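(* For all integers $k>\ell>1$, there exist two $k$-graphs $F_1$ and $F_2$ (each with at least one edge) such that \[0<\gamma^{(k)}_\ell(\{F_1,F_2\})<\min\{\gamma^{(k)}_\ell(F_1),\gamma^{(k)}_\ell(F_2)\}.\]
   Context: A $k$-graph is a pair $H=(V,E)$ with $V$ a finite set and $E\subseteq\binom{V}{k}$. For $0<\ell<k$ and $T\in\binom{V(H)}{\ell}$, the degree $d_H(T)$ is the number of $(k-\ell)$-sets $T'\subseteq V(H)\setminus T$ with $T\cup T'\in E(H)$; the minimum $\ell$-degree is $\delta_\ell(H)=\min\{d_H(T):T\in\binom{V(H)}{\ell}\}$. For a nonempty family $\mathcal F$ of $k$-graphs, each having at least one edge, a $k$-graph is $\mathcal F$-free if it contains no member of $\mathcal F$ as a (not necessarily induced) subgraph. Let $\mathrm{ex}^{(k)}_\ell(n,\mathcal F)$ be the maximum of $\delta_\ell(H)$ over all $n$-vertex $\mathcal F$-free $k$-graphs $H$. The $\ell$-degree Turán density is \[\gamma^{(k)}_\ell(\mathcal F)=\lim_{n\to\infty}\frac{\mathrm{ex}^{(k)}_\ell(n,\mathcal F)}{\binom{n-\ell}{k-\ell}},\] and this limit is known to exist. For a single $k$-graph $F$, $\gamma^{(k)}_\ell(F)=\gamma^{(k)}_\ell(\{F\})$. *)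

theory Defs
  imports Complex_Main "HOL-Library.Ramsey"
begin

type_synonym 'a hypergraph = "'a set \<times> 'a set set"

abbreviation verts :: "'a hypergraph \<Rightarrow> 'a set" where
  "verts \<equiv> fst"

abbreviation edges :: "'a hypergraph \<Rightarrow> 'a set set" where
  "edges \<equiv> snd"

definition kgraph :: "nat \<Rightarrow> 'a hypergraph \<Rightarrow> bool" where
  "kgraph k H \<longleftrightarrow> finite (verts H) \<and> edges H \<subseteq> nsets (verts H) k"

definition degree :: "nat \<Rightarrow> 'a hypergraph \<Rightarrow> 'a set \<Rightarrow> nat" where
  "degree k H T = card {T' \<in> nsets (verts H - T) (k - card T). T \<union> T' \<in> edges H}"

text \<open>The value is meaningful only if \<open>H\<close> has at least \<open>l\<close> vertices; otherwise the
  minimum is taken over the empty set.\<close>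

definition min_degree :: "nat \<Rightarrow> nat \<Rightarrow> 'a hypergraph \<Rightarrow> nat" where
  "min_degree k l H = Min (degree k H ` nsets (verts H) l)"

text \<open>Containment as a (not necessarily induced) subgraph is up to isomorphism: the map \<open>f\<close>
  embeds a copy of \<open>F\<close> into \<open>H\<close>.\<close>

definition contains_copy :: "'b hypergraph \<Rightarrow> 'a hypergraph \<Rightarrow> bool" where
  "contains_copy H F \<longleftrightarrow>
     (\<exists>f. inj_on f (verts F) \<and> f ` verts F \<subseteq> verts H \<and> (\<forall>e\<in>edges F. f ` e \<in> edges H))"

definition family_free :: "'a hypergraph set \<Rightarrow> 'b hypergraph \<Rightarrow> bool" where
  "family_free \<F> H \<longleftrightarrow> (\<forall>F\<in>\<F>. \<not> contains_copy H F)"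

text \<open>Host graphs may be taken to live on natural numbers, since every finite \<open>k\<close>-graph is
  isomorphic to such a one. If every member of \<open>\<F>\<close> has an edge, then the edgeless \<open>n\<close>-vertex
  \<open>k\<close>-graph is \<open>\<F>\<close>-free, so for \<open>n \<ge> l\<close> the maximum ranges over a nonempty set, which is
  finite because all degrees are bounded by \<open>(n - l) choose (k - l)\<close>.\<close>

definition ex_deg :: "nat \<Rightarrow> nat \<Rightarrow> nat \<Rightarrow> 'a hypergraph set \<Rightarrow> nat" where
  "ex_deg k l n \<F> =
     Max {min_degree k l H | H :: nat hypergraph.
            kgraph k H \<and> card (verts H) = n \<and> family_free \<F> H}"

text \<open>The finitely many \<open>n < l\<close>, where \<open>n - l\<close> is truncated, do not affect the limit.\<close>

definition turan_density :: "nat \<Rightarrow> nat \<Rightarrow> 'a hypergraph set \<Rightarrow> real" where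
  "turan_density k l \<F> =
     lim (\<lambda>n. real (ex_deg k l n \<F>) / real ((n - l) choose (k - l)))"

end

theory Submission
  imports Defs "HOL-Library.FuncSet" "HOL-Computational_Algebra.Primes"
begin

text \<open>
  Write \<open>r = k - l\<close>. The link of an \<open>l\<close>-set \<open>S\<close> is the family of \<open>r\<close>-sets \<open>R\<close> such that \<open>S \<union> R\<close>
  is an edge; its size is the degree of \<open>S\<close>. The two \<open>k\<close>-graphs are chosen so that a host whose
  links all have density about one half is forced to contain one of them, while each of them alone
  can be avoided at density one half.

  The clique cone consists of an \<open>r\<close>-set \<open>R\<close> and a \<open>q\<close>-set \<open>Q\<close>, with all edges \<open>R \<union> S\<close> for
  \<open>l\<close>-subsets \<open>S\<close> of \<open>Q\<close>. The linked grid consists of a complete \<open>k\<close>-partite \<open>k\<close>-graph with parts of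
  size \<open>2 * l\<close>, each part cut into two halves of size \<open>l\<close>. The first halves form the core, the second
  halves are the blocks. For every block \<open>B\<close> and every \<open>l\<close>-subset \<open>S\<close> of the core it has \<open>r\<close> new
  vertices \<open>R\<close> and the edges \<open>S \<union> R\<close> and \<open>B \<union> R\<close>.

  Upper bound for the pair (\<open>linked_grid_or_clique_cone\<close>). Let all degrees be at least \<open>1/2 - \<eta>\<close>
  of the maximum. The host is dense, so it contains a complete \<open>k\<close>-partite \<open>k\<close>-graph with huge parts.
  Fix a core in it. Call two \<open>l\<close>-sets linked if their links share at least a proportion \<open>\<eta>\<close> of all
  \<open>r\<close>-sets. If every part contains an \<open>l\<close>-set that is linked to all \<open>l\<close>-subsets of the core, the connecting
  \<open>r\<close>-sets can be chosen disjointly and the linked grid appears. Otherwise Ramsey's theorem yields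
  an \<open>l\<close>-set \<open>S'\<close> and a set \<open>Q\<close> of \<open>q\<close> vertices such that no \<open>l\<close>-subset of \<open>Q\<close> is linked to \<open>S'\<close>.
  Since links fill almost half of everything, each \<open>l\<close>-subset of \<open>Q\<close> then has almost the same link,
  namely the complement of the link of \<open>S'\<close>. So these links have a common member, which forms a
  clique cone with \<open>Q\<close>. As \<open>\<eta>\<close> only depends on \<open>k\<close>, \<open>l\<close>, \<open>q\<close>, the density of the pair is below \<open>1/2\<close>.

  Hosts without the linked grid (\<open>bicolouring_pattern\<close>, \<open>linked_grid_not_bicoloured\<close>). Colour a
  proportion \<open>p\<close> of the vertices red, and let a \<open>k\<close>-set be an edge if its number of red vertices lies
  in a set \<open>J\<close>. If neither \<open>0\<close> nor \<open>k\<close> is in \<open>J\<close>, a copy of the grid has a core with many vertices of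
  both colours and a block without red vertices. If moreover \<open>J\<close> does not contain both \<open>b\<close> and \<open>s + b\<close>
  for any \<open>b \<le> r\<close>, then that block and an \<open>l\<close>-subset of the core with \<open>s\<close> red vertices have disjoint links, so there is
  no such copy. One can choose \<open>J\<close>, \<open>p\<close> and \<open>s\<close> such that moreover all degrees are at least half of the
  maximum, asymptotically; this uses \<open>l > 1\<close>.

  Hosts without the clique cone (\<open>clique_cone_free_of_hash\<close>, \<open>degree_hash_filter_ge\<close>). Every vertex
  \<open>v\<close> sorts the others into \<open>m\<close> buckets by a hash function. Forbid the \<open>k\<close>-sets that contain a vertex
  \<open>v\<close> together with \<open>l\<close> other vertices in a common bucket of \<open>v\<close>. A clique cone with
  \<open>q > m * (l - 1)\<close> dies by the pigeonhole principle. For large \<open>m\<close> this costs every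
  \<open>l\<close>-set at most a quarter of all \<open>r\<close>-sets. Here \<open>l > 1\<close> is used again: for
  \<open>l = 1\<close> every \<open>k\<close>-set would be forbidden. Imposing both conditions gives hosts without either graph and with positive density.

  Finally, all these bounds concern large hosts and become statements about the densities once the
  limit is known to exist (\<open>ratio_tendsto\<close>). It exists since a random bounded sample of a large host
  inherits its normalised degrees, up to an error that is exponentially unlikely.
\<close>

section \<open>Bounded differences\<close>

lemma exp_le_quadratic:
  fixes x :: real
  assumes "\<bar>x\<bar> \<le> 1"
  shows "exp x \<le> 1 + x + x\<^sup>2"
proof (cases "0 \<le> x")
  case True
  then show ?thesis using assms exp_bound[of x] by simp
next
  case False
  define y where "y = - x"
  have y: "0 \<le> y" "y \<le> 1" using False assms by (auto simp: y_def)
  have "1 \<le> 1 + y\<^sup>2 / 2 + y ^ 3 / 2 + y ^ 4 / 2" using y by simp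
  also have "\<dots> = (1 - y + y\<^sup>2) * (1 + y + y\<^sup>2 / 2)"
    by (simp add: field_simps power2_eq_square power3_eq_cube power4_eq_xxxx)
  also have "\<dots> \<le> (1 - y + y\<^sup>2) * exp y"
    using exp_lower_Taylor_quadratic[OF y(1)] y
    by (intro mult_left_mono) auto
  finally have "exp (- y) \<le> 1 - y + y\<^sup>2"
    by (simp add: exp_minus field_simps)
  then show ?thesis by (simp add: y_def)
qed

text \<open>Hoeffding's lemma with a worse constant.\<close>

lemma sum_exp_centred_le:
  fixes h :: "'a \<Rightarrow> real"
  assumes "finite V" "sum h V = 0" and h: "\<And>v. v \<in> V \<Longrightarrow> \<bar>h v\<bar> \<le> d" and d: "0 \<le> d" "d \<le> 1"
  shows "(\<Sum>v\<in>V. exp (h v)) \<le> real (card V) * exp (d\<^sup>2)"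
proof -
  have "(\<Sum>v\<in>V. exp (h v)) \<le> (\<Sum>v\<in>V. (1 + d\<^sup>2) + h v)"
  proof (rule sum_mono)
    fix v assume v: "v \<in> V"
    have "exp (h v) \<le> 1 + h v + (h v)\<^sup>2"
      using h[OF v] d by (intro exp_le_quadratic) auto
    also have "(h v)\<^sup>2 \<le> d\<^sup>2" using h[OF v] d by (metis abs_le_square_iff abs_of_nonneg)
    finally show "exp (h v) \<le> (1 + d\<^sup>2) + h v" by simp
  qed
  also have "\<dots> = real (card V) * (1 + d\<^sup>2)"
    by (simp add: sum.distrib assms(2) algebra_simps)
  also have "\<dots> \<le> real (card V) * exp (d\<^sup>2)"
    by (intro mult_left_mono) (auto simp: exp_ge_add_one_self)
  finally show ?thesis .
qed

lemma sum_PiE_insert: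
  assumes "i \<notin> I"
  shows "(\<Sum>x\<in>PiE (insert i I) (\<lambda>_. V). F x) = (\<Sum>x\<in>PiE I (\<lambda>_. V). \<Sum>v\<in>V. F (x(i := v)))"
proof -
  have "(\<Sum>x\<in>PiE (insert i I) (\<lambda>_. V). F x)
      = (\<Sum>(v, x)\<in>V \<times> PiE I (\<lambda>_. V). F (x(i := v)))"
    unfolding PiE_insert_eq using inj_combinator[OF assms, of "\<lambda>_. V"]
    by (simp add: sum.reindex case_prod_unfold)
  also have "\<dots> = (\<Sum>v\<in>V. \<Sum>x\<in>PiE I (\<lambda>_. V). F (x(i := v)))"
    by (simp add: sum.cartesian_product)
  also have "\<dots> = (\<Sum>x\<in>PiE I (\<lambda>_. V). \<Sum>v\<in>V. F (x(i := v)))"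
    by (rule sum.swap)
  finally show ?thesis .
qed

text \<open>The exponential moment behind McDiarmid's inequality, for the uniform measure on functions from \<open>I\<close>
  to \<open>V\<close>. Averaging over one coordinate gives a function of the remaining ones with the same mean and
  the same bounded differences, and the error made by averaging is centred. So every coordinate
  contributes one factor \<open>exp ((u * c)\<^sup>2)\<close>.\<close>

lemma bounded_differences_exp_moment:
  fixes f :: "('i \<Rightarrow> 'a) \<Rightarrow> real"
  assumes "finite I" and V: "finite V" "V \<noteq> {}"
    and "\<And>x i v. x \<in> PiE I (\<lambda>_. V) \<Longrightarrow> i \<in> I \<Longrightarrow> v \<in> V \<Longrightarrow> \<bar>f (x(i := v)) - f x\<bar> \<le> c"
    and c: "0 \<le> c" and u: "0 \<le> u" "u * c \<le> 1"
    and "\<mu> * real (card V) ^ card I = (\<Sum>x\<in>PiE I (\<lambda>_. V). f x)"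
  shows "(\<Sum>x\<in>PiE I (\<lambda>_. V). exp (u * (\<mu> - f x)))
           \<le> real (card V) ^ card I * exp (real (card I) * (u * c)\<^sup>2)"
  using assms(1,4,8)
proof (induction I arbitrary: f rule: finite_induct)
  case empty
  then show ?case by simp
next
  case (insert i I)
  note bd = insert.prems(1)
  define g where "g x = (\<Sum>v\<in>V. f (x(i := v))) / real (card V)" for x
  have n: "real (card V) > 0" using V by (simp add: card_gt_0_iff)
  have upd: "x(i := v) \<in> PiE (insert i I) (\<lambda>_. V)" if "x \<in> PiE I (\<lambda>_. V)" "v \<in> V" for x v
    using that by (auto simp: PiE_iff extensional_def)
  have gb: "\<bar>g (x(j := w)) - g x\<bar> \<le> c" if x: "x \<in> PiE I (\<lambda>_. V)" and j: "j \<in> I" and w: "w \<in> V" for x j w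
  proof -
    have ji: "j \<noteq> i" using j insert.hyps by auto
    have "\<bar>g (x(j := w)) - g x\<bar> = \<bar>\<Sum>v\<in>V. f ((x(i := v))(j := w)) - f (x(i := v))\<bar> / real (card V)"
      using ji n by (simp add: g_def fun_upd_twist sum_subtractf diff_divide_distrib[symmetric] abs_divide)
    also have "\<dots> \<le> (\<Sum>v\<in>V. \<bar>f ((x(i := v))(j := w)) - f (x(i := v))\<bar>) / real (card V)"
      by (intro divide_right_mono sum_abs) auto
    also have "\<dots> \<le> (\<Sum>v\<in>V. c) / real (card V)"
    proof (intro divide_right_mono sum_mono)
      fix v assume "v \<in> V"
      then show "\<bar>f ((x(i := v))(j := w)) - f (x(i := v))\<bar> \<le> c"
        by (intro bd upd x w) (use j in auto)
    qed auto
    also have "\<dots> = c" using n by simp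
    finally show ?thesis .
  qed
  have mean: "\<mu> * real (card V) ^ card I = (\<Sum>x\<in>PiE I (\<lambda>_. V). g x)"
  proof -
    have "\<mu> * real (card V) ^ card I * real (card V) = (\<Sum>x\<in>PiE (insert i I) (\<lambda>_. V). f x)"
      using insert.prems(2) insert.hyps by (simp add: mult_ac)
    also have "\<dots> = (\<Sum>x\<in>PiE I (\<lambda>_. V). g x) * real (card V)"
      using insert.hyps n by (simp add: sum_PiE_insert g_def sum_divide_distrib[symmetric])
    finally show ?thesis using n by simp
  qed
  have IH: "(\<Sum>x\<in>PiE I (\<lambda>_. V). exp (u * (\<mu> - g x)))
           \<le> real (card V) ^ card I * exp (real (card I) * (u * c)\<^sup>2)"
    by (rule insert.IH[OF gb mean])
  have inner: "(\<Sum>v\<in>V. exp (u * (g x - f (x(i := v))))) \<le> real (card V) * exp ((u * c)\<^sup>2)"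
    if x: "x \<in> PiE I (\<lambda>_. V)" for x
  proof (rule sum_exp_centred_le)
    show "(\<Sum>v\<in>V. u * (g x - f (x(i := v)))) = 0"
      using n by (simp add: sum_distrib_left[symmetric] sum_subtractf g_def)
    fix v assume v: "v \<in> V"
    have "\<bar>g x - f (x(i := v))\<bar> = \<bar>\<Sum>w\<in>V. f ((x(i := v))(i := w)) - f (x(i := v))\<bar> / real (card V)"
      using n by (simp add: g_def sum_subtractf field_simps abs_mult[symmetric])
    also have "\<dots> \<le> (\<Sum>w\<in>V. \<bar>f ((x(i := v))(i := w)) - f (x(i := v))\<bar>) / real (card V)"
      by (intro divide_right_mono sum_abs) auto
    also have "\<dots> \<le> (\<Sum>w\<in>V. c) / real (card V)"
      by (intro divide_right_mono sum_mono bd upd x v) auto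
    also have "\<dots> = c" using n by simp
    finally show "\<bar>u * (g x - f (x(i := v)))\<bar> \<le> u * c"
      using u by (simp add: abs_mult mult_left_mono)
  qed (use V c u in auto)
  have "(\<Sum>x\<in>PiE (insert i I) (\<lambda>_. V). exp (u * (\<mu> - f x)))
      = (\<Sum>x\<in>PiE I (\<lambda>_. V). exp (u * (\<mu> - g x)) * (\<Sum>v\<in>V. exp (u * (g x - f (x(i := v))))))"
    using insert.hyps
    by (simp add: sum_PiE_insert sum_distrib_left exp_add[symmetric] algebra_simps)
  also have "\<dots> \<le> (\<Sum>x\<in>PiE I (\<lambda>_. V). exp (u * (\<mu> - g x)) * (real (card V) * exp ((u * c)\<^sup>2)))"
    by (intro sum_mono mult_left_mono inner) auto
  also have "\<dots> = (\<Sum>x\<in>PiE I (\<lambda>_. V). exp (u * (\<mu> - g x))) * (real (card V) * exp ((u * c)\<^sup>2))"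
    by (simp add: sum_distrib_right)
  also have "\<dots> \<le> (real (card V) ^ card I * exp (real (card I) * (u * c)\<^sup>2)) * (real (card V) * exp ((u * c)\<^sup>2))"
    by (intro mult_right_mono IH) auto
  also have "\<dots> = real (card V) ^ card (insert i I) * exp (real (card (insert i I)) * (u * c)\<^sup>2)"
    using insert.hyps by (simp add: exp_add[symmetric] algebra_simps)
  finally show ?case .
qed

text \<open>Markov's inequality for the exponential moment.\<close>

lemma bounded_differences_tail:
  fixes f :: "('i \<Rightarrow> 'a) \<Rightarrow> real"
  assumes "finite I" and V: "finite V" "V \<noteq> {}"
    and bd: "\<And>x i v. x \<in> PiE I (\<lambda>_. V) \<Longrightarrow> i \<in> I \<Longrightarrow> v \<in> V \<Longrightarrow> \<bar>f (x(i := v)) - f x\<bar> \<le> c"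
    and c: "0 \<le> c" and u: "0 \<le> u" "u * c \<le> 1"
    and mean: "\<mu> * real (card V) ^ card I = (\<Sum>x\<in>PiE I (\<lambda>_. V). f x)"
  shows "real (card {x \<in> PiE I (\<lambda>_. V). f x \<le> \<mu> - s})
           \<le> real (card V) ^ card I * exp (real (card I) * (u * c)\<^sup>2 - u * s)"
proof -
  let ?B = "{x \<in> PiE I (\<lambda>_. V). f x \<le> \<mu> - s}"
  have fin: "finite (PiE I (\<lambda>_. V))" using assms(1) V by (simp add: finite_PiE)
  have "real (card ?B) * exp (u * s) = (\<Sum>x\<in>?B. exp (u * s))" by simp
  also have "\<dots> \<le> (\<Sum>x\<in>?B. exp (u * (\<mu> - f x)))"
    using u by (intro sum_mono) (auto intro!: mult_left_mono)
  also have "\<dots> \<le> (\<Sum>x\<in>PiE I (\<lambda>_. V). exp (u * (\<mu> - f x)))"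
    using fin by (intro sum_mono2) auto
  also have "\<dots> \<le> real (card V) ^ card I * exp (real (card I) * (u * c)\<^sup>2)"
    by (rule bounded_differences_exp_moment[OF assms])
  finally have "real (card ?B) \<le> real (card V) ^ card I * exp (real (card I) * (u * c)\<^sup>2) / exp (u * s)"
    by (simp add: field_simps)
  then show ?thesis by (simp add: exp_diff)
qed

section \<open>Random samples of a hypergraph\<close>

text \<open>The degree of a fixed \<open>l\<close>-set in a random sample: \<open>I\<close> indexes the remaining sample points, and \<open>L\<close>
  is the link of the \<open>l\<close>-set in the host. Samples may repeat points, hence the injectivity on \<open>R\<close>.\<close>

definition link_hits :: "'i set \<Rightarrow> nat \<Rightarrow> 'a set set \<Rightarrow> ('i \<Rightarrow> 'a) \<Rightarrow> nat" where
  "link_hits I r L y = card {R \<in> nsets I r. inj_on y R \<and> y ` R \<in> L}"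

lemma card_bijections_onto_set:
  assumes "finite R" "finite B" "card R = card B"
  shows "card {z \<in> PiE R (\<lambda>_. B). inj_on z R} = fact (card R)"
  using card_inj_on_subset_funcset[of R B R] assms
  by (simp add: fact_prod_rev)

lemma card_labellings_onto:
  assumes "finite R" "finite V" "L \<subseteq> nsets V (card R)"
  shows "card {z \<in> PiE R (\<lambda>_. V). inj_on z R \<and> z ` R \<in> L} = card L * fact (card R)"
proof -
  have finL: "finite L" using assms finite_imp_finite_nsets finite_subset by metis
  have eq: "{z \<in> PiE R (\<lambda>_. V). inj_on z R \<and> z ` R \<in> L}
      = (\<Union>B\<in>L. {z \<in> PiE R (\<lambda>_. B). inj_on z R})" (is "?l = ?r")
  proof
    show "?l \<subseteq> ?r" by (auto simp: PiE_iff)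
    show "?r \<subseteq> ?l"
    proof
      fix z assume "z \<in> ?r"
      then obtain B where B: "B \<in> L" "z \<in> PiE R (\<lambda>_. B)" "inj_on z R" by auto
      have B': "finite B" "card B = card R" "B \<subseteq> V"
        using B(1) assms(3) by (auto simp: nsets_def)
      have "z ` R = B"
        using B B' by (intro card_subset_eq) (auto simp: card_image)
      then show "z \<in> ?l" using B B' by (auto simp: PiE_iff)
    qed
  qed
  have "card ?r = (\<Sum>B\<in>L. card {z \<in> PiE R (\<lambda>_. B). inj_on z R})"
  proof (rule card_UN_disjoint[OF finL])
    show "\<forall>B\<in>L. finite {z \<in> PiE R (\<lambda>_. B). inj_on z R}"
    proof
      fix B assume "B \<in> L"
      then have "finite B" using assms(3) by (auto simp: nsets_def)
      then have "finite (PiE R (\<lambda>_. B))" using assms(1) by (simp add: finite_PiE)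
      then show "finite {z \<in> PiE R (\<lambda>_. B). inj_on z R}" by simp
    qed
    show "\<forall>B\<in>L. \<forall>C\<in>L. B \<noteq> C \<longrightarrow> {z \<in> PiE R (\<lambda>_. B). inj_on z R} \<inter> {z \<in> PiE R (\<lambda>_. C). inj_on z R} = {}"
    proof (intro ballI impI, rule ccontr)
      fix B C assume BC: "B \<in> L" "C \<in> L" "B \<noteq> C"
        and "{z \<in> PiE R (\<lambda>_. B). inj_on z R} \<inter> {z \<in> PiE R (\<lambda>_. C). inj_on z R} \<noteq> {}"
      then obtain z where z: "z \<in> PiE R (\<lambda>_. B)" "z \<in> PiE R (\<lambda>_. C)" "inj_on z R" by auto
      have "finite B" "card B = card R" "finite C" "card C = card R"
        using BC assms(3) by (auto simp: nsets_def)
      moreover have "z ` R \<subseteq> B" "z ` R \<subseteq> C" using z by auto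
      ultimately have "z ` R = B" "z ` R = C"
        using z(3) by (simp_all add: card_subset_eq card_image)
      then show False using BC by simp
    qed
  qed
  also have "\<dots> = (\<Sum>B\<in>L. fact (card R))"
    using assms by (intro sum.cong refl card_bijections_onto_set) (auto simp: nsets_def)
  finally show ?thesis using eq by simp
qed

lemma card_PiE_restrict:
  assumes "finite I" "R \<subseteq> I" "finite V"
    and P: "\<And>y. P y \<longleftrightarrow> P (restrict y R)"
  shows "card {y \<in> PiE I (\<lambda>_. V). P y}
    = card {z \<in> PiE R (\<lambda>_. V). P z} * card V ^ (card I - card R)"
proof -
  have fR: "finite R" using assms finite_subset by auto
  have "bij_betw (\<lambda>(z, w) i. if i \<in> R then z i else w i)
     ({z \<in> PiE R (\<lambda>_. V). P z} \<times> PiE (I - R) (\<lambda>_. V)) {y \<in> PiE I (\<lambda>_. V). P y}"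
  proof (rule bij_betw_byWitness[where f' = "\<lambda>y. (restrict y R, restrict y (I - R))"])
    show "\<forall>a\<in>{z \<in> PiE R (\<lambda>_. V). P z} \<times> PiE (I - R) (\<lambda>_. V).
      (\<lambda>y. (restrict y R, restrict y (I - R))) ((\<lambda>(z, w) i. if i \<in> R then z i else w i) a) = a"
      by (auto simp: fun_eq_iff restrict_def PiE_iff extensional_def)
    show "\<forall>a'\<in>{y \<in> PiE I (\<lambda>_. V). P y}.
      (\<lambda>(z, w) i. if i \<in> R then z i else w i) ((\<lambda>y. (restrict y R, restrict y (I - R))) a') = a'"
      using assms(2) by (auto simp: fun_eq_iff restrict_def PiE_iff extensional_def)
    show "(\<lambda>(z, w) i. if i \<in> R then z i else w i) `
      ({z \<in> PiE R (\<lambda>_. V). P z} \<times> PiE (I - R) (\<lambda>_. V)) \<subseteq> {y \<in> PiE I (\<lambda>_. V). P y}"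
    proof clarsimp
      fix z w assume z: "z \<in> PiE R (\<lambda>_. V)" "P z" and w: "w \<in> PiE (I - R) (\<lambda>_. V)"
      have "restrict (\<lambda>i. if i \<in> R then z i else w i) R = restrict z R"
        by (auto simp: restrict_def fun_eq_iff)
      then have "P (\<lambda>i. if i \<in> R then z i else w i)" using z P by metis
      moreover have "(\<lambda>i. if i \<in> R then z i else w i) \<in> PiE I (\<lambda>_. V)"
        using z w assms(2) by (auto simp: PiE_iff extensional_def)
      ultimately show "(\<lambda>i. if i \<in> R then z i else w i) \<in> PiE I (\<lambda>_. V) \<and> P (\<lambda>i. if i \<in> R then z i else w i)"
        by simp
    qed
    show "(\<lambda>y. (restrict y R, restrict y (I - R))) ` {y \<in> PiE I (\<lambda>_. V). P y}
      \<subseteq> {z \<in> PiE R (\<lambda>_. V). P z} \<times> PiE (I - R) (\<lambda>_. V)"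
    proof (intro image_subsetI, elim CollectE conjE, intro SigmaI CollectI conjI)
      fix y assume y: "y \<in> PiE I (\<lambda>_. V)" "P y"
      show "restrict y R \<in> PiE R (\<lambda>_. V)" "restrict y (I - R) \<in> PiE (I - R) (\<lambda>_. V)"
        using y(1) assms(2) by (auto simp: PiE_iff)
      show "P (restrict y R)" using y(2) P by blast
    qed
  qed
  from bij_betw_same_card[OF this] show ?thesis
    using assms fR by (simp add: card_cartesian_product card_funcsetE card_Diff_subset)
qed

text \<open>Linearity of expectation, with all counts multiplied by the number of samples.\<close>

lemma sum_link_hits:
  assumes "finite I" "finite V" "L \<subseteq> nsets V r"
  shows "(\<Sum>y\<in>PiE I (\<lambda>_. V). link_hits I r L y)
    = (card I choose r) * (card L * fact r * card V ^ (card I - r))"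
proof -
  have finP: "finite (PiE I (\<lambda>_. V))" using assms by (simp add: finite_PiE)
  have finN: "finite (nsets I r)" using assms by (simp add: finite_imp_finite_nsets)
  have "(\<Sum>y\<in>PiE I (\<lambda>_. V). link_hits I r L y)
     = (\<Sum>y\<in>PiE I (\<lambda>_. V). \<Sum>R\<in>nsets I r. if inj_on y R \<and> y ` R \<in> L then 1 else 0)"
    unfolding link_hits_def using finN by (simp add: sum.If_cases Int_def)
  also have "\<dots> = (\<Sum>R\<in>nsets I r. \<Sum>y\<in>PiE I (\<lambda>_. V). if inj_on y R \<and> y ` R \<in> L then 1 else 0)"
    by (rule sum.swap)
  also have "\<dots> = (\<Sum>R\<in>nsets I r. card {y \<in> PiE I (\<lambda>_. V). inj_on y R \<and> y ` R \<in> L})"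
    using finP by (simp add: sum.If_cases Int_def)
  also have "\<dots> = (\<Sum>R\<in>nsets I r. card L * fact r * card V ^ (card I - r))"
  proof (rule sum.cong[OF refl])
    fix R assume "R \<in> nsets I r"
    then have R: "R \<subseteq> I" "finite R" "card R = r" by (auto simp: nsets_def)
    have "card {y \<in> PiE I (\<lambda>_. V). inj_on y R \<and> y ` R \<in> L}
       = card {z \<in> PiE R (\<lambda>_. V). inj_on z R \<and> z ` R \<in> L} * card V ^ (card I - card R)"
      by (rule card_PiE_restrict) (use assms R in \<open>auto simp: inj_on_def\<close>)
    then show "card {y \<in> PiE I (\<lambda>_. V). inj_on y R \<and> y ` R \<in> L} = card L * fact r * card V ^ (card I - r)"
      using card_labellings_onto[OF R(2) assms(2), of L] assms R by simp
  qed
  finally show ?thesis by simp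
qed

lemma card_nsets_containing:
  assumes "finite I" "i \<in> I" "0 < r"
  shows "card {R \<in> nsets I r. i \<in> R} = (card I - 1) choose (r - 1)"
proof -
  have "{R \<in> nsets I r. i \<in> R} = insert i ` nsets (I - {i}) (r - 1)" (is "?l = ?r")
  proof
    show "?l \<subseteq> ?r"
    proof
      fix R assume R: "R \<in> ?l"
      then have "R = insert i (R - {i})" "R - {i} \<in> nsets (I - {i}) (r - 1)"
        by (auto simp: nsets_def)
      then show "R \<in> ?r" by blast
    qed
    show "?r \<subseteq> ?l" using assms by (auto simp: nsets_def card_insert_if)
  qed
  moreover have "inj_on (insert i) (nsets (I - {i}) (r - 1))"
    by (rule inj_onI) (auto simp: nsets_def)
  ultimately show ?thesis using assms by (simp add: card_image)
qed

text \<open>Resampling the point \<open>i\<close> only affects the \<open>r\<close>-sets of indices that contain \<open>i\<close>.\<close>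

lemma link_hits_bounded_differences:
  assumes "finite I" "i \<in> I" "0 < r"
  shows "\<bar>real (link_hits I r L (y(i := v))) - real (link_hits I r L y)\<bar>
    \<le> real ((card I - 1) choose (r - 1))"
proof -
  define A where "A y = {R \<in> nsets I r. inj_on y R \<and> y ` R \<in> L}" for y
  define C where "C = {R \<in> nsets I r. i \<in> R}"
  have fin: "finite (nsets I r)" using assms by (simp add: finite_imp_finite_nsets)
  have finA: "finite (A y)" for y using fin by (simp add: A_def)
  have finC: "finite C" using fin by (simp add: C_def)
  have same: "R \<in> A (y(i := v)) \<longleftrightarrow> R \<in> A y" if "R \<notin> C" for R
  proof (cases "R \<in> nsets I r")
    case True
    then have "i \<notin> R" using that by (simp add: C_def)
    then have "inj_on (y(i := v)) R = inj_on y R" "(y(i := v)) ` R = y ` R"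
      by (auto simp: inj_on_def)
    then show ?thesis by (simp add: A_def)
  qed (simp add: A_def)
  have le: "card (A y) \<le> card (A z) + card C"
    if "\<And>R. R \<notin> C \<Longrightarrow> R \<in> A y \<longleftrightarrow> R \<in> A z" for y z
  proof -
    have "A y \<subseteq> A z \<union> C" using that by auto
    then have "card (A y) \<le> card (A z \<union> C)" using finA finC by (intro card_mono) auto
    also have "\<dots> \<le> card (A z) + card C" by (rule card_Un_le)
    finally show ?thesis .
  qed
  have "card (A (y(i := v))) \<le> card (A y) + card C" "card (A y) \<le> card (A (y(i := v))) + card C"
    using le same by blast+
  then show ?thesis
    using card_nsets_containing[OF assms] by (simp add: link_hits_def A_def C_def)
qed

text \<open>The error probability decays exponentially in the sample size, because the maximal change \<open>c\<close> per
  coordinate is only the fraction \<open>r / card I\<close> of the range of the count.\<close>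

lemma link_hits_tail:
  assumes I: "finite I" and V: "finite V" "V \<noteq> {}" and L: "L \<subseteq> nsets V r"
    and r: "0 < r" "r \<le> card I" and e: "0 \<le> e" "e \<le> 1"
    and d: "d * real (card V) ^ r \<le> real (card L) * fact r"
  shows "real (card {y \<in> PiE I (\<lambda>_. V). real (link_hits I r L y) \<le> (d - e) * real (card I choose r)})
     \<le> real (card V) ^ card I * exp (- (real (card I) * (e / (2 * real r))\<^sup>2))"
proof -
  define c where "c = real ((card I - 1) choose (r - 1))"
  define M where "M = real (card I)"
  define \<mu> where "\<mu> = real (card I choose r) * (real (card L) * fact r / real (card V) ^ r)"
  \<comment> \<open>The exponent that minimises the tail bound, given that a coordinate changes the count by \<open>c\<close>.\<close>
  define u where "u = e / (2 * real r) / c"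
  define s where "s = e * real (card I choose r)"
  have n: "real (card V) > 0" using V by (simp add: card_gt_0_iff)
  have c: "c > 0" using r by (simp add: c_def)
  have absorb: "real r * real (card I choose r) = M * c"
  proof -
    have "r * (card I choose r) = card I * ((card I - 1) choose (r - 1))"
      using times_binomial_minus1_eq[OF r(1), of "card I"] by simp
    then show ?thesis unfolding M_def c_def of_nat_mult[symmetric] by simp
  qed
  have "real (card V) ^ card I = real (card V) ^ r * real (card V) ^ (card I - r)"
    using r by (simp add: power_add[symmetric])
  then have mean: "\<mu> * real (card V) ^ card I = (\<Sum>y\<in>PiE I (\<lambda>_. V). real (link_hits I r L y))"
    using sum_link_hits[OF I V(1) L] n unfolding of_nat_sum[symmetric]
    by (simp add: \<mu>_def)
  have dm: "d * real (card I choose r) \<le> \<mu>"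
    using d n unfolding \<mu>_def by (subst mult.commute, intro mult_left_mono) (simp_all add: field_simps)
  have "{y \<in> PiE I (\<lambda>_. V). real (link_hits I r L y) \<le> (d - e) * real (card I choose r)}
     \<subseteq> {y \<in> PiE I (\<lambda>_. V). real (link_hits I r L y) \<le> \<mu> - s}"
    using dm by (auto simp: s_def algebra_simps)
  then have "real (card {y \<in> PiE I (\<lambda>_. V). real (link_hits I r L y) \<le> (d - e) * real (card I choose r)})
     \<le> real (card {y \<in> PiE I (\<lambda>_. V). real (link_hits I r L y) \<le> \<mu> - s})"
    using I V by (intro of_nat_mono card_mono) (auto simp: finite_PiE)
  also have "\<dots> \<le> real (card V) ^ card I * exp (real (card I) * (u * c)\<^sup>2 - u * s)"
  proof (rule bounded_differences_tail[OF I V _ _ _ _ mean])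
    show "u * c \<le> 1" using c e r by (simp add: u_def field_simps)
    show "\<bar>real (link_hits I r L (x(i := v))) - real (link_hits I r L x)\<bar> \<le> c"
      if "i \<in> I" for x i v
      unfolding c_def using that I r by (intro link_hits_bounded_differences) auto
  qed (use c e r in \<open>auto simp: u_def\<close>)
  also have "real (card I) * (u * c)\<^sup>2 - u * s = - (real (card I) * (e / (2 * real r))\<^sup>2)"
  proof -
    have uc: "u * c = e / (2 * real r)" using c by (simp add: u_def)
    have "u * s = u * (e / real r) * (M * c)"
      using absorb r by (simp add: s_def field_simps)
    also have "\<dots> = M * (2 * (u * c) * (u * c))" using uc by (simp add: algebra_simps)
    finally have "u * s = 2 * M * (u * c)\<^sup>2" by (simp add: power2_eq_square algebra_simps)
    then show ?thesis using uc by (simp add: M_def)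
  qed
  finally show ?thesis .
qed

text \<open>Union bound over the pairs of equal sample points. For a bounded sample size this is a vanishing
  proportion of all samples as \<open>V\<close> grows.\<close>

lemma card_noninjective_le:
  assumes "finite I" "finite V"
  shows "card {x \<in> PiE I (\<lambda>_. V). \<not> inj_on x I} \<le> card I ^ 2 * card V ^ (card I - 1)"
proof -
  define D where "D = {(i, j). i \<in> I \<and> j \<in> I \<and> i \<noteq> j}"
  define B where "B p = {x \<in> PiE I (\<lambda>_. V). x (fst p) = x (snd p)}" for p
  have sub: "D \<subseteq> I \<times> I" by (auto simp: D_def)
  have D: "finite D" using finite_subset[OF sub] assms(1) by simp
  have cD: "card D \<le> card I ^ 2"
    using card_mono[OF _ sub] assms(1) by (simp add: power2_eq_square card_cartesian_product)
  have finB: "finite (B p)" for p using assms by (simp add: B_def finite_PiE)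
  have B: "card (B p) \<le> card V ^ (card I - 1)" if pD: "p \<in> D" for p
  proof -
    obtain i j where p: "p = (i, j)" "i \<in> I" "j \<in> I" "i \<noteq> j" using pD by (auto simp: D_def)
    have "inj_on (\<lambda>x. restrict x (I - {j})) (B p)"
    proof (rule inj_onI)
      fix x y assume xy: "x \<in> B p" "y \<in> B p" "restrict x (I - {j}) = restrict y (I - {j})"
      have eq: "x a = y a" if "a \<in> I - {j}" for a
        using xy(3) that by (metis restrict_apply')
      show "x = y"
      proof (rule PiE_ext)
        show "x \<in> PiE I (\<lambda>_. V)" "y \<in> PiE I (\<lambda>_. V)" using xy by (auto simp: B_def)
        fix a assume "a \<in> I"
        then show "x a = y a" using eq[of a] eq[of i] xy p by (cases "a = j") (auto simp: B_def)
      qed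
    qed
    then have "card (B p) = card ((\<lambda>x. restrict x (I - {j})) ` B p)" by (simp add: card_image)
    also have "\<dots> \<le> card (PiE (I - {j}) (\<lambda>_. V))"
    proof (rule card_mono)
      show "finite (PiE (I - {j}) (\<lambda>_. V))" using assms by (simp add: finite_PiE)
      show "(\<lambda>x. restrict x (I - {j})) ` B p \<subseteq> PiE (I - {j}) (\<lambda>_. V)"
        by (rule image_subsetI) (auto simp: B_def PiE_iff)
    qed
    also have "\<dots> = card V ^ (card I - 1)" using assms p by (simp add: card_funcsetE)
    finally show ?thesis .
  qed
  have "{x \<in> PiE I (\<lambda>_. V). \<not> inj_on x I} \<subseteq> (\<Union>p\<in>D. B p)"
    by (auto simp: D_def B_def inj_on_def)
  then have "card {x \<in> PiE I (\<lambda>_. V). \<not> inj_on x I} \<le> card (\<Union>p\<in>D. B p)"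
    using D finB by (intro card_mono) simp_all
  also have "\<dots> \<le> (\<Sum>p\<in>D. card (B p))" by (rule card_UN_le[OF D])
  also have "\<dots> \<le> (\<Sum>p\<in>D. card V ^ (card I - 1))" by (rule sum_mono[OF B])
  also have "\<dots> \<le> card I ^ 2 * card V ^ (card I - 1)" using cD by simp
  finally show ?thesis .
qed

text \<open>The sampled hypergraph, on the index set instead of the sampled vertices. For injective \<open>x\<close> it is
  isomorphic to an induced subgraph of \<open>H\<close>.\<close>

definition pullback :: "nat \<Rightarrow> ('i \<Rightarrow> 'a) \<Rightarrow> 'i set \<Rightarrow> 'a hypergraph \<Rightarrow> 'i hypergraph" where
  "pullback k x I H = (I, {e \<in> nsets I k. x ` e \<in> edges H})"

lemma link_hits_le_degree_pullback:
  assumes "finite I" "inj_on x I" "T \<in> nsets I l" "l \<le> k"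
    and V: "x ` I \<subseteq> verts H"
  shows "link_hits (I - T) (k - l) {R \<in> nsets (verts H - x ` T) (k - l). x ` T \<union> R \<in> edges H} x
    \<le> degree k (pullback k x I H) T"
proof -
  have T: "T \<subseteq> I" "card T = l" "finite T" using assms(3) by (auto simp: nsets_def)
  have "{R \<in> nsets (I - T) (k - l). inj_on x R \<and> x ` R \<in> {R \<in> nsets (verts H - x ` T) (k - l). x ` T \<union> R \<in> edges H}}
    \<subseteq> {R \<in> nsets (verts (pullback k x I H) - T) (k - card T). T \<union> R \<in> edges (pullback k x I H)}"
  proof
    fix R assume "R \<in> {R \<in> nsets (I - T) (k - l). inj_on x R \<and> x ` R \<in> {R \<in> nsets (verts H - x ` T) (k - l). x ` T \<union> R \<in> edges H}}"
    then have R: "R \<subseteq> I - T" "finite R" "card R = k - l" "x ` T \<union> x ` R \<in> edges H"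
      by (auto simp: nsets_def)
    have "card (T \<union> R) = card T + card R" using R T by (intro card_Un_disjoint) auto
    then show "R \<in> {R \<in> nsets (verts (pullback k x I H) - T) (k - card T). T \<union> R \<in> edges (pullback k x I H)}"
      using R T assms(4) by (auto simp: pullback_def nsets_def image_Un)
  qed
  moreover have "finite (nsets (I - T) (k - l))" using assms(1) by (simp add: finite_imp_finite_nsets)
  ultimately show ?thesis
    using T unfolding link_hits_def degree_def
    by (intro card_mono) (auto simp: pullback_def)
qed

lemma card_bad_samples_le:
  fixes H :: "'a hypergraph"
  assumes V: "finite (verts H)" "verts H \<noteq> {}" and l: "l < k" and I: "finite I" "k \<le> card I"
    and e: "0 \<le> e" "e \<le> 1"
    and deg: "\<And>T. T \<in> nsets (verts H) l \<Longrightarrow>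
       d * real (card (verts H)) ^ (k - l) \<le> real (degree k H T) * fact (k - l)"
    and T: "T \<in> nsets I l"
  shows "real (card {x \<in> PiE I (\<lambda>_. verts H). inj_on x I \<and>
       real (degree k (pullback k x I H) T) < (d - e) * real ((card I - l) choose (k - l))})
     \<le> real (card (verts H)) ^ card I * exp (- (real (card I - l) * (e / (2 * real (k - l)))\<^sup>2))"
    (is "real (card ?B) \<le> _")
proof -
  define V where "V = verts H"
  define r where "r = k - l"
  define J where "J = I - T"
  define L where "L z = {R \<in> nsets (V - z ` T) r. z ` T \<union> R \<in> edges H}" for z :: "'b \<Rightarrow> 'a"
  \<comment> \<open>The sample is split into its values \<open>z\<close> on \<open>T\<close> and \<open>y\<close> elsewhere; for fixed \<open>z\<close> the tail bound
    applies to \<open>y\<close>.\<close>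
  define Y where "Y z = {y \<in> PiE J (\<lambda>_. V). real (link_hits J r (L z) y) \<le> (d - e) * real (card J choose r)}" for z
  define glue where "glue z y = (\<lambda>i. if i \<in> T then z i else y i)" for z y :: "'b \<Rightarrow> 'a"
  define Z where "Z = {z \<in> PiE T (\<lambda>_. V). inj_on z T}"
  have T': "T \<subseteq> I" "card T = l" "finite T" using T by (auto simp: nsets_def)
  have J: "finite J" "card J = card I - l" using I T' by (auto simp: J_def card_Diff_subset)
  have finV: "finite V" "V \<noteq> {}" using V by (auto simp: V_def)
  have finPT: "finite (PiE T (\<lambda>_. V))" using T' finV by (simp add: finite_PiE)
  have Z: "finite Z" "card Z \<le> card V ^ l"
    using finPT card_mono[OF finPT, of Z] T' by (auto simp: Z_def card_funcsetE)
  have finY: "finite (Y z)" for z using J finV by (simp add: Y_def finite_PiE)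
  have cardY: "real (card (Y z)) \<le> real (card V) ^ (card I - l) * exp (- (real (card I - l) * (e / (2 * real r))\<^sup>2))"
    if z: "z \<in> Z" for z
  proof -
    have zT: "z ` T \<in> nsets V l" using z T' by (auto simp: Z_def nsets_def card_image)
    have "real (card (Y z)) \<le> real (card V) ^ card J * exp (- (real (card J) * (e / (2 * real r))\<^sup>2))"
      unfolding Y_def
    proof (rule link_hits_tail[OF J(1) finV])
      show "L z \<subseteq> nsets V r" by (auto simp: L_def nsets_def)
      have "degree k H (z ` T) = card (L z)"
        using zT by (simp add: degree_def L_def V_def r_def nsets_def)
      then show "d * real (card V) ^ r \<le> real (card (L z)) * fact r"
        using deg[of "z ` T"] zT by (simp add: V_def r_def)
    qed (use l I e J in \<open>auto simp: r_def\<close>)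
    then show ?thesis using J by simp
  qed
  have "?B \<subseteq> (\<Union>z\<in>Z. glue z ` Y z)"
  proof
    fix x assume "x \<in> ?B"
    then have x: "x \<in> PiE I (\<lambda>_. V)" "inj_on x I"
      and xd: "real (degree k (pullback k x I H) T) < (d - e) * real ((card I - l) choose (k - l))"
      by (auto simp: V_def)
    define z where "z = restrict x T"
    define y where "y = restrict x J"
    have img: "z ` T = x ` T" by (simp add: z_def)
    have "link_hits J r (L z) x \<le> degree k (pullback k x I H) T"
    proof -
      have "x ` I \<subseteq> verts H" using x(1) by (auto simp: V_def)
      from link_hits_le_degree_pullback[OF I(1) x(2) T less_imp_le[OF l] this]
      show ?thesis by (simp only: J_def r_def L_def img V_def)
    qed
    moreover have "link_hits J r (L z) y = link_hits J r (L z) x"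
    proof -
      have same: "inj_on y R = inj_on x R \<and> y ` R = x ` R" if "R \<in> nsets J r" for R
      proof -
        have e: "y i = x i" if "i \<in> R" for i using that \<open>R \<in> nsets J r\<close> by (auto simp: y_def nsets_def)
        show ?thesis by (intro conjI inj_on_cong image_cong refl e)
      qed
      have "{R \<in> nsets J r. inj_on y R \<and> y ` R \<in> L z} = {R \<in> nsets J r. inj_on x R \<and> x ` R \<in> L z}"
        by (intro Collect_cong conj_cong refl) (simp_all only: same)
      then show ?thesis by (simp add: link_hits_def)
    qed
    moreover have "y \<in> PiE J (\<lambda>_. V)" using x(1) by (auto simp: y_def J_def PiE_iff)
    ultimately have "y \<in> Y z" using xd J by (auto simp: Y_def r_def)
    moreover have "z \<in> PiE T (\<lambda>_. V)" using x(1) T' by (auto simp: z_def PiE_iff)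
    moreover have "inj_on z T" using x(2) T' by (auto simp: z_def inj_on_def)
    moreover have "x = glue z y"
    proof
      fix i
      have "x i = undefined" if "i \<notin> I" using x(1) that by (rule PiE_arb)
      then show "x i = glue z y i" using T'(1) by (auto simp: glue_def z_def y_def J_def)
    qed
    ultimately show "x \<in> (\<Union>z\<in>Z. glue z ` Y z)" by (auto simp: Z_def)
  qed
  then have "card ?B \<le> card (\<Union>z\<in>Z. glue z ` Y z)"
    using Z finY by (intro card_mono) auto
  also have "\<dots> \<le> (\<Sum>z\<in>Z. card (glue z ` Y z))" by (rule card_UN_le[OF Z(1)])
  also have "\<dots> \<le> (\<Sum>z\<in>Z. card (Y z))" by (intro sum_mono card_image_le finY)
  finally have "real (card ?B) \<le> real (\<Sum>z\<in>Z. card (Y z))" by (rule of_nat_mono)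
  also have "\<dots> = (\<Sum>z\<in>Z. real (card (Y z)))" by (rule of_nat_sum)
  also have "\<dots> \<le> (\<Sum>z\<in>Z. real (card V) ^ (card I - l) * exp (- (real (card I - l) * (e / (2 * real r))\<^sup>2)))"
    by (rule sum_mono[OF cardY])
  also have "\<dots> \<le> real (card V) ^ l * (real (card V) ^ (card I - l) * exp (- (real (card I - l) * (e / (2 * real r))\<^sup>2)))"
  proof -
    have "real (card Z) \<le> real (card V) ^ l" using Z(2) by (metis of_nat_mono of_nat_power)
    then show ?thesis by (simp add: mult_right_mono)
  qed
  also have "\<dots> = real (card V) ^ card I * exp (- (real (card I - l) * (e / (2 * real r))\<^sup>2))"
  proof -
    have "card I = l + (card I - l)" using l I by simp
    then have "real (card V) ^ card I = real (card V) ^ l * real (card V) ^ (card I - l)"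
      by (metis power_add)
    then show ?thesis by simp
  qed
  finally show ?thesis by (simp add: V_def r_def)
qed

text \<open>The exponential tail beats the number of \<open>l\<close>-sets of sample points, so some injective sample is good
  for all of them at once.\<close>

lemma good_sample_exists:
  fixes H :: "'a hypergraph"
  assumes V: "finite (verts H)" "verts H \<noteq> {}" and l: "l < k" and I: "finite I" "k \<le> card I"
    and e: "0 \<le> e" "e \<le> 1"
    and deg: "\<And>T. T \<in> nsets (verts H) l \<Longrightarrow>
       d * real (card (verts H)) ^ (k - l) \<le> real (degree k H T) * fact (k - l)"
    and small: "real (card I choose l) * exp (- (real (card I - l) * (e / (2 * real (k - l)))\<^sup>2))
       + real (card I) ^ 2 / real (card (verts H)) < 1"
  obtains x where "inj_on x I" "x ` I \<subseteq> verts H"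
    "\<And>T. T \<in> nsets I l \<Longrightarrow>
       (d - e) * real ((card I - l) choose (k - l)) \<le> real (degree k (pullback k x I H) T)"
proof -
  define n where "n = card (verts H)"
  define P where "P = PiE I (\<lambda>_. verts H)"
  define B where "B T = {x \<in> PiE I (\<lambda>_. verts H). inj_on x I \<and>
       real (degree k (pullback k x I H) T) < (d - e) * real ((card I - l) choose (k - l))}" for T
  define N where "N = {x \<in> PiE I (\<lambda>_. verts H). \<not> inj_on x I}"
  define E where "E = exp (- (real (card I - l) * (e / (2 * real (k - l)))\<^sup>2))"
  have n: "real n > 0" using V by (simp add: n_def card_gt_0_iff)
  have finP: "finite P" using I V by (simp add: P_def finite_PiE)
  have finB: "finite (B T)" "finite N" for T using finP by (simp_all add: P_def B_def N_def)
  have finT: "finite (nsets I l)" using I by (simp add: finite_imp_finite_nsets)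
  have cB: "real (card (B T)) \<le> real n ^ card I * E" if "T \<in> nsets I l" for T
    unfolding B_def n_def E_def by (rule card_bad_samples_le[OF V l I e deg that])
  have "card (N \<union> (\<Union>T\<in>nsets I l. B T)) \<le> card N + (\<Sum>T\<in>nsets I l. card (B T))"
    using card_Un_le[of N "\<Union>T\<in>nsets I l. B T"] card_UN_le[OF finT, of B] by linarith
  then have "real (card (N \<union> (\<Union>T\<in>nsets I l. B T))) \<le> real (card N + (\<Sum>T\<in>nsets I l. card (B T)))"
    by (rule of_nat_mono)
  also have "\<dots> = real (card N) + (\<Sum>T\<in>nsets I l. real (card (B T)))"
    by (simp only: of_nat_add of_nat_sum)
  also have "\<dots> \<le> real (card I ^ 2 * n ^ (card I - 1)) + (\<Sum>T\<in>nsets I l. real n ^ card I * E)"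
    using card_noninjective_le[OF I(1) V(1)] unfolding N_def n_def
    by (intro add_mono sum_mono) (auto intro: cB[unfolded n_def] simp del: of_nat_mult of_nat_power)
  also have "\<dots> = real n ^ card I * (real (card I choose l) * E + real (card I) ^ 2 / real n)"
  proof -
    have "card I = Suc (card I - 1)" using l I by simp
    then have "real n ^ card I = real n * real n ^ (card I - 1)" by (metis power_Suc)
    then have "real n ^ card I * (real (card I) ^ 2 / real n) = real (card I) ^ 2 * real n ^ (card I - 1)"
      using n by simp
    then show ?thesis by (simp add: algebra_simps)
  qed
  also have "\<dots> < real n ^ card I"
    using mult_strict_left_mono[OF small, of "real n ^ card I"] n by (simp add: E_def n_def)
  also have "\<dots> = real (card P)" using I by (simp add: P_def card_funcsetE n_def)
  finally have "card (N \<union> (\<Union>T\<in>nsets I l. B T)) < card P" by simp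
  then have "\<not> P \<subseteq> N \<union> (\<Union>T\<in>nsets I l. B T)"
    using finB finT by (meson card_mono finite_UN finite_UnI not_le)
  then obtain x where x: "x \<in> P" "x \<notin> N" "\<And>T. T \<in> nsets I l \<Longrightarrow> x \<notin> B T" by auto
  show thesis
  proof (rule that[of x])
    show "inj_on x I" using x by (auto simp: P_def N_def)
    then show "(d - e) * real ((card I - l) choose (k - l)) \<le> real (degree k (pullback k x I H) T)"
      if "T \<in> nsets I l" for T using x(1) x(3)[OF that] by (auto simp: P_def B_def)
    show "x ` I \<subseteq> verts H" using x by (auto simp: P_def)
  qed
qed

section \<open>Existence of the density\<close>

text \<open>The hypothesis makes the limes inferior at least the limes superior.\<close>

lemma convergent_if_nearly_antitone:
  fixes s :: "nat \<Rightarrow> real"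
  assumes bd: "\<And>n. 0 \<le> s n" "\<And>n. s n \<le> B"
    and step: "\<And>e. 0 < e \<Longrightarrow> \<exists>m0. \<forall>m\<ge>m0. \<exists>n0. \<forall>n\<ge>n0. s n \<le> s m + e"
  shows "convergent s"
proof -
  \<comment> \<open>The supremum of \<open>X\<close> is the limes superior of \<open>s\<close>.\<close>
  define X where "X = {x. \<exists>\<^sub>\<infinity>n. x \<le> s n}"
  have X0: "0 \<in> X" using bd by (simp add: X_def INFM_iff_infinite)
  have XB: "x \<le> B" if "x \<in> X" for x
  proof -
    have "\<exists>\<^sub>\<infinity>n. x \<le> s n" using that by (simp add: X_def)
    then obtain n where "x \<le> s n" using INFM_EX by blast
    then show ?thesis using bd(2)[of n] by simp
  qed
  then have bdd: "bdd_above X" by (auto simp: bdd_above_def)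
  define L where "L = Sup X"
  have "s \<longlonglongrightarrow> L"
  proof (rule LIMSEQ_I)
    fix e :: real assume e: "0 < e"
    have "L + e / 2 \<notin> X" using cSup_upper[OF _ bdd] e unfolding L_def by fastforce
    then have "\<forall>\<^sub>\<infinity>n. s n < L + e / 2" by (simp add: X_def not_INFM not_le)
    then obtain n1 where n1: "\<And>n. n \<ge> n1 \<Longrightarrow> s n < L + e / 2"
      by (auto simp: MOST_nat_le)
    obtain x where x: "x \<in> X" "L - e / 3 < x"
      using less_cSup_iff[of X "L - e / 3"] X0 bdd e unfolding L_def by auto
    obtain m0 where m0: "\<And>m. m \<ge> m0 \<Longrightarrow> \<exists>n0. \<forall>n\<ge>n0. s n \<le> s m + e / 3"
      using step[of "e / 3"] e by auto
    have low: "L - e < s m" if m: "m \<ge> m0" for m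
    proof -
      obtain n0 where n0: "\<And>n. n \<ge> n0 \<Longrightarrow> s n \<le> s m + e / 3" using m0[OF m] by auto
      obtain n where "n \<ge> n0" "x \<le> s n"
        using x(1) by (auto simp: X_def INFM_nat_le)
      then show ?thesis using n0[of n] x e by linarith
    qed
    show "\<exists>n0. \<forall>n\<ge>n0. norm (s n - L) < e"
    proof (intro exI allI impI)
      fix n assume "n \<ge> max n1 m0"
      then show "norm (s n - L) < e" using n1[of n] low[of n] e by (auto simp: abs_less_iff)
    qed
  qed
  then show ?thesis by (auto simp: convergent_def)
qed

lemma falling_binomial_ratio:
  "(\<lambda>n. real ((n - l) choose r) * fact r / real n ^ r) \<longlonglongrightarrow> 1"
proof (induction r)
  case 0
  then show ?case by simp
next
  case (Suc r)
  have f: "(\<lambda>n. real n * (1 / real n)) \<longlonglongrightarrow> 1"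
    by (rule tendsto_eventually) (auto simp: eventually_at_top_linorder intro!: exI[of _ 1])
  have "(\<lambda>n. 1 - real (l + r) * (1 / real n)) \<longlonglongrightarrow> 1 - real (l + r) * 0"
    by (intro tendsto_intros lim_1_over_n)
  from tendsto_mult[OF Suc.IH this]
  have "(\<lambda>n. real ((n - l) choose r) * fact r / real n ^ r * (1 - real (l + r) * (1 / real n))) \<longlonglongrightarrow> 1"
    by simp
  then show ?case
  proof (rule Lim_transform_eventually)
    show "\<forall>\<^sub>F n in sequentially. real ((n - l) choose r) * fact r / real n ^ r * (1 - real (l + r) * (1 / real n))
      = real ((n - l) choose Suc r) * fact (Suc r) / real n ^ Suc r"
      unfolding eventually_at_top_linorder
    proof (intro exI allI impI)
      fix n assume n: "n \<ge> Suc (l + r)"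
      have "Suc r * ((n - l) choose Suc r) = (n - l - r) * ((n - l) choose r)"
        by (simp only: binomial_absorption binomial_absorb_comp)
      then have "real (Suc r * ((n - l) choose Suc r)) = real ((n - l - r) * ((n - l) choose r))"
        by (simp only:)
      moreover have "real (n - l - r) = real n - real (l + r)" using n by simp
      ultimately have "real (Suc r) * real ((n - l) choose Suc r) = (real n - real (l + r)) * real ((n - l) choose r)"
        by (simp only: of_nat_mult)
      moreover have "fact (Suc r) = real (Suc r) * fact r" by simp
      ultimately have "real ((n - l) choose Suc r) * fact (Suc r)
          = (real n - real (l + r)) * real ((n - l) choose r) * fact r"
        by (simp only: mult_ac)
      then show "real ((n - l) choose r) * fact r / real n ^ r * (1 - real (l + r) * (1 / real n))
      = real ((n - l) choose Suc r) * fact (Suc r) / real n ^ Suc r"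
        using n by (simp add: field_simps del: of_nat_Suc fact_Suc binomial_Suc_Suc)
    qed
  qed
qed

lemma power_times_exp_decay:
  fixes a :: real
  assumes "a > 0"
  shows "(\<lambda>m. real m ^ l * exp (- (real (m - l) * a))) \<longlonglongrightarrow> 0"
proof -
  have "filterlim (\<lambda>m. a * real m) at_top sequentially"
    using assms by (intro filterlim_tendsto_pos_mult_at_top[OF tendsto_const _ filterlim_real_sequentially]) auto
  then have "(\<lambda>m. (a * real m) ^ l / exp (a * real m)) \<longlonglongrightarrow> 0"
    by (rule filterlim_compose[OF tendsto_power_div_exp_0])
  from tendsto_mult_right_zero[OF this, of "exp (real l * a) / a ^ l"]
  show ?thesis
  proof (rule Lim_transform_eventually)
    show "\<forall>\<^sub>F m in sequentially. exp (real l * a) / a ^ l * ((a * real m) ^ l / exp (a * real m))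
      = real m ^ l * exp (- (real (m - l) * a))"
      unfolding eventually_at_top_linorder
    proof (intro exI allI impI)
      fix m assume "l \<le> m"
      then have "exp (- (real (m - l) * a)) = exp (real l * a) / exp (a * real m)"
        by (simp add: exp_diff[symmetric] of_nat_diff algebra_simps)
      then show "exp (real l * a) / a ^ l * ((a * real m) ^ l / exp (a * real m))
        = real m ^ l * exp (- (real (m - l) * a))"
        using assms by (simp add: power_mult_distrib)
    qed
  qed
qed

lemma degree_le:
  assumes "finite (verts H)" "T \<in> nsets (verts H) l"
  shows "degree k H T \<le> (card (verts H) - l) choose (k - l)"
proof -
  have T: "T \<subseteq> verts H" "finite T" "card T = l" using assms by (auto simp: nsets_def)
  have "degree k H T \<le> card (nsets (verts H - T) (k - card T))"
    unfolding degree_def using assms by (intro card_mono) (auto simp: finite_imp_finite_nsets)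
  then show ?thesis using T by (simp add: card_Diff_subset)
qed

lemma min_degree_ge_iff:
  assumes "finite (verts H)" "l \<le> card (verts H)"
  shows "d \<le> min_degree k l H \<longleftrightarrow> (\<forall>T\<in>nsets (verts H) l. d \<le> degree k H T)"
proof -
  have "finite (nsets (verts H) l)" "nsets (verts H) l \<noteq> {}"
    using assms by (auto simp: finite_imp_finite_nsets nsets_eq_empty_iff)
  then show ?thesis by (simp add: min_degree_def)
qed

lemma min_degree_le:
  assumes "finite (verts H)" "l \<le> card (verts H)"
  shows "min_degree k l H \<le> (card (verts H) - l) choose (k - l)"
proof -
  have "nsets (verts H) l \<noteq> {}" using assms by (auto simp: nsets_eq_empty_iff)
  then obtain T where T: "T \<in> nsets (verts H) l" by auto
  have "min_degree k l H \<le> degree k H T" using min_degree_ge_iff[OF assms] T by blast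
  also have "\<dots> \<le> (card (verts H) - l) choose (k - l)" by (rule degree_le[OF assms(1) T])
  finally show ?thesis .
qed

lemma kgraph_pullback: "finite I \<Longrightarrow> kgraph k (pullback k x I H)"
  by (auto simp: kgraph_def pullback_def)

lemma contains_copy_pullback:
  assumes "inj_on x I" "x ` I \<subseteq> verts H" "contains_copy (pullback k x I H) F"
  shows "contains_copy H F"
proof -
  obtain f where f: "inj_on f (verts F)" "f ` verts F \<subseteq> I" "\<And>e. e \<in> edges F \<Longrightarrow> x ` f ` e \<in> edges H"
    using assms(3) by (auto simp: contains_copy_def pullback_def)
  have "inj_on (x \<circ> f) (verts F)"
    using f assms(1) by (auto intro: comp_inj_on inj_on_subset)
  moreover have "(x \<circ> f) ` verts F \<subseteq> verts H" using f(2) assms(2) by auto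
  moreover have "\<forall>e\<in>edges F. (x \<circ> f) ` e \<in> edges H"
    using f(3) by (metis image_comp)
  ultimately show ?thesis unfolding contains_copy_def by blast
qed

locale turan_problem =
  fixes k l :: nat and \<F> :: "'a hypergraph set"
  assumes l: "l < k" and nonempty_edges: "\<And>F. F \<in> \<F> \<Longrightarrow> edges F \<noteq> {}"
begin

definition ratio :: "nat \<Rightarrow> real" where
  "ratio n = real (ex_deg k l n \<F>) / real ((n - l) choose (k - l))"

definition min_degrees :: "nat \<Rightarrow> nat set" where
  "min_degrees n = {min_degree k l H | H :: nat hypergraph.
            kgraph k H \<and> card (verts H) = n \<and> family_free \<F> H}"

lemma turan_density_eq: "turan_density k l \<F> = lim ratio"
  by (simp add: turan_density_def ratio_def[abs_def])

lemma ex_deg_eq: "ex_deg k l n \<F> = Max (min_degrees n)"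
  by (simp add: ex_deg_def min_degrees_def)

lemma finite_min_degrees:
  assumes "l \<le> n" shows "finite (min_degrees n)"
proof (rule finite_subset)
  show "min_degrees n \<subseteq> {..(n - l) choose (k - l)}"
    using assms min_degree_le by (auto simp: min_degrees_def kgraph_def)
qed simp

lemma min_degrees_nonempty: "min_degrees n \<noteq> {}"
proof -
  have "family_free \<F> ({..<n}, {})"
    using nonempty_edges by (fastforce simp: family_free_def contains_copy_def)
  then have "min_degree k l ({..<n}, {}) \<in> min_degrees n"
    unfolding min_degrees_def by (intro CollectI exI[of _ "({..<n}, {})"]) (auto simp: kgraph_def)
  then show ?thesis by blast
qed

lemma ex_deg_attained:
  assumes "l \<le> n"
  obtains H :: "nat hypergraph" where "kgraph k H" "card (verts H) = n" "family_free \<F> H"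
    "ex_deg k l n \<F> = min_degree k l H"
proof -
  have "ex_deg k l n \<F> \<in> min_degrees n"
    unfolding ex_deg_eq by (rule Max_in[OF finite_min_degrees[OF assms] min_degrees_nonempty])
  then show ?thesis using that unfolding min_degrees_def by blast
qed

lemma ex_deg_ge:
  fixes H :: "nat hypergraph"
  assumes "l \<le> card (verts H)" "kgraph k H" "family_free \<F> H"
  shows "min_degree k l H \<le> ex_deg k l (card (verts H)) \<F>"
  unfolding ex_deg_eq using assms
  by (intro Max_ge finite_min_degrees) (auto simp only: min_degrees_def)

lemma ratio_ge:
  fixes H :: "nat hypergraph"
  assumes "k \<le> card (verts H)" "kgraph k H" "family_free \<F> H"
    and d: "\<And>T. T \<in> nsets (verts H) l \<Longrightarrow> d * real ((card (verts H) - l) choose (k - l)) \<le> real (degree k H T)"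
  shows "d \<le> ratio (card (verts H))"
proof -
  have fin: "finite (verts H)" using assms by (simp add: kgraph_def)
  have ll: "l \<le> card (verts H)" using assms l by simp
  have pos: "real ((card (verts H) - l) choose (k - l)) > 0" using assms(1) by simp
  have "nat \<lceil>d * real ((card (verts H) - l) choose (k - l))\<rceil> \<le> min_degree k l H"
    unfolding min_degree_ge_iff[OF fin ll] using d by (metis nat_ceiling_le_eq)
  then have "d * real ((card (verts H) - l) choose (k - l)) \<le> real (min_degree k l H)"
    by (simp add: nat_ceiling_le_eq)
  also have "\<dots> \<le> real (ex_deg k l (card (verts H)) \<F>)"
    using ex_deg_ge[OF ll assms(2,3)] by simp
  finally show ?thesis using pos by (simp add: ratio_def field_simps)
qed

lemma ratio_attained:
  assumes "k \<le> n"
  obtains H :: "nat hypergraph" where "kgraph k H" "card (verts H) = n" "family_free \<F> H"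
    "\<And>T. T \<in> nsets (verts H) l \<Longrightarrow> ratio n * real ((n - l) choose (k - l)) \<le> real (degree k H T)"
proof -
  obtain H :: "nat hypergraph" where H: "kgraph k H" "card (verts H) = n" "family_free \<F> H"
    "ex_deg k l n \<F> = min_degree k l H"
    using ex_deg_attained assms l by (metis less_imp_le_nat order_trans)
  have "real ((n - l) choose (k - l)) > 0" using assms by simp
  then have "ratio n * real ((n - l) choose (k - l)) = real (min_degree k l H)"
    using H(4) by (simp add: ratio_def)
  moreover have "min_degree k l H \<le> degree k H T" if "T \<in> nsets (verts H) l" for T
    using min_degree_ge_iff[of H l "min_degree k l H" k] H(1,2) assms l that by (auto simp: kgraph_def)
  ultimately show ?thesis using that[OF H(1-3)] by simp
qed

lemma ratio_bounds: "0 \<le> ratio n" "ratio n \<le> 1"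
proof -
  show "0 \<le> ratio n" by (simp add: ratio_def)
  show "ratio n \<le> 1"
  proof (cases "k \<le> n")
    case True
    then obtain H :: "nat hypergraph" where H: "kgraph k H" "card (verts H) = n"
      "ex_deg k l n \<F> = min_degree k l H"
      using ex_deg_attained l by (metis less_imp_le_nat order_trans)
    then have "min_degree k l H \<le> (n - l) choose (k - l)"
      using min_degree_le[of H l k] True l by (auto simp: kgraph_def)
    then show ?thesis using H True by (simp add: ratio_def)
  next
    case False
    then have "n - l < k - l" using l by simp
    then have "(n - l) choose (k - l) = 0" by (rule binomial_eq_0)
    then show ?thesis unfolding ratio_def by (simp only: of_nat_0 div_by_0)
  qed
qed

text \<open>An extremal host on \<open>n\<close> vertices has a good sample of size \<open>m\<close>, and the sample is a competitor in the
  definition of the extremal number for \<open>m\<close>. The threshold for \<open>m\<close> does not depend on \<open>n\<close>, which is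
  why this yields convergence.\<close>

lemma ratio_sampling:
  assumes e: "0 < e" "e \<le> 1"
  shows "\<exists>m0. \<forall>m\<ge>m0. \<exists>n0. \<forall>n\<ge>n0. ratio n \<le> ratio m + e"
proof -
  define r where "r = k - l"
  \<comment> \<open>The rate of the exponential tail for the sampling error \<open>e / 2\<close>; the other half of \<open>e\<close> absorbs
    the difference between \<open>(n - l) choose r\<close> and \<open>n ^ r / fact r\<close>.\<close>
  define a where "a = (e / 2 / (2 * real r))\<^sup>2"
  have a: "a > 0" using e l by (simp add: a_def r_def)
  have "\<forall>\<^sub>F m in sequentially. real m ^ l * exp (- (real (m - l) * a)) < 1 / 2"
    by (rule order_tendstoD(2)[OF power_times_exp_decay[OF a]]) simp
  then obtain m1 where m1: "\<And>m. m \<ge> m1 \<Longrightarrow> real m ^ l * exp (- (real (m - l) * a)) < 1 / 2"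
    by (auto simp: eventually_at_top_linorder)
  have "\<forall>\<^sub>F n in sequentially. 1 - e / 2 < real ((n - l) choose r) * fact r / real n ^ r"
    using order_tendstoD(1)[OF falling_binomial_ratio[of l r]] e by simp
  then obtain n1 where n1: "\<And>n. n \<ge> n1 \<Longrightarrow> 1 - e / 2 < real ((n - l) choose r) * fact r / real n ^ r"
    by (auto simp: eventually_at_top_linorder)
  show ?thesis
  proof (rule exI[of _ "max m1 k"], intro allI impI)
    fix m assume m: "max m1 k \<le> m"
    show "\<exists>n0. \<forall>n\<ge>n0. ratio n \<le> ratio m + e"
    proof (rule exI[of _ "n1 + k + 2 * m\<^sup>2 + 1"], intro allI impI)
      fix n assume n: "n1 + k + 2 * m\<^sup>2 + 1 \<le> n"
      obtain H :: "nat hypergraph" where H: "kgraph k H" "card (verts H) = n" "family_free \<F> H"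
        "\<And>T. T \<in> nsets (verts H) l \<Longrightarrow> ratio n * real ((n - l) choose r) \<le> real (degree k H T)"
        using ratio_attained[of n] n unfolding r_def by auto
      have n0: "real n > 0" using n by simp
      have deg: "(ratio n - e / 2) * real (card (verts H)) ^ (k - l) \<le> real (degree k H T) * fact (k - l)"
        if "T \<in> nsets (verts H) l" for T
      proof -
        have "ratio n - e / 2 \<le> ratio n * (1 - e / 2)"
          using ratio_bounds[of n] e by (simp add: algebra_simps mult_left_le)
        also have "\<dots> \<le> ratio n * (real ((n - l) choose r) * fact r / real n ^ r)"
          using ratio_bounds[of n] n1[of n] n by (intro mult_left_mono) auto
        finally have "(ratio n - e / 2) * real n ^ r \<le> ratio n * real ((n - l) choose r) * fact r"
          using n0 by (simp add: field_simps)
        also have "\<dots> \<le> real (degree k H T) * fact r"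
          using H(4)[OF that] by (intro mult_right_mono) auto
        finally show ?thesis using H(2) by (simp add: r_def)
      qed
      have small: "real (card {..<m} choose l) * exp (- (real (card {..<m} - l) * (e / 2 / (2 * real (k - l)))\<^sup>2))
        + real (card {..<m}) ^ 2 / real (card (verts H)) < 1"
      proof -
        have "real (m choose l) \<le> real m ^ l"
          using binomial_le_pow[of l m] m l by (metis max.bounded_iff less_imp_le_nat of_nat_mono of_nat_power order_trans)
        then have "real (m choose l) * exp (- (real (m - l) * a)) \<le> real m ^ l * exp (- (real (m - l) * a))"
          by (intro mult_right_mono) auto
        also have "\<dots> < 1 / 2" using m1 m by simp
        finally have 1: "real (m choose l) * exp (- (real (m - l) * a)) < 1 / 2" .
        have "real (2 * m\<^sup>2) < real n" using n by (intro of_nat_less_iff[THEN iffD2]) simp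
        then have "real m ^ 2 / real n < 1 / 2" using n0 by (simp add: field_simps)
        from add_strict_mono[OF 1 this]
        have "real (m choose l) * exp (- (real (m - l) * a)) + real m ^ 2 / real n < 1" by simp
        then show ?thesis unfolding a_def r_def H(2) card_lessThan .
      qed
      have fV: "finite (verts H)" "verts H \<noteq> {}" using H(1,2) n0 by (auto simp: kgraph_def)
      have km: "k \<le> card {..<m}" using m by simp
      have e2: "0 \<le> e / 2" "e / 2 \<le> 1" using e by auto
      obtain x where x: "inj_on x {..<m}" "x ` {..<m} \<subseteq> verts H"
        "\<And>T. T \<in> nsets {..<m} l \<Longrightarrow>
          (ratio n - e / 2 - e / 2) * real ((card {..<m} - l) choose (k - l)) \<le> real (degree k (pullback k x {..<m} H) T)"
        using good_sample_exists[OF fV l finite_lessThan km e2 deg small] by blast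
      have "ratio n - e \<le> ratio (card (verts (pullback k x {..<m} H)))"
      proof (rule ratio_ge)
        show "kgraph k (pullback k x {..<m} H)" by (simp add: kgraph_pullback)
        show "family_free \<F> (pullback k x {..<m} H)"
          using H(3) contains_copy_pullback[OF x(1,2)] unfolding family_free_def by blast
      qed (use m x(3) in \<open>auto simp: pullback_def\<close>)
      then show "ratio n \<le> ratio m + e" by (simp add: pullback_def)
    qed
  qed
qed

theorem ratio_tendsto: "ratio \<longlonglongrightarrow> turan_density k l \<F>"
proof -
  have "convergent ratio"
  proof (rule convergent_if_nearly_antitone)
    fix e :: real assume e: "0 < e"
    obtain m0 where m0: "\<And>m. m \<ge> m0 \<Longrightarrow> \<exists>n0. \<forall>n\<ge>n0. ratio n \<le> ratio m + min e 1"
      using ratio_sampling[of "min e 1"] e by auto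
    have "\<exists>n0. \<forall>n\<ge>n0. ratio n \<le> ratio m + e" if m: "m \<ge> m0" for m
    proof -
      obtain n0 where "\<And>n. n \<ge> n0 \<Longrightarrow> ratio n \<le> ratio m + min e 1" using m0[OF m] by auto
      moreover have "min e 1 \<le> e" by simp
      ultimately show ?thesis by (meson add_left_mono order_trans)
    qed
    then show "\<exists>m0. \<forall>m\<ge>m0. \<exists>n0. \<forall>n\<ge>n0. ratio n \<le> ratio m + e" by blast
  qed (use ratio_bounds in auto)
  then show ?thesis by (simp add: turan_density_eq convergent_LIMSEQ_iff)
qed

lemma turan_density_le:
  assumes "\<And>n. n \<ge> n0 \<Longrightarrow> ratio n \<le> c"
  shows "turan_density k l \<F> \<le> c"
  using ratio_tendsto assms by (intro LIMSEQ_le_const2) auto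

text \<open>Since the limit exists, hosts of infinitely many orders suffice for a lower bound.\<close>

lemma turan_density_ge:
  assumes "\<And>n0. \<exists>n\<ge>n0. c \<le> ratio n"
  shows "c \<le> turan_density k l \<F>"
proof (rule ccontr)
  assume "\<not> c \<le> turan_density k l \<F>"
  then have "\<forall>\<^sub>F n in sequentially. ratio n < c"
    using order_tendstoD(2)[OF ratio_tendsto] by simp
  then obtain n0 where "\<And>n. n \<ge> n0 \<Longrightarrow> ratio n < c" by (auto simp: eventually_at_top_linorder)
  then show False using assms[of n0] by (meson not_le)
qed

end

section \<open>Partite subgraphs, Ramsey sets and greedy choices\<close>

text \<open>Averaging in the form used below: if the sum is large and no term exceeds \<open>b\<close>, then many terms are
  at least \<open>c\<close>.\<close>

lemma heavy_elements:
  fixes f :: "'a \<Rightarrow> real"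
  assumes "finite V" and le: "\<And>v. v \<in> V \<Longrightarrow> f v \<le> b" and b: "0 \<le> b"
  shows "sum f V \<le> real (card {v \<in> V. c \<le> f v}) * b + real (card V) * max c 0"
proof -
  have "sum f V = sum f {v \<in> V. c \<le> f v} + sum f {v \<in> V. \<not> c \<le> f v}"
    using assms(1) by (subst sum.union_disjoint[symmetric]) (auto intro: sum.cong)
  also have "sum f {v \<in> V. c \<le> f v} \<le> real (card {v \<in> V. c \<le> f v}) * b"
    using le by (intro sum_bounded_above) auto
  also have "sum f {v \<in> V. \<not> c \<le> f v} \<le> real (card {v \<in> V. \<not> c \<le> f v}) * max c 0"
    by (intro sum_bounded_above) auto
  also have "\<dots> \<le> real (card V) * max c 0"
    using assms(1) by (intro mult_right_mono of_nat_mono card_mono) auto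
  finally show ?thesis by simp
qed

lemma card_lists_Suc_eq_sum:
  assumes "finite V" "E \<subseteq> {xs. set xs \<subseteq> V \<and> length xs = Suc k}"
  shows "card E = (\<Sum>v\<in>V. card {xs. v # xs \<in> E})"
proof -
  have finE: "finite E" using assms finite_lists_length_eq[of V "Suc k"] finite_subset by blast
  have fin: "finite {xs. v # xs \<in> E}" for v
  proof -
    have "{xs. v # xs \<in> E} = (#) v -` E" by auto
    then show ?thesis using finite_vimageI[OF finE, of "(#) v"] by (simp add: inj_on_def)
  qed
  have "E = (\<Union>v\<in>V. (#) v ` {xs. v # xs \<in> E})"
  proof
    show "E \<subseteq> (\<Union>v\<in>V. (#) v ` {xs. v # xs \<in> E})"
    proof
      fix ys assume ys: "ys \<in> E"
      then obtain v xs where "ys = v # xs" "v \<in> V" using assms(2) by (cases ys) auto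
      then show "ys \<in> (\<Union>v\<in>V. (#) v ` {xs. v # xs \<in> E})" using ys by auto
    qed
  qed auto
  then have "card E = card (\<Union>v\<in>V. (#) v ` {xs. v # xs \<in> E})" by simp
  also have "\<dots> = (\<Sum>v\<in>V. card ((#) v ` {xs. v # xs \<in> E}))"
    using assms(1) fin by (intro card_UN_disjoint) auto
  also have "\<dots> = (\<Sum>v\<in>V. card {xs. v # xs \<in> E})" by (simp add: card_image)
  finally show ?thesis .
qed

text \<open>Erdos's theorem that a positive proportion of all \<open>k\<close>-tuples contains a box with sides of size \<open>t\<close>.
  Working with lists instead of edges makes the induction on \<open>k\<close> pass to the tails of the lists: a
  bounded number \<open>M\<close> of heavy first entries is fixed, and by the pigeonhole principle many tails are
  compatible with the same \<open>t\<close> of them.\<close>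

lemma dense_contains_complete_partite:
  fixes d :: real
  assumes "0 < d"
  shows "\<exists>n0. \<forall>(V :: 'a set) E. finite V \<longrightarrow> n0 \<le> card V \<longrightarrow>
    E \<subseteq> {xs. set xs \<subseteq> V \<and> length xs = k} \<longrightarrow> d * real (card V) ^ k \<le> real (card E) \<longrightarrow>
    (\<exists>A. (\<forall>i<k. A i \<subseteq> V \<and> card (A i) = t) \<and> (\<forall>xs. length xs = k \<longrightarrow> (\<forall>i<k. xs ! i \<in> A i) \<longrightarrow> xs \<in> E))"
  using assms
proof (induction k arbitrary: d)
  case 0
  show ?case
  proof (intro exI[of _ 0] allI impI)
    fix V :: "'a set" and E :: "'a list set"
    assume "E \<subseteq> {xs. set xs \<subseteq> V \<and> length xs = 0}" "d * real (card V) ^ 0 \<le> real (card E)"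
    then have "E \<noteq> {}" "E \<subseteq> {[]}" using 0 by auto
    then show "\<exists>A. (\<forall>i<0. A i \<subseteq> V \<and> card (A i) = t) \<and>
      (\<forall>xs. length xs = 0 \<longrightarrow> (\<forall>i<0. xs ! i \<in> A i) \<longrightarrow> xs \<in> E)" by auto
  qed
next
  case (Suc k)
  define M where "M = nat \<lceil>4 * real t / d\<rceil> + 1"
  have M: "M > 0" "4 * real t \<le> d * real M"
  proof -
    have "4 * real t / d \<le> real M" unfolding M_def by linarith
    then show "4 * real t \<le> d * real M" using Suc.prems by (simp add: field_simps)
  qed (simp add: M_def)
  define d' where "d' = d / 4 / 2 ^ M"
  have "d' > 0" using Suc.prems by (simp add: d'_def)
  from Suc.IH[OF this] obtain n0 where n0:
    "\<And>(V :: 'a set) E. finite V \<Longrightarrow> n0 \<le> card V \<Longrightarrow>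
      E \<subseteq> {xs. set xs \<subseteq> V \<and> length xs = k} \<Longrightarrow> d' * real (card V) ^ k \<le> real (card E) \<Longrightarrow>
      \<exists>A. (\<forall>i<k. A i \<subseteq> V \<and> card (A i) = t) \<and> (\<forall>xs. length xs = k \<longrightarrow> (\<forall>i<k. xs ! i \<in> A i) \<longrightarrow> xs \<in> E)"
    by blast
  show ?case
  proof (intro exI[of _ "max n0 (nat \<lceil>2 * real M / d\<rceil> + 1)"] allI impI)
    fix V :: "'a set" and E
    assume V: "finite V" and nV: "max n0 (nat \<lceil>2 * real M / d\<rceil> + 1) \<le> card V"
      and E: "E \<subseteq> {xs. set xs \<subseteq> V \<and> length xs = Suc k}" and dE: "d * real (card V) ^ Suc k \<le> real (card E)"
    define n where "n = real (card V)"
    define W where "W = {xs. set xs \<subseteq> V \<and> length xs = k}"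
    have W: "finite W" "card W = card V ^ k"
      using V by (auto simp: W_def finite_lists_length_eq card_lists_length_eq)
    have n: "n > 0" using nV by (simp add: n_def)
    have Mn: "real M \<le> d / 2 * n"
    proof -
      have "2 * real M / d \<le> n" using nV unfolding n_def by linarith
      then show ?thesis using Suc.prems by (simp add: field_simps)
    qed
    have subW: "{xs. v # xs \<in> E} \<subseteq> W" for v
      by (auto simp: W_def dest!: subsetD[OF E])
    then have fin: "finite {xs. v # xs \<in> E}" for v using W(1) finite_subset by blast
    have deg_le: "real (card {xs. v # xs \<in> E}) \<le> n ^ k" for v
      using card_mono[OF W(1) subW[of v]] W(2) by (simp add: n_def flip: of_nat_power)
    \<comment> \<open>Vertices that start many of the lists; by averaging there are at least \<open>M\<close> of them.\<close>
    define X where "X = {v \<in> V. d / 2 * n ^ k \<le> real (card {xs. v # xs \<in> E})}"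
    have "real (card E) = (\<Sum>v\<in>V. real (card {xs. v # xs \<in> E}))"
      unfolding card_lists_Suc_eq_sum[OF V E] by (rule of_nat_sum)
    also have "\<dots> \<le> real (card X) * n ^ k + n * max (d / 2 * n ^ k) 0"
      unfolding X_def n_def using deg_le n by (intro heavy_elements V) (auto simp: n_def)
    also have "max (d / 2 * n ^ k) 0 = d / 2 * n ^ k" using Suc.prems n by simp
    finally have "d * n ^ Suc k \<le> real (card X) * n ^ k + n * (d / 2 * n ^ k)"
      using dE by (simp add: n_def)
    then have "(d / 2 * n) * n ^ k \<le> real (card X) * n ^ k" by (simp add: algebra_simps)
    then have "d / 2 * n \<le> real (card X)" using n by simp
    then have "M \<le> card X" using Mn by simp
    then obtain Y where Y: "Y \<subseteq> X" "card Y = M" "finite Y"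
      using obtain_subset_with_card_n by metis
    \<comment> \<open>\<open>c xs\<close> collects the members of \<open>Y\<close> that extend the tail \<open>xs\<close>. Double counting shows that a
      positive proportion of the tails has at least \<open>t\<close> such extensions; \<open>M \<ge> 4 * t / d\<close> was chosen
      for this.\<close>
    define c where "c xs = {v \<in> Y. v # xs \<in> E}" for xs
    have fc: "finite (c xs)" "card (c xs) \<le> M" for xs
      using Y card_mono[of Y "c xs"] by (auto simp: c_def)
    define G where "G = {xs \<in> W. real t \<le> real (card (c xs))}"
    have "real M * (d / 2 * n ^ k) = (\<Sum>v\<in>Y. d / 2 * n ^ k)" using Y by simp
    also have "\<dots> \<le> (\<Sum>v\<in>Y. real (card {xs. v # xs \<in> E}))"
      using Y by (intro sum_mono) (auto simp: X_def)
    also have "\<dots> = (\<Sum>v\<in>Y. \<Sum>xs\<in>W. if v # xs \<in> E then 1 else 0)"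
    proof (rule sum.cong[OF refl])
      fix v
      have "W \<inter> {xs. v # xs \<in> E} = {xs. v # xs \<in> E}" using subW[of v] by blast
      then show "real (card {xs. v # xs \<in> E}) = (\<Sum>xs\<in>W. if v # xs \<in> E then 1 else 0)"
        using W(1) by (simp add: sum.If_cases)
    qed
    also have "\<dots> = (\<Sum>xs\<in>W. \<Sum>v\<in>Y. if v # xs \<in> E then 1 else 0)" by (rule sum.swap)
    also have "\<dots> = (\<Sum>xs\<in>W. real (card (c xs)))"
      using Y(3) by (intro sum.cong[OF refl]) (simp add: sum.If_cases c_def Int_def)
    also have "\<dots> \<le> real (card G) * real M + real (card W) * max (real t) 0"
      unfolding G_def using fc by (intro heavy_elements W) auto
    also have "\<dots> = real (card G) * real M + real t * n ^ k" using W(2) by (simp add: n_def)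
    finally have "real M * (d / 2 * n ^ k) \<le> real (card G) * real M + real t * n ^ k" .
    moreover have "real t * n ^ k \<le> d / 4 * real M * n ^ k"
      using M n by (intro mult_right_mono) auto
    ultimately have "real M * (d / 4 * n ^ k) \<le> real M * real (card G)"
      by (simp add: algebra_simps)
    then have cG: "d / 4 * n ^ k \<le> real (card G)" using M by simp
    \<comment> \<open>The extensions form one of the \<open>2 ^ M\<close> subsets of \<open>Y\<close>, a number that does not depend on the
      host, so a positive proportion of the tails shares them.\<close>
    have finG: "finite G" using W by (simp add: G_def)
    have "c xs \<in> Pow Y" for xs unfolding c_def by blast
    then have "G = (\<Union>D\<in>Pow Y. {xs \<in> G. c xs = D})" by blast
    then have "card G \<le> (\<Sum>D\<in>Pow Y. card {xs \<in> G. c xs = D})"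
      using card_UN_le[of "Pow Y" "\<lambda>D. {xs \<in> G. c xs = D}"] Y(3) by simp
    then have G2: "real (card G) \<le> (\<Sum>D\<in>Pow Y. real (card {xs \<in> G. c xs = D}))"
      unfolding of_nat_sum[symmetric] by (rule of_nat_mono)
    have "\<exists>D\<in>Pow Y. d' * n ^ k \<le> real (card {xs \<in> G. c xs = D})"
    proof (rule ccontr)
      assume none: "\<not> ?thesis"
      have lt: "real (card {xs \<in> G. c xs = D}) < d' * n ^ k" if D: "D \<in> Pow Y" for D
      proof (rule ccontr)
        assume "\<not> ?thesis"
        then have "d' * n ^ k \<le> real (card {xs \<in> G. c xs = D})" by (simp only: not_less)
        then show False using none D by blast
      qed
      have "(\<Sum>D\<in>Pow Y. real (card {xs \<in> G. c xs = D})) < (\<Sum>D\<in>Pow Y. d' * n ^ k)"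
      proof (rule sum_strict_mono)
        show "finite (Pow Y)" using Y(3) by simp
        show "Pow Y \<noteq> {}" by (rule Pow_not_empty)
      qed (rule lt)
      also have "\<dots> = d / 4 * n ^ k" using Y by (simp add: card_Pow d'_def)
      finally show False using G2 cG by simp
    qed
    then obtain D where "D \<in> Pow Y" and D2: "d' * n ^ k \<le> real (card {xs \<in> G. c xs = D})"
      by (elim bexE)
    then have DY: "D \<subseteq> Y" by (simp only: Pow_iff)
    note D = DY D2
    define E' where "E' = {xs \<in> G. c xs = D}"
    have "0 < d' * n ^ k" using \<open>d' > 0\<close> n by simp
    then have "real (card E') > 0" using D2 unfolding E'_def by linarith
    then have "E' \<noteq> {}" by (metis card.empty less_irrefl of_nat_0)
    then obtain xs where xs: "xs \<in> E'" by blast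
    then have "xs \<in> G" and cD: "c xs = D" unfolding E'_def by blast+
    then have "t \<le> card (c xs)" unfolding G_def by simp
    then have "t \<le> card D" by (simp only: cD)
    then obtain A0 where A0: "A0 \<subseteq> D" "card A0 = t" using obtain_subset_with_card_n by blast
    have "E' \<subseteq> {xs. set xs \<subseteq> V \<and> length xs = k}" unfolding E'_def G_def W_def by blast
    moreover have "d' * real (card V) ^ k \<le> real (card E')" using D(2) by (simp add: E'_def n_def)
    moreover have "n0 \<le> card V" using nV by simp
    ultimately have "\<exists>A. (\<forall>i<k. A i \<subseteq> V \<and> card (A i) = t) \<and>
        (\<forall>xs. length xs = k \<longrightarrow> (\<forall>i<k. xs ! i \<in> A i) \<longrightarrow> xs \<in> E')"
      by (intro n0[OF V])
    then obtain A where A: "\<forall>i<k. A i \<subseteq> V \<and> card (A i) = t"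
      "\<forall>xs. length xs = k \<longrightarrow> (\<forall>i<k. xs ! i \<in> A i) \<longrightarrow> xs \<in> E'"
      by (elim exE conjE)
    define A' where "A' i = (case i of 0 \<Rightarrow> A0 | Suc j \<Rightarrow> A j)" for i
    show "\<exists>A. (\<forall>i<Suc k. A i \<subseteq> V \<and> card (A i) = t) \<and>
      (\<forall>xs. length xs = Suc k \<longrightarrow> (\<forall>i<Suc k. xs ! i \<in> A i) \<longrightarrow> xs \<in> E)"
    proof (intro exI[of _ A'] conjI allI impI)
      fix i assume i: "i < Suc k"
      have "X \<subseteq> V" unfolding X_def by blast
      then have "A0 \<subseteq> V" using A0(1) DY Y(1) by blast
      then show "A' i \<subseteq> V" "card (A' i) = t"
        using A(1) A0(2) i unfolding A'_def by (cases i; simp)+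
    next
      fix xs assume xs: "length xs = Suc k" "\<forall>i<Suc k. xs ! i \<in> A' i"
      then obtain v ys where vy: "xs = v # ys" "length ys = k" by (cases xs) auto
      have v: "v \<in> A0" using xs(2)[rule_format, of 0] vy by (simp add: A'_def)
      have "\<forall>i<k. ys ! i \<in> A i"
      proof (intro allI impI)
        fix i assume "i < k"
        then show "ys ! i \<in> A i" using xs(2)[rule_format, of "Suc i"] vy by (simp add: A'_def)
      qed
      then have "ys \<in> E'" using A(2) vy(2) by blast
      then have "c ys = D" by (simp add: E'_def)
      then have "v \<in> c ys" using v A0(1) by blast
      then show "xs \<in> E" by (simp add: c_def vy)
    qed
  qed
qed

text \<open>One application of the two-colour Ramsey theorem per relation. The bound depends on the number of
  relations only, so the relations may be chosen after the set \<open>B\<close>.\<close>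

lemma ramsey_several_relations:
  "\<exists>M. \<forall>(B :: 'a set) (rel :: 'a set \<Rightarrow> nat \<Rightarrow> bool). finite B \<longrightarrow> M \<le> card B \<longrightarrow>
    (\<exists>Q\<subseteq>B. card Q = s \<and> ((\<exists>j<c. \<forall>S\<in>nsets Q l. \<not> rel S j) \<or> (\<forall>j<c. \<forall>S\<in>nsets Q l. rel S j)))"
proof (induction c)
  case 0
  show ?case by (intro exI[of _ s]) (metis less_zeroE obtain_subset_with_card_n)
next
  case (Suc c)
  then obtain M where M: "\<And>(B :: 'a set) (rel :: 'a set \<Rightarrow> nat \<Rightarrow> bool). finite B \<Longrightarrow> M \<le> card B \<Longrightarrow>
    \<exists>Q\<subseteq>B. card Q = s \<and> ((\<exists>j<c. \<forall>S\<in>nsets Q l. \<not> rel S j) \<or> (\<forall>j<c. \<forall>S\<in>nsets Q l. rel S j))"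
    by blast
  obtain N :: nat where N: "partn_lst {..<N} [s, M] l" using ramsey_full by blast
  show ?case
  proof (intro exI[of _ N] allI impI)
    fix B :: "'a set" and rel :: "'a set \<Rightarrow> nat \<Rightarrow> bool"
    assume B: "finite B" "N \<le> card B"
    obtain B' where B': "B' \<subseteq> B" "card B' = N" "finite B'"
      using obtain_subset_with_card_n[OF B(2)] by blast
    obtain h where h: "bij_betw h {..<N} B'"
      using ex_bij_betw_nat_finite[OF B'(3)] B'(2) by (auto simp: lessThan_atLeast0)
    define f where "f S = (if rel (h ` S) c then 1 else 0::nat)" for S
    have "f \<in> nsets {..<N} l \<rightarrow> {..<length [s, M]}" by (auto simp: f_def)
    then obtain i K where i: "i < length [s, M]" and K: "K \<in> nsets {..<N} ([s, M] ! i)" "f ` nsets K l \<subseteq> {i}"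
      using N unfolding partn_lst_def monochromatic_def by blast
    have Ksub: "K \<subseteq> {..<N}" "card K = [s, M] ! i" using K by (auto simp: nsets_def)
    have inj: "inj_on h K" using h Ksub by (meson bij_betw_def inj_on_subset)
    define Q where "Q = h ` K"
    have Q: "Q \<subseteq> B" "card Q = [s, M] ! i" "finite Q"
      using h Ksub B' inj K(1) by (auto simp: Q_def card_image nsets_def bij_betw_def)
    have col: "rel S c \<longleftrightarrow> i = 1" if S: "S \<in> nsets Q l" for S
    proof -
      obtain K' where K': "K' \<in> nsets K l" "S = h ` K'"
        using nset_image_obtains[OF S[unfolded Q_def] inj] by blast
      then have "f K' = i" using K(2) by blast
      then show ?thesis using K'(2) by (auto simp: f_def split: if_splits)
    qed
    show "\<exists>Q\<subseteq>B. card Q = s \<and> ((\<exists>j<Suc c. \<forall>S\<in>nsets Q l. \<not> rel S j) \<or> (\<forall>j<Suc c. \<forall>S\<in>nsets Q l. rel S j))"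
    proof (cases "i = 0")
      case True
      then have "\<forall>S\<in>nsets Q l. \<not> rel S c" "card Q = s" using col Q by auto
      then show ?thesis using Q(1) by blast
    next
      case False
      then have "i = 1" using i by auto
      then have all: "\<And>S. S \<in> nsets Q l \<Longrightarrow> rel S c" and "card Q = M" using col Q by auto
      then obtain Q' where Q': "Q' \<subseteq> Q" "card Q' = s"
        "(\<exists>j<c. \<forall>S\<in>nsets Q' l. \<not> rel S j) \<or> (\<forall>j<c. \<forall>S\<in>nsets Q' l. rel S j)"
        using M[OF Q(3), of rel] by auto
      have sub: "nsets Q' l \<subseteq> nsets Q l" by (rule nsets_mono[OF Q'(1)])
      have "(\<exists>j<Suc c. \<forall>S\<in>nsets Q' l. \<not> rel S j) \<or> (\<forall>j<Suc c. \<forall>S\<in>nsets Q' l. rel S j)"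
        using Q'(3)
      proof
        assume "\<exists>j<c. \<forall>S\<in>nsets Q' l. \<not> rel S j"
        then show ?thesis using less_SucI by blast
      next
        assume a: "\<forall>j<c. \<forall>S\<in>nsets Q' l. rel S j"
        have "\<forall>j<Suc c. \<forall>S\<in>nsets Q' l. rel S j"
        proof (intro allI impI ballI)
          fix j S assume j: "j < Suc c" and S: "S \<in> nsets Q' l"
          show "rel S j"
          proof (cases "j = c")
            case True then show ?thesis using all sub S by blast
          next
            case False then show ?thesis using a j S by simp
          qed
        qed
        then show ?thesis by blast
      qed
      moreover have "Q' \<subseteq> B" using Q'(1) Q(1) by (rule order_trans)
      ultimately show ?thesis using Q'(2) by (intro exI[of _ Q'] conjI)
    qed
  qed
qed

text \<open>Each choice only has to avoid \<open>Z\<close> and the fewer than \<open>card P\<close> sets chosen before.\<close>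

lemma greedy_disjoint_choice:
  assumes "finite P" "finite Z"
    and ex: "\<And>p Z'. p \<in> P \<Longrightarrow> finite Z' \<Longrightarrow> card Z' \<le> card Z + r * card P \<Longrightarrow>
       \<exists>R. finite R \<and> card R = r \<and> R \<inter> Z' = {} \<and> good p R"
  shows "\<exists>\<rho>. (\<forall>p\<in>P. finite (\<rho> p) \<and> card (\<rho> p) = r \<and> \<rho> p \<inter> Z = {} \<and> good p (\<rho> p)) \<and>
     (\<forall>p\<in>P. \<forall>p'\<in>P. p \<noteq> p' \<longrightarrow> \<rho> p \<inter> \<rho> p' = {})"
  using assms(1) ex
proof (induction P rule: finite_induct)
  case empty
  then show ?case by simp
next
  case (insert a P)
  have ex': "\<exists>R. finite R \<and> card R = r \<and> R \<inter> Z' = {} \<and> good p R"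
    if p: "p \<in> P" "finite Z'" "card Z' \<le> card Z + r * card P" for p Z'
  proof (rule insert.prems)
    have "r * card P \<le> r * card (insert a P)" using insert.hyps by simp
    then show "card Z' \<le> card Z + r * card (insert a P)" using p(3) by linarith
  qed (use p in simp_all)
  have "\<exists>\<rho>. (\<forall>p\<in>P. finite (\<rho> p) \<and> card (\<rho> p) = r \<and> \<rho> p \<inter> Z = {} \<and> good p (\<rho> p)) \<and>
     (\<forall>p\<in>P. \<forall>p'\<in>P. p \<noteq> p' \<longrightarrow> \<rho> p \<inter> \<rho> p' = {})"
    by (rule insert.IH) (rule ex')
  then obtain \<rho> where
    \<rho>: "\<forall>p\<in>P. finite (\<rho> p) \<and> card (\<rho> p) = r \<and> \<rho> p \<inter> Z = {} \<and> good p (\<rho> p)"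
      "\<forall>p\<in>P. \<forall>p'\<in>P. p \<noteq> p' \<longrightarrow> \<rho> p \<inter> \<rho> p' = {}"
    by (elim exE conjE)
  define Z' where "Z' = Z \<union> (\<Union>p\<in>P. \<rho> p)"
  have "card (\<Union>p\<in>P. \<rho> p) \<le> (\<Sum>p\<in>P. card (\<rho> p))" using insert.hyps by (intro card_UN_le)
  also have "\<dots> = r * card P" using \<rho> by simp
  finally have "card Z' \<le> card Z + r * card P"
    unfolding Z'_def using card_Un_le[of Z "\<Union>p\<in>P. \<rho> p"] by linarith
  then have "card Z' \<le> card Z + r * card (insert a P)" using insert.hyps by simp
  moreover have "finite Z'" using assms(2) insert.hyps \<rho> by (auto simp: Z'_def)
  ultimately obtain R where R: "finite R" "card R = r" "R \<inter> Z' = {}" "good a R"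
    using insert.prems[of a Z'] by blast
  show ?case
  proof (intro exI[of _ "\<rho>(a := R)"] conjI ballI impI)
    fix p assume p: "p \<in> insert a P"
    have "finite ((\<rho>(a := R)) p) \<and> card ((\<rho>(a := R)) p) = r \<and> (\<rho>(a := R)) p \<inter> Z = {} \<and> good p ((\<rho>(a := R)) p)"
    proof (cases "p = a")
      case True
      have "R \<inter> Z = {}" using R(3) by (auto simp: Z'_def)
      then show ?thesis using True R by simp
    next
      case False
      then have "p \<in> P" using p by simp
      then show ?thesis using False \<rho>(1) by simp
    qed
    then show "finite ((\<rho>(a := R)) p)" "card ((\<rho>(a := R)) p) = r" "(\<rho>(a := R)) p \<inter> Z = {}" "good p ((\<rho>(a := R)) p)"
      by blast+
  next
    fix p p' assume pp: "p \<in> insert a P" "p' \<in> insert a P" "p \<noteq> p'"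
    have RP: "R \<inter> \<rho> q = {}" if "q \<in> P" for q using R(3) that by (auto simp: Z'_def)
    consider "p = a" "p' \<in> P" "p' \<noteq> a" | "p' = a" "p \<in> P" "p \<noteq> a" | "p \<in> P" "p' \<in> P" "p \<noteq> a" "p' \<noteq> a"
      using pp by blast
    then show "(\<rho>(a := R)) p \<inter> (\<rho>(a := R)) p' = {}"
      using RP \<rho>(2) pp(3) by cases (simp_all add: Int_commute)
  qed
qed

section \<open>The linked grid and the clique cone\<close>

definition relabel :: "('a \<Rightarrow> 'b) \<Rightarrow> 'a hypergraph \<Rightarrow> 'b hypergraph" where
  "relabel h F = (h ` verts F, (\<lambda>e. h ` e) ` edges F)"

lemma contains_copy_relabel:
  assumes h: "inj_on h (verts F)" and sub: "\<And>e. e \<in> edges F \<Longrightarrow> e \<subseteq> verts F"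
  shows "contains_copy H (relabel h F) \<longleftrightarrow> contains_copy H F"
proof
  assume "contains_copy H (relabel h F)"
  then obtain f where f: "inj_on f (h ` verts F)" "f ` h ` verts F \<subseteq> verts H"
    "\<And>e. e \<in> edges F \<Longrightarrow> f ` h ` e \<in> edges H"
    by (auto simp: contains_copy_def relabel_def)
  have "inj_on (f \<circ> h) (verts F)" by (rule comp_inj_on[OF h f(1)])
  moreover have "(f \<circ> h) ` verts F \<subseteq> verts H" using f(2) by (simp only: image_comp)
  moreover have "(f \<circ> h) ` e \<in> edges H" if "e \<in> edges F" for e
    using f(3)[OF that] by (simp only: image_comp)
  ultimately show "contains_copy H F" unfolding contains_copy_def by blast
next
  assume "contains_copy H F"
  then obtain f where f: "inj_on f (verts F)" "f ` verts F \<subseteq> verts H"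
    "\<And>e. e \<in> edges F \<Longrightarrow> f ` e \<in> edges H"
    by (auto simp: contains_copy_def)
  define g where "g = f \<circ> inv_into (verts F) h"
  have gh: "g ` h ` X = f ` X" if "X \<subseteq> verts F" for X
  proof -
    have "inv_into (verts F) h ` h ` X = X" by (rule inv_into_image_cancel[OF h that])
    then show ?thesis by (simp only: g_def image_comp[symmetric])
  qed
  have "inj_on g (h ` verts F)"
    unfolding g_def using inj_on_inv_into[of "h ` verts F" h "verts F"] f(1)
    by (intro comp_inj_on) (auto simp: inv_into_image_cancel[OF h])
  then show "contains_copy H (relabel h F)"
    unfolding contains_copy_def relabel_def
    using f(2,3) gh[OF order_refl] gh[OF sub] by (intro exI[of _ g]) auto
qed

lemma kgraph_relabel:
  assumes "kgraph k F" "inj_on h (verts F)"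
  shows "kgraph k (relabel h F)"
proof -
  have "h ` e \<in> nsets (h ` verts F) k" if "e \<in> edges F" for e
  proof -
    have e: "e \<subseteq> verts F" "finite e" "card e = k" using that assms(1) by (auto simp: kgraph_def nsets_def)
    then show ?thesis using inj_on_subset[OF assms(2) e(1)] by (auto simp: nsets_def card_image)
  qed
  then show ?thesis using assms(1) by (auto simp: kgraph_def relabel_def)
qed

type_synonym grid_vertex = "(nat \<times> nat) + ((nat \<times> nat) set \<times> nat \<times> nat)"

text \<open>The \<open>k\<close> parts are the rows; the first \<open>l\<close> columns form the core, and the remaining \<open>l\<close> columns of
  row \<open>i\<close> form block \<open>i\<close>.\<close>

definition grid :: "nat \<Rightarrow> nat \<Rightarrow> (nat \<times> nat) set" where
  "grid k l = {..<k} \<times> {..<2 * l}"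

definition core :: "nat \<Rightarrow> nat \<Rightarrow> (nat \<times> nat) set" where
  "core k l = {..<k} \<times> {..<l}"

definition block :: "nat \<Rightarrow> nat \<Rightarrow> (nat \<times> nat) set" where
  "block l i = {i} \<times> {l..<2 * l}"

definition transversal :: "nat \<Rightarrow> (nat \<Rightarrow> nat) \<Rightarrow> (nat \<times> nat) set" where
  "transversal k g = (\<lambda>i. (i, g i)) ` {..<k}"

definition link_pairs :: "nat \<Rightarrow> nat \<Rightarrow> ((nat \<times> nat) set \<times> nat) set" where
  "link_pairs k l = nsets (core k l) l \<times> {..<k}"

definition connector :: "nat \<Rightarrow> (nat \<times> nat) set \<times> nat \<Rightarrow> grid_vertex set" where
  "connector r p = (\<lambda>j. Inr (fst p, snd p, j)) ` {..<r}"

text \<open>The first graph of the pair. Its vertices are grid points and, for each pair of an \<open>l\<close>-subset of the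
  core and a block, \<open>k - l\<close> private connecting vertices.\<close>

definition linked_grid :: "nat \<Rightarrow> nat \<Rightarrow> grid_vertex hypergraph" where
  "linked_grid k l =
     (Inl ` grid k l \<union> (\<Union>p\<in>link_pairs k l. connector (k - l) p),
      {Inl ` transversal k g | g. \<forall>i<k. g i < 2 * l} \<union>
      {Inl ` fst p \<union> connector (k - l) p | p. p \<in> link_pairs k l} \<union>
      {Inl ` block l (snd p) \<union> connector (k - l) p | p. p \<in> link_pairs k l})"

lemma transversal_subset: "\<forall>i<k. g i < 2 * l \<Longrightarrow> transversal k g \<subseteq> grid k l"
  by (auto simp: transversal_def grid_def)

lemma card_transversal: "finite (transversal k g)" "card (transversal k g) = k"
  by (auto simp: transversal_def card_image inj_on_def)

lemma link_pairsD:
  assumes "p \<in> link_pairs k l"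
  shows "fst p \<subseteq> core k l" "finite (fst p)" "card (fst p) = l" "snd p < k"
  using assms by (auto simp: link_pairs_def nsets_def)

lemma finite_link_pairs: "finite (link_pairs k l)"
  by (simp add: link_pairs_def core_def finite_imp_finite_nsets)

lemma card_block: "finite (block l i)" "card (block l i) = l"
  by (auto simp: block_def card_cartesian_product)

lemma core_subset_grid: "core k l \<subseteq> grid k l"
  by (auto simp: core_def grid_def)

lemma block_subset_grid: "i < k \<Longrightarrow> block l i \<subseteq> grid k l"
  by (auto simp: block_def grid_def)

lemma card_connector: "finite (connector r p)" "card (connector r p) = r"
  by (auto simp: connector_def card_image inj_on_def)

lemma linked_grid_verts:
  "verts (linked_grid k l) = Inl ` grid k l \<union> (\<Union>p\<in>link_pairs k l. connector (k - l) p)"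
  by (simp only: linked_grid_def fst_conv)

lemma transversal_edge:
  assumes "\<forall>i<k. g i < 2 * l"
  shows "Inl ` transversal k g \<in> edges (linked_grid k l)"
  unfolding linked_grid_def snd_conv using assms by (intro UnI1 CollectI exI[of _ g] conjI refl)

lemma core_edge:
  assumes "p \<in> link_pairs k l"
  shows "Inl ` fst p \<union> connector (k - l) p \<in> edges (linked_grid k l)"
  unfolding linked_grid_def snd_conv using assms
  by (intro UnI1[OF UnI2] CollectI exI[of _ p] conjI refl)

lemma block_edge:
  assumes "p \<in> link_pairs k l"
  shows "Inl ` block l (snd p) \<union> connector (k - l) p \<in> edges (linked_grid k l)"
  unfolding linked_grid_def snd_conv using assms
  by (intro UnI2 CollectI exI[of _ p] conjI refl)

lemma linked_grid_edge_cases: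
  assumes "e \<in> edges (linked_grid k l)"
  obtains (transversal) g where "e = Inl ` transversal k g" "\<forall>i<k. g i < 2 * l"
    | (core) p where "e = Inl ` fst p \<union> connector (k - l) p" "p \<in> link_pairs k l"
    | (block) p where "e = Inl ` block l (snd p) \<union> connector (k - l) p" "p \<in> link_pairs k l"
  using assms unfolding linked_grid_def snd_conv Un_iff mem_Collect_eq by blast

lemma kgraph_linked_grid:
  assumes "l < k"
  shows "kgraph k (linked_grid k l)"
proof -
  have conn: "Inl ` X \<union> connector (k - l) p \<in> nsets (verts (linked_grid k l)) k"
    if X: "finite X" "card X = l" "X \<subseteq> grid k l" and p: "p \<in> link_pairs k l" for X p
  proof -
    have "card (Inl ` X \<union> connector (k - l) p) = card (Inl ` X :: grid_vertex set) + card (connector (k - l) p)"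
      using X card_connector by (intro card_Un_disjoint) (auto simp: connector_def)
    then have 1: "card (Inl ` X \<union> connector (k - l) p) = k"
      using X assms by (simp add: card_image card_connector)
    have 2: "finite (Inl ` X \<union> connector (k - l) p)" using X card_connector by simp
    have "Inl ` X \<subseteq> (Inl ` grid k l :: grid_vertex set)" by (rule image_mono[OF X(3)])
    moreover have "connector (k - l) p \<subseteq> (\<Union>p\<in>link_pairs k l. connector (k - l) p)"
      by (rule UN_upper[OF p])
    ultimately have 3: "Inl ` X \<union> connector (k - l) p \<subseteq> verts (linked_grid k l)"
      unfolding linked_grid_verts by (rule Un_mono)
    show ?thesis using 1 2 3 by (simp add: nsets_def)
  qed
  have "finite (verts (linked_grid k l))"
    unfolding linked_grid_verts by (simp add: grid_def finite_link_pairs card_connector)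
  moreover have "e \<in> nsets (verts (linked_grid k l)) k" if "e \<in> edges (linked_grid k l)" for e
    using that
  proof (cases rule: linked_grid_edge_cases)
    case (transversal g)
    have "Inl ` transversal k g \<subseteq> verts (linked_grid k l)"
      unfolding linked_grid_verts by (intro le_supI1 image_mono transversal_subset transversal(2))
    moreover have "card (Inl ` transversal k g :: grid_vertex set) = k"
      by (simp add: card_image card_transversal)
    ultimately show ?thesis using transversal(1) card_transversal by (simp add: nsets_def)
  next
    case (core p)
    note p = link_pairsD[OF core(2)]
    show ?thesis unfolding core(1)
      using p(1) core_subset_grid by (intro conn p(2,3) core(2)) (rule order_trans)
  next
    case (block p)
    note p = link_pairsD[OF block(2)]
    show ?thesis unfolding block(1)
      by (intro conn card_block block(2) block_subset_grid p(4))
  qed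
  ultimately show ?thesis by (simp add: kgraph_def subsetI)
qed

text \<open>Apart from its two linking edges for each pair, the grid only has transversal edges. These force both
  colours into the core, and a blue block. The conditions on \<open>J\<close> exclude every colouring of the
  connecting vertices between that block and a subset of the core with \<open>s\<close> red vertices.\<close>

lemma linked_grid_not_bicoloured:
  assumes l: "0 < l" "l < k"
    and J: "0 \<notin> J" "k \<notin> J" "s \<le> l" "\<And>b. b \<le> k - l \<Longrightarrow> b \<notin> J \<or> s + b \<notin> J"
    and col: "\<And>e. e \<in> edges (linked_grid k l) \<Longrightarrow> card {v \<in> e. red v} \<in> J"
  shows False
proof -
  define c where "c x \<longleftrightarrow> red (Inl x)" for x
  have trans: "card {x \<in> transversal k g. c x} \<in> J" if "\<forall>i<k. g i < 2 * l" for g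
  proof -
    have "{v \<in> Inl ` transversal k g. red v} = Inl ` {x \<in> transversal k g. c x}"
      by (auto simp: c_def)
    then have "card {v \<in> Inl ` transversal k g. red v} = card (Inl ` {x \<in> transversal k g. c x} :: grid_vertex set)"
      by (simp only:)
    also have "\<dots> = card {x \<in> transversal k g. c x}" by (simp add: card_image)
    finally show ?thesis using col[OF transversal_edge[OF that]] by (simp only:)
  qed
  \<comment> \<open>Otherwise the blocks contain an entirely red transversal, against \<open>k \<notin> J\<close>.\<close>
  have "\<exists>i<k. \<forall>x\<in>block l i. \<not> c x"
  proof (rule ccontr)
    assume "\<not> ?thesis"
    then have ex: "\<exists>x\<in>block l i. c x" if "i < k" for i using that by blast
    have "\<forall>i\<in>{..<k}. \<exists>y. y < 2 * l \<and> c (i, y)"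
    proof
      fix i assume "i \<in> {..<k}"
      then obtain x where "x \<in> block l i" "c x" using ex by blast
      then show "\<exists>y. y < 2 * l \<and> c (i, y)" by (cases x) (auto simp: block_def)
    qed
    from bchoice[OF this] obtain g where g: "\<And>i. i < k \<Longrightarrow> g i < 2 * l \<and> c (i, g i)" by blast
    then have "{x \<in> transversal k g. c x} = transversal k g" by (auto simp: transversal_def)
    then show False using trans[of g] g J(2) by (simp add: card_transversal)
  qed
  then obtain i where i: "i < k" "\<And>x. x \<in> block l i \<Longrightarrow> \<not> c x" by blast
  have finC: "finite (core k l)" by (simp add: core_def)
  \<comment> \<open>Fewer than \<open>l\<close> vertices cannot fill a row of the core, so the others contain a transversal.\<close>
  have many: "l \<le> card {x \<in> core k l. P x}"
    if "\<And>g. \<forall>i<k. g i < 2 * l \<Longrightarrow> \<not> (\<forall>x\<in>transversal k g. \<not> P x)" for P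
  proof (rule ccontr)
    assume less: "\<not> l \<le> card {x \<in> core k l. P x}"
    have "\<forall>i\<in>{..<k}. \<exists>y. y < l \<and> \<not> P (i, y)"
    proof (intro ballI, rule ccontr)
      fix i assume "i \<in> {..<k}" "\<not> (\<exists>y. y < l \<and> \<not> P (i, y))"
      then have "Pair i ` {..<l} \<subseteq> {x \<in> core k l. P x}" by (auto simp: core_def)
      then have "card (Pair i ` {..<l}) \<le> card {x \<in> core k l. P x}"
        using finC by (intro card_mono) auto
      then show False using less by (simp add: card_image inj_on_def)
    qed
    from bchoice[OF this] obtain g where g: "\<And>i. i < k \<Longrightarrow> g i < l \<and> \<not> P (i, g i)" by blast
    then have "\<forall>i<k. g i < 2 * l" by fastforce
    moreover have "\<forall>x\<in>transversal k g. \<not> P x" using g by (auto simp: transversal_def)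
    ultimately show False using that by blast
  qed
  have reds: "l \<le> card {x \<in> core k l. c x}"
  proof (rule many, rule notI)
    fix g assume g: "\<forall>i<k. g i < 2 * l" "\<forall>x\<in>transversal k g. \<not> c x"
    then have "{x \<in> transversal k g. c x} = {}" by blast
    then have "card {x \<in> transversal k g. c x} = 0" by (simp only: card.empty)
    then show False using trans[OF g(1)] J(1) by (simp only:)
  qed
  have blues: "l \<le> card {x \<in> core k l. \<not> c x}"
  proof (rule many, rule notI)
    fix g assume g: "\<forall>i<k. g i < 2 * l" "\<forall>x\<in>transversal k g. \<not> \<not> c x"
    then have "{x \<in> transversal k g. c x} = transversal k g" by blast
    then have "card {x \<in> transversal k g. c x} = k" by (simp only: card_transversal)
    then show False using trans[OF g(1)] J(2) by (simp only:)
  qed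
  have "s \<le> card {x \<in> core k l. c x}" using reds J(3) by linarith
  then obtain A1 where A1: "A1 \<subseteq> {x \<in> core k l. c x}" "card A1 = s" "finite A1"
    by (rule obtain_subset_with_card_n)
  have "l - s \<le> card {x \<in> core k l. \<not> c x}" using blues by linarith
  then obtain A0 where A0: "A0 \<subseteq> {x \<in> core k l. \<not> c x}" "card A0 = l - s" "finite A0"
    by (rule obtain_subset_with_card_n)
  \<comment> \<open>An \<open>l\<close>-subset of the core with exactly \<open>s\<close> red vertices; block \<open>i\<close> has none.\<close>
  define S where "S = A1 \<union> A0"
  have "card S = l"
    unfolding S_def using A1 A0 J(3) by (subst card_Un_disjoint) auto
  then have p: "(S, i) \<in> link_pairs k l"
    using A1 A0 i(1) by (auto simp: link_pairs_def nsets_def S_def)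
  have redS: "{x \<in> S. c x} = A1" using A1 A0 by (auto simp: S_def)
  define b where "b = card {v \<in> connector (k - l) (S, i). red v}"
  have b: "b \<le> k - l"
    using card_mono[OF card_connector(1)[of "k - l" "(S, i)"], of "{v \<in> connector (k - l) (S, i). red v}"]
    by (auto simp: b_def card_connector)
  have count: "card {v \<in> Inl ` X \<union> connector (k - l) (S, i). red v} = card {x \<in> X. c x} + b"
    if "finite X" for X
  proof -
    have "{v \<in> Inl ` X \<union> connector (k - l) (S, i). red v}
      = Inl ` {x \<in> X. c x} \<union> {v \<in> connector (k - l) (S, i). red v}" by (auto simp: c_def)
    then have "card {v \<in> Inl ` X \<union> connector (k - l) (S, i). red v}
      = card (Inl ` {x \<in> X. c x} \<union> {v \<in> connector (k - l) (S, i). red v})" by (simp only:)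
    also have "\<dots> = card (Inl ` {x \<in> X. c x} :: grid_vertex set) + b"
      unfolding b_def using that card_connector(1)[of "k - l" "(S, i)"]
      by (intro card_Un_disjoint) (auto simp: connector_def)
    also have "card (Inl ` {x \<in> X. c x} :: grid_vertex set) = card {x \<in> X. c x}" by (simp add: card_image)
    finally show ?thesis .
  qed
  have "Inl ` S \<union> connector (k - l) (S, i) \<in> edges (linked_grid k l)"
    "Inl ` block l i \<union> connector (k - l) (S, i) \<in> edges (linked_grid k l)"
    using core_edge[OF p] block_edge[OF p] by simp_all
  note inJ = col[OF this(1)] col[OF this(2)]
  have "finite S" using A1(3) A0(3) by (simp add: S_def)
  have "card {x \<in> S. c x} + b \<in> J" "card {x \<in> block l i. c x} + b \<in> J"
    using inJ count[OF \<open>finite S\<close>] count[OF card_block(1)[of l i]] by (simp_all only:)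
  moreover have "{x \<in> block l i. c x} = {}" using i(2) by blast
  ultimately show False using J(4)[OF b] A1(2) redS by simp
qed

text \<open>The connecting sets are chosen greedily after the grid has been placed. Hence it suffices that
  linked sets have common link members avoiding any set of bounded size.\<close>

lemma linked_grid_embeds:
  assumes V: "finite V" and \<phi>: "inj_on \<phi> (grid k l)" "\<phi> ` grid k l \<subseteq> V"
    and trans: "\<And>g. \<forall>i<k. g i < 2 * l \<Longrightarrow> \<phi> ` transversal k g \<in> E"
    and links: "\<And>S i Z. S \<in> nsets (core k l) l \<Longrightarrow> i < k \<Longrightarrow> finite Z \<Longrightarrow>
       card Z \<le> card (grid k l) + (k - l) * card (link_pairs k l) \<Longrightarrow>
       \<exists>R. R \<subseteq> V \<and> finite R \<and> card R = k - l \<and> R \<inter> Z = {} \<and> \<phi> ` S \<union> R \<in> E \<and> \<phi> ` block l i \<union> R \<in> E"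
  shows "contains_copy (V, E) (linked_grid k l)"
proof -
  define r where "r = k - l"
  define good where "good p R \<longleftrightarrow> R \<subseteq> V \<and> \<phi> ` fst p \<union> R \<in> E \<and> \<phi> ` block l (snd p) \<union> R \<in> E" for p R
  have cg: "card (\<phi> ` grid k l) = card (grid k l)" using \<phi>(1) by (rule card_image)
  have ex: "\<exists>R. finite R \<and> card R = r \<and> R \<inter> Z' = {} \<and> good p R"
    if "p \<in> link_pairs k l" "finite Z'" "card Z' \<le> card (\<phi> ` grid k l) + r * card (link_pairs k l)" for p Z'
    using links[of "fst p" "snd p" Z'] that unfolding good_def cg r_def link_pairs_def
    by (auto simp: mem_Times_iff)
  have "finite (\<phi> ` grid k l)" by (simp add: grid_def)
  have "\<exists>\<rho>. (\<forall>p\<in>link_pairs k l. finite (\<rho> p) \<and> card (\<rho> p) = r \<and> \<rho> p \<inter> \<phi> ` grid k l = {} \<and> good p (\<rho> p)) \<and>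
    (\<forall>p\<in>link_pairs k l. \<forall>p'\<in>link_pairs k l. p \<noteq> p' \<longrightarrow> \<rho> p \<inter> \<rho> p' = {})"
    by (rule greedy_disjoint_choice[OF finite_link_pairs \<open>finite (\<phi> ` grid k l)\<close>]) (rule ex)
  then obtain \<rho> where \<rho>: "\<forall>p\<in>link_pairs k l. finite (\<rho> p) \<and> card (\<rho> p) = r \<and> \<rho> p \<inter> \<phi> ` grid k l = {} \<and> good p (\<rho> p)"
    "\<forall>p\<in>link_pairs k l. \<forall>p'\<in>link_pairs k l. p \<noteq> p' \<longrightarrow> \<rho> p \<inter> \<rho> p' = {}"
    by (elim exE conjE)
  have "\<exists>h. bij_betw h {..<r} (\<rho> p)" if "p \<in> link_pairs k l" for p
    using ex_bij_betw_nat_finite[of "\<rho> p"] \<rho>(1) that by (auto simp: lessThan_atLeast0)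
  then obtain h where h: "\<And>p. p \<in> link_pairs k l \<Longrightarrow> bij_betw (h p) {..<r} (\<rho> p)" by metis
  define f where "f v = (case v of Inl x \<Rightarrow> \<phi> x | Inr (S, i, j) \<Rightarrow> h (S, i) j)" for v
  have fInl: "f (Inl x) = \<phi> x" for x by (simp add: f_def)
  have fInr: "f (Inr (S, i, j)) = h (S, i) j" for S i j by (simp add: f_def)
  have fX: "f ` Inl ` X = \<phi> ` X" for X by (simp add: image_image fInl)
  have fC: "f ` connector r p = \<rho> p" if "p \<in> link_pairs k l" for p
  proof -
    have "f ` connector r p = h p ` {..<r}" by (simp add: connector_def image_image fInr)
    then show ?thesis using h[OF that] by (simp add: bij_betw_def)
  qed
  have "inj_on f (verts (linked_grid k l))"
  proof (rule inj_onI)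
    fix v w assume v: "v \<in> verts (linked_grid k l)" and w: "w \<in> verts (linked_grid k l)" and eq: "f v = f w"
    have cases: "(\<exists>x\<in>grid k l. u = Inl x) \<or> (\<exists>p\<in>link_pairs k l. \<exists>j<r. u = Inr (fst p, snd p, j))"
      if "u \<in> verts (linked_grid k l)" for u
      using that by (auto simp: linked_grid_def connector_def r_def)
    have inr: "h p j \<in> \<rho> p" if "p \<in> link_pairs k l" "j < r" for p j
      using h[OF that(1)] that(2) by (auto simp: bij_betw_def)
    from cases[OF v] cases[OF w] consider
        x y where "v = Inl x" "w = Inl y" "x \<in> grid k l" "y \<in> grid k l"
      | x p j where "v = Inl x" "x \<in> grid k l" "w = Inr (fst p, snd p, j)" "p \<in> link_pairs k l" "j < r"
      | x p j where "w = Inl x" "x \<in> grid k l" "v = Inr (fst p, snd p, j)" "p \<in> link_pairs k l" "j < r"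
      | p j p' j' where "v = Inr (fst p, snd p, j)" "p \<in> link_pairs k l" "j < r"
          "w = Inr (fst p', snd p', j')" "p' \<in> link_pairs k l" "j' < r"
      by blast
    then show "v = w"
    proof cases
      case 1
      then show ?thesis using eq \<phi>(1) by (auto simp: fInl inj_on_def)
    next
      case 2
      then have "\<phi> x \<in> \<rho> p" using eq inr by (simp add: fInl fInr)
      then show ?thesis using \<rho>(1) 2 by blast
    next
      case 3
      then have "h p j = \<phi> x" using eq by (simp add: fInl fInr)
      then have "\<phi> x \<in> \<rho> p" using inr[OF 3(4,5)] by simp
      then show ?thesis using \<rho>(1) 3 by blast
    next
      case 4
      then have hh: "h p j = h p' j'" using eq by (simp add: fInr)
      then have "p = p'" using \<rho>(2) inr[OF 4(2,3)] inr[OF 4(5,6)] 4(2,5) by (metis disjoint_iff)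
      then have "j = j'" using h[OF 4(2)] hh 4(3,6) by (auto simp: bij_betw_def inj_on_def)
      then show ?thesis using 4 \<open>p = p'\<close> by simp
    qed
  qed
  moreover have "f ` verts (linked_grid k l) \<subseteq> V"
  proof -
    have "f ` verts (linked_grid k l) = \<phi> ` grid k l \<union> (\<Union>p\<in>link_pairs k l. \<rho> p)"
      unfolding linked_grid_verts image_Un fX image_UN r_def[symmetric] using fC by simp
    then show ?thesis using \<phi>(2) \<rho>(1) by (auto simp: good_def)
  qed
  moreover have "f ` e \<in> E" if "e \<in> edges (linked_grid k l)" for e
  proof -
    from that show ?thesis
    proof (cases rule: linked_grid_edge_cases)
      case (transversal g)
      then show ?thesis using trans by (simp add: fX)
    next
      case (core p)
      then show ?thesis using \<rho>(1) fC[OF core(2)] by (simp add: image_Un fX good_def r_def)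
    next
      case (block p)
      then show ?thesis using \<rho>(1) fC[OF block(2)] by (simp add: image_Un fX good_def r_def)
    qed
  qed
  ultimately show ?thesis unfolding contains_copy_def by auto
qed

text \<open>The second graph of the pair.\<close>

definition clique_cone :: "nat \<Rightarrow> nat \<Rightarrow> nat \<Rightarrow> nat hypergraph" where
  "clique_cone r l q = ({..<r + q}, (\<lambda>S. {..<r} \<union> S) ` nsets {r..<r + q} l)"

lemma kgraph_clique_cone:
  assumes "l \<le> q"
  shows "kgraph (r + l) (clique_cone r l q)" "edges (clique_cone r l q) \<noteq> {}"
proof -
  have "{..<r} \<union> S \<in> nsets {..<r + q} (r + l)" if "S \<in> nsets {r..<r + q} l" for S
  proof -
    have S: "S \<subseteq> {r..<r + q}" "finite S" "card S = l" using that by (auto simp: nsets_def)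
    then have "card ({..<r} \<union> S) = card {..<r} + card S" by (intro card_Un_disjoint) auto
    then show ?thesis using S by (auto simp: nsets_def)
  qed
  then show "kgraph (r + l) (clique_cone r l q)" by (auto simp: kgraph_def clique_cone_def)
  show "edges (clique_cone r l q) \<noteq> {}"
    using assms by (auto simp: clique_cone_def nsets_eq_empty_iff)
qed

lemma clique_cone_embeds:
  assumes R: "finite R" "card R = r" "R \<subseteq> verts H" and Q: "finite Q" "card Q = q" "Q \<subseteq> verts H"
    and disj: "R \<inter> Q = {}" and E: "\<And>S. S \<in> nsets Q l \<Longrightarrow> R \<union> S \<in> edges H"
  shows "contains_copy H (clique_cone r l q)"
proof -
  obtain f where f: "bij_betw f {..<r} R"
    using ex_bij_betw_nat_finite[OF R(1)] R(2) by (auto simp: lessThan_atLeast0)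
  have "\<exists>g. bij_betw g {r..<r + q} Q"
    using Q by (intro finite_same_card_bij) auto
  then obtain g where g: "bij_betw g {r..<r + q} Q" ..
  define h where "h x = (if x < r then f x else g x)" for x
  have hf: "h ` {..<r} = R" using f by (auto simp: h_def bij_betw_def)
  have hg: "h ` S = g ` S" if "S \<subseteq> {r..<r + q}" for S using that by (auto simp: h_def)
  have hQ: "h ` {r..<r + q} = Q" using hg[OF order_refl] g by (simp add: bij_betw_def)
  have split: "{..<r + q} = {..<r} \<union> {r..<r + q}" by auto
  have inj: "inj_on h {..<r + q}"
    unfolding split
  proof (rule inj_on_Un[THEN iffD2], intro conjI)
    show "inj_on h {..<r}" using f by (auto simp: h_def bij_betw_def inj_on_def)
    show "inj_on h {r..<r + q}" using g by (auto simp: h_def bij_betw_def inj_on_def)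
    show "h ` ({..<r} - {r..<r + q}) \<inter> h ` ({r..<r + q} - {..<r}) = {}"
      using disj hf hQ by blast
  qed
  have "h ` ({..<r} \<union> S) \<in> edges H" if "S \<in> nsets {r..<r + q} l" for S
  proof -
    have S: "S \<subseteq> {r..<r + q}" "finite S" "card S = l" using that by (auto simp: nsets_def)
    have "S \<subseteq> {..<r + q}" using S(1) by auto
    then have "inj_on h S" by (rule inj_on_subset[OF inj])
    then have "h ` S \<in> nsets Q l" using S hQ by (auto simp: nsets_def card_image)
    then show ?thesis using E hf by (simp add: image_Un)
  qed
  moreover have "h ` {..<r + q} \<subseteq> verts H" unfolding split image_Un hf hQ using R Q by simp
  ultimately show ?thesis using inj unfolding contains_copy_def clique_cone_def by auto
qed

section \<open>The joint upper bound\<close>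

definition link :: "nat \<Rightarrow> 'a hypergraph \<Rightarrow> 'a set \<Rightarrow> 'a set set" where
  "link k H T = {R \<in> nsets (verts H - T) (k - card T). T \<union> R \<in> edges H}"

lemma degree_eq_card_link: "degree k H T = card (link k H T)"
  by (simp add: degree_def link_def)

lemma link_subset: "T \<in> nsets V l \<Longrightarrow> link k H T \<subseteq> nsets (verts H) (k - l)"
  by (auto simp: link_def nsets_def)

lemma eventually_binomial_bounds:
  assumes "0 < \<epsilon>"
  shows "\<forall>\<^sub>F n in sequentially. (1 - \<epsilon>) * real n ^ r \<le> real ((n - l) choose r) * fact r \<and>
    real ((n - l) choose r) * fact r \<le> (1 + \<epsilon>) * real n ^ r"
proof -
  have "\<forall>\<^sub>F n in sequentially. 1 - \<epsilon> < real ((n - l) choose r) * fact r / real n ^ r"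
    by (rule order_tendstoD(1)[OF falling_binomial_ratio]) (use assms in simp)
  moreover have "\<forall>\<^sub>F n in sequentially. real ((n - l) choose r) * fact r / real n ^ r < 1 + \<epsilon>"
    by (rule order_tendstoD(2)[OF falling_binomial_ratio]) (use assms in simp)
  ultimately show ?thesis
    using eventually_gt_at_top[of 0]
  proof eventually_elim
    case (elim n)
    have "real n ^ r > 0" using elim(3) by simp
    then show ?case using elim(1,2) by (simp add: field_simps)
  qed
qed

text \<open>What it means for a host to be large: restricting to the complement of an \<open>l\<close>-set hardly changes the
  number of \<open>r\<close>-sets, \<open>z\<close> vertices meet few \<open>r\<close>-sets, and degrees near one half give a positive
  proportion of edges.\<close>

lemma eventually_host_size_estimates:
  fixes \<eta> :: real and z :: nat
  assumes l: "l < k" and e: "0 < \<eta>" "\<eta> \<le> 1 / 4"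
  shows "\<forall>\<^sub>F n in sequentially.
    real (n choose (k - l)) \<le> (1 + \<eta>) * real ((n - l) choose (k - l)) \<and>
    real z * real ((n - 1) choose (k - l - 1)) < \<eta> * real ((n - l) choose (k - l)) \<and>
    1 / (16 * fact l * fact (k - l)) * real n ^ k \<le> real (n choose l) * ((1 / 2 - \<eta>) * real ((n - l) choose (k - l)))"
proof -
  define r where "r = k - l"
  have r: "0 < r" using l by (simp add: r_def)
  have e3: "0 < \<eta> / 3" using e by simp
  have large: "\<forall>\<^sub>F n in sequentially. 4 * real z * fact r / \<eta> < real n"
    using filterlim_real_sequentially by (simp add: filterlim_at_top_dense)
  from eventually_binomial_bounds[OF e3, of r l] eventually_binomial_bounds[OF e3, of r 0]
    eventually_binomial_bounds[of "1 / 2" l 0, simplified] eventually_binomial_bounds[of 1 "r - 1" 1, simplified]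
    large eventually_gt_at_top[of 0]
  have "\<forall>\<^sub>F n in sequentially. real (n choose r) \<le> (1 + \<eta>) * real ((n - l) choose r) \<and>
    real z * real ((n - 1) choose (r - 1)) < \<eta> * real ((n - l) choose r) \<and>
    1 / (16 * fact l * fact r) * real n ^ k \<le> real (n choose l) * ((1 / 2 - \<eta>) * real ((n - l) choose r))"
  proof eventually_elim
    case (elim n)
    have n: "real n > 0" using elim(6) by simp
    have fr: "(fact r :: real) > 0" "(fact l :: real) > 0" by simp_all
    have half: "real n ^ r / 2 \<le> real ((n - l) choose r) * fact r"
    proof -
      have "real n ^ r / 2 = 1 / 2 * real n ^ r" by simp
      also have "\<dots> \<le> (1 - \<eta> / 3) * real n ^ r" using e n by (intro mult_right_mono) auto
      finally show ?thesis using elim(1) by linarith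
    qed
    have 1: "real (n choose r) \<le> (1 + \<eta>) * real ((n - l) choose r)"
    proof -
      have "real (n choose r) * fact r \<le> (1 + \<eta> / 3) * real n ^ r" using elim(2) by simp
      also have "\<dots> \<le> ((1 + \<eta>) * (1 - \<eta> / 3)) * real n ^ r"
      proof (intro mult_right_mono)
        have "\<eta> * \<eta> \<le> \<eta>" using e by (simp add: mult_left_le)
        then show "1 + \<eta> / 3 \<le> (1 + \<eta>) * (1 - \<eta> / 3)" by (simp add: field_simps)
      qed (use n in simp)
      also have "\<dots> = (1 + \<eta>) * ((1 - \<eta> / 3) * real n ^ r)" by simp
      also have "\<dots> \<le> (1 + \<eta>) * (real ((n - l) choose r) * fact r)"
        using elim(1) e by (intro mult_left_mono) auto
      finally have "real (n choose r) * fact r \<le> ((1 + \<eta>) * real ((n - l) choose r)) * fact r"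
        by (simp only: mult.assoc)
      then show ?thesis using fr(1) by (simp only: mult_le_cancel_right_pos)
    qed
    have 2: "real z * real ((n - 1) choose (r - 1)) < \<eta> * real ((n - l) choose r)"
    proof -
      have "real ((n - 1) choose (r - 1)) \<le> real ((n - 1) choose (r - 1)) * fact (r - 1)"
        by (simp add: mult_le_cancel_left1 fact_ge_1)
      also have "\<dots> \<le> 2 * real n ^ (r - 1)" using elim(4) by simp
      finally have "real z * real ((n - 1) choose (r - 1)) * fact r \<le> real z * (2 * real n ^ (r - 1)) * fact r"
        by (intro mult_right_mono mult_left_mono) auto
      also have "\<dots> = (2 * real z * fact r) * real n ^ (r - 1)" by simp
      also have "\<dots> < (\<eta> / 2 * real n) * real n ^ (r - 1)"
      proof (rule mult_strict_right_mono)
        show "2 * real z * fact r < \<eta> / 2 * real n" using elim(5) e by (simp add: field_simps)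
      qed (use n in simp)
      also have "\<dots> = \<eta> * (real n ^ r / 2)"
      proof -
        have "real n ^ r = real n * real n ^ (r - 1)" using r by (cases r) auto
        then show ?thesis by simp
      qed
      also have "\<dots> \<le> \<eta> * (real ((n - l) choose r) * fact r)"
        using half e by (intro mult_left_mono) auto
      finally have "real z * real ((n - 1) choose (r - 1)) * fact r < \<eta> * real ((n - l) choose r) * fact r"
        by (simp only: mult.assoc)
      then show ?thesis using fr(1) by (simp only: mult_less_cancel_right_pos)
    qed
    have 3: "1 / (16 * fact l * fact r) * real n ^ k \<le> real (n choose l) * ((1 / 2 - \<eta>) * real ((n - l) choose r))"
    proof -
      have "k = l + r" using l by (simp add: r_def)
      then have "real n ^ k = real n ^ l * real n ^ r" by (simp only: power_add)
      then have "1 / (16 * fact l * fact r) * real n ^ k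
          = (real n ^ l / 2 / fact l) * (1 / 4 * (real n ^ r / 2 / fact r))"
        by (simp add: field_simps)
      also have "\<dots> \<le> real (n choose l) * ((1 / 2 - \<eta>) * real ((n - l) choose r))"
      proof (intro mult_mono)
        show "real n ^ l / 2 / fact l \<le> real (n choose l)" using elim(3) fr by (simp add: field_simps)
        show "real n ^ r / 2 / fact r \<le> real ((n - l) choose r)" using half fr by (simp add: field_simps)
      qed (use e n in auto)
      finally show ?thesis .
    qed
    show ?case using 1 2 3 by blast
  qed
  then show ?thesis by (simp only: r_def)
qed

text \<open>An \<open>l\<close>-set and a member of its link, listed one after the other, can be recovered from the combined
  list, since their sizes are known. So the number of lists is at least the sum of the degrees.\<close>

lemma card_edge_lists_ge:
  fixes H :: "'a hypergraph" and D :: real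
  assumes H: "kgraph k H" and l: "l \<le> k"
    and D: "\<And>T. T \<in> nsets (verts H) l \<Longrightarrow> D \<le> real (degree k H T)"
  shows "real (card (verts H) choose l) * D
    \<le> real (card {xs. set xs \<subseteq> verts H \<and> length xs = k \<and> distinct xs \<and> set xs \<in> edges H})"
proof -
  define V where "V = verts H"
  define E where "E = {xs. set xs \<subseteq> V \<and> length xs = k \<and> distinct xs \<and> set xs \<in> edges H}"
  have finV: "finite V" using H by (simp add: kgraph_def V_def)
  have "E \<subseteq> {xs. set xs \<subseteq> V \<and> length xs = k}" by (auto simp: E_def)
  then have finE: "finite E" using finite_lists_length_eq[OF finV] by (rule finite_subset)
  define lst where "lst X = (SOME xs. set xs = X \<and> distinct xs)" for X :: "'a set"
  have lst: "set (lst X) = X" "distinct (lst X)" if "finite X" for X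
    using someI_ex[OF finite_distinct_list[OF that]] by (simp_all add: lst_def)
  define P where "P = Sigma (nsets V l) (link k H)"
  have finL: "finite (link k H T)" for T
  proof -
    have "link k H T \<subseteq> Pow V" by (auto simp: link_def nsets_def V_def)
    then show ?thesis using finV by (simp add: finite_subset)
  qed
  have inP: "T \<subseteq> V \<and> finite T \<and> card T = l \<and> R \<subseteq> V \<and> R \<inter> T = {} \<and> finite R \<and> card R = k - l \<and> T \<union> R \<in> edges H"
    if "(T, R) \<in> P" for T R
    using that by (auto simp: P_def link_def nsets_def V_def)
  define F where "F p = lst (fst p) @ lst (snd p)" for p :: "'a set \<times> 'a set"
  have "inj_on F P"
  proof (rule inj_onI)
    fix p p' assume p: "p \<in> P" "p' \<in> P" and eq: "F p = F p'"
    obtain T R T' R' where TR: "p = (T, R)" "p' = (T', R')" by (cases p, cases p')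
    note a = inP[OF p(1)[unfolded TR]] and b = inP[OF p(2)[unfolded TR]]
    have "length (lst T) = l" "length (lst T') = l"
      using a b lst[of T] lst[of T'] distinct_card[of "lst T"] distinct_card[of "lst T'"] by simp_all
    then have "lst T = lst T'" "lst R = lst R'" using eq by (simp_all add: F_def TR)
    then have "set (lst T) = set (lst T')" "set (lst R) = set (lst R')" by simp_all
    then show "p = p'" using a b lst(1) by (simp add: TR)
  qed
  moreover have "F ` P \<subseteq> E"
  proof (rule image_subsetI)
    fix p assume p: "p \<in> P"
    obtain T R where TR: "p = (T, R)" by (cases p)
    note a = inP[OF p[unfolded TR]]
    have T: "set (lst T) = T" "distinct (lst T)" and R: "set (lst R) = R" "distinct (lst R)"
      using a lst[of T] lst[of R] by simp_all
    have "length (lst T) = l" "length (lst R) = k - l"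
      using a T R distinct_card[of "lst T"] distinct_card[of "lst R"] by simp_all
    then show "F p \<in> E" using a T R l by (auto simp: E_def F_def TR)
  qed
  ultimately have "card P \<le> card E" using finE by (rule card_inj_on_le)
  moreover have "card P = (\<Sum>T\<in>nsets V l. card (link k H T))"
    unfolding P_def using finV finL by (simp add: finite_imp_finite_nsets)
  ultimately have "(\<Sum>T\<in>nsets V l. card (link k H T)) \<le> card E" by simp
  then have "real (\<Sum>T\<in>nsets V l. card (link k H T)) \<le> real (card E)" by (rule of_nat_mono)
  then have le: "(\<Sum>T\<in>nsets V l. real (card (link k H T))) \<le> real (card E)" by (simp only: of_nat_sum)
  have "real (card V choose l) * D = (\<Sum>T\<in>nsets V l. D)" by simp
  also have "\<dots> \<le> (\<Sum>T\<in>nsets V l. real (card (link k H T)))"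
    using D by (intro sum_mono) (simp add: degree_eq_card_link V_def)
  finally show ?thesis using le by (simp add: E_def V_def)
qed

text \<open>Few \<open>r\<close>-sets meet a small set of vertices.\<close>

lemma exists_member_avoiding:
  assumes "finite V" "L \<subseteq> nsets V r" "0 < r" "finite Z"
    and "card Z * ((card V - 1) choose (r - 1)) < card L"
  shows "\<exists>R\<in>L. R \<inter> Z = {}"
proof (rule ccontr)
  assume none: "\<not> ?thesis"
  have "L \<subseteq> (\<Union>v\<in>Z \<inter> V. {R \<in> nsets V r. v \<in> R})"
  proof
    fix R assume R: "R \<in> L"
    then obtain v where "v \<in> R" "v \<in> Z" using none by blast
    moreover have "R \<in> nsets V r" using R assms(2) by blast
    moreover have "R \<subseteq> V" using \<open>R \<in> nsets V r\<close> by (simp add: nsets_def)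
    ultimately show "R \<in> (\<Union>v\<in>Z \<inter> V. {R \<in> nsets V r. v \<in> R})" by blast
  qed
  then have "card L \<le> card (\<Union>v\<in>Z \<inter> V. {R \<in> nsets V r. v \<in> R})"
    using assms(1) by (intro card_mono) (simp_all add: finite_imp_finite_nsets)
  also have "\<dots> \<le> (\<Sum>v\<in>Z \<inter> V. card {R \<in> nsets V r. v \<in> R})"
    using assms(1) by (intro card_UN_le) simp
  also have "\<dots> = (\<Sum>v\<in>Z \<inter> V. (card V - 1) choose (r - 1))"
    using assms by (intro sum.cong refl card_nsets_containing) auto
  also have "\<dots> \<le> card Z * ((card V - 1) choose (r - 1))"
    using assms(4) by (simp add: card_mono)
  finally show False using assms(5) by simp
qed

text \<open>Two almost disjoint links of density about one half are almost complementary. If all \<open>l\<close>-subsets of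
  \<open>Q\<close> are unlinked to the same \<open>S'\<close>, their links all nearly equal the complement \<open>D\<close> of the link of
  \<open>S'\<close>, and so they have a common member \<open>R\<close>. Every vertex of \<open>Q\<close> lies in an \<open>l\<close>-subset of \<open>Q\<close>, so \<open>R\<close> is
  disjoint from \<open>Q\<close>.\<close>

lemma clique_cone_of_unlinked_clique:
  fixes H :: "'a hypergraph" and \<eta> N :: real
  assumes fin: "finite (verts H)" and l: "0 < l" "l < k"
    and tot: "real (card (verts H) choose (k - l)) \<le> (1 + \<eta>) * N"
    and deg: "\<And>T. T \<in> nsets (verts H) l \<Longrightarrow> (1 / 2 - \<eta>) * N \<le> real (degree k H T)"
    and N: "0 < N" and e: "0 < \<eta>" "20 * (real (q choose l) + 1) * \<eta> \<le> 1"
    and S': "S' \<in> nsets (verts H) l" and Q: "Q \<subseteq> verts H" "card Q = q" "l \<le> q"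
    and unlinked: "\<And>S. S \<in> nsets Q l \<Longrightarrow> real (card (link k H S \<inter> link k H S')) < \<eta> * N"
  shows "contains_copy H (clique_cone (k - l) l q)"
proof -
  define U where "U = nsets (verts H) (k - l)"
  \<comment> \<open>The link of every \<open>l\<close>-subset of \<open>Q\<close> covers \<open>D\<close> up to a proportion \<open>4 * \<eta>\<close>. There are \<open>q choose l\<close>
    of them, so by the choice of \<open>\<eta>\<close> they cannot together miss all of \<open>D\<close>.\<close>
  define D where "D = U - link k H S'"
  have finU: "finite U" using fin by (simp add: U_def finite_imp_finite_nsets)
  have finQ: "finite Q" using Q(1) fin by (rule finite_subset)
  have finNQ: "finite (nsets Q l)" using finQ by (rule finite_imp_finite_nsets)
  have subU: "link k H T \<subseteq> U" if "T \<in> nsets (verts H) l" for T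
    unfolding U_def using that by (rule link_subset)
  have cardU: "real (card U) \<le> (1 + \<eta>) * N" using tot by (simp add: U_def)
  have SV: "S \<in> nsets (verts H) l" if "S \<in> nsets Q l" for S
    using that nsets_mono[OF Q(1)] by blast
  have cD: "real (card D) \<le> (1 / 2 + 2 * \<eta>) * N"
  proof -
    have "card D = card U - card (link k H S')"
      unfolding D_def using subU[OF S'] finU by (intro card_Diff_subset) (auto intro: finite_subset)
    moreover have "card (link k H S') \<le> card U" using subU[OF S'] finU by (rule card_mono[rotated])
    ultimately have "real (card D) = real (card U) - real (card (link k H S'))" by simp
    then show ?thesis using cardU deg[OF S'] by (simp add: degree_eq_card_link algebra_simps)
  qed
  have big: "(1 / 2 - 2 * \<eta>) * N \<le> real (card (link k H S \<inter> D))" if "S \<in> nsets Q l" for S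
  proof -
    have "link k H S = (link k H S \<inter> link k H S') \<union> (link k H S \<inter> D)"
      using subU[OF SV[OF that]] by (auto simp: D_def)
    then have "card (link k H S) \<le> card (link k H S \<inter> link k H S') + card (link k H S \<inter> D)"
      using card_Un_le[of "link k H S \<inter> link k H S'" "link k H S \<inter> D"] by simp
    then have "real (card (link k H S)) \<le> real (card (link k H S \<inter> link k H S')) + real (card (link k H S \<inter> D))"
      by linarith
    then show ?thesis using unlinked[OF that] deg[OF SV[OF that]]
      by (simp add: degree_eq_card_link algebra_simps)
  qed
  have finD: "finite D" using finU by (simp add: D_def)
  have miss: "real (card (D - link k H S)) \<le> 4 * \<eta> * N" if "S \<in> nsets Q l" for S
  proof -
    have "card (D - link k H S) + card (link k H S \<inter> D) = card D"
      using card_Int_Diff[OF finD, of "link k H S"] by (simp add: Int_commute)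
    then have "real (card (D - link k H S)) + real (card (link k H S \<inter> D)) = real (card D)"
      by (simp only: of_nat_add[symmetric])
    then show ?thesis using big[OF that] cD by (simp add: algebra_simps)
  qed
  have "nsets Q l \<noteq> {}" using Q finQ by (auto simp: nsets_eq_empty_iff)
  then obtain S0 where S0: "S0 \<in> nsets Q l" by blast
  have "card (link k H S0 \<inter> D) \<le> card D" using finD by (intro card_mono) auto
  then have cD': "(1 / 2 - 2 * \<eta>) * N \<le> real (card D)" using big[OF S0] by linarith
  have "\<not> D \<subseteq> (\<Union>S\<in>nsets Q l. D - link k H S)"
  proof
    assume "D \<subseteq> (\<Union>S\<in>nsets Q l. D - link k H S)"
    then have "card D \<le> card (\<Union>S\<in>nsets Q l. D - link k H S)"
      using finNQ finD by (intro card_mono) simp_all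
    also have "\<dots> \<le> (\<Sum>S\<in>nsets Q l. card (D - link k H S))" by (rule card_UN_le[OF finNQ])
    finally have "real (card D) \<le> real (\<Sum>S\<in>nsets Q l. card (D - link k H S))" by (rule of_nat_mono)
    also have "\<dots> = (\<Sum>S\<in>nsets Q l. real (card (D - link k H S)))" by (rule of_nat_sum)
    also have "\<dots> \<le> (\<Sum>S\<in>nsets Q l. 4 * \<eta> * N)" by (rule sum_mono[OF miss])
    also have "\<dots> = (4 * real (q choose l) * \<eta>) * N" using Q(2) by simp
    finally have "(1 / 2 - 2 * \<eta>) * N \<le> (4 * real (q choose l) * \<eta>) * N" using cD' by linarith
    then have "1 / 2 - 2 * \<eta> \<le> 4 * real (q choose l) * \<eta>" using N by (simp only: mult_le_cancel_right_pos)
    moreover have "20 * (real (q choose l) * \<eta>) + 20 * \<eta> \<le> 1" using e(2) by (simp add: algebra_simps)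
    moreover have "0 \<le> real (q choose l) * \<eta>" using e(1) by simp
    moreover have "4 * real (q choose l) * \<eta> = 4 * (real (q choose l) * \<eta>)" by simp
    ultimately show False using e(1) by linarith
  qed
  then obtain R where RD: "R \<in> D" and RL: "\<And>S. S \<in> nsets Q l \<Longrightarrow> R \<in> link k H S" by blast
  have R: "R \<subseteq> verts H" "finite R" "card R = k - l" using RD by (auto simp: D_def U_def nsets_def)
  show ?thesis
  proof (rule clique_cone_embeds[OF R(2,3,1) finQ Q(2,1)])
    show "R \<inter> Q = {}"
    proof (rule ccontr)
      assume "R \<inter> Q \<noteq> {}"
      then obtain x where x: "x \<in> R" "x \<in> Q" by blast
      have "l - 1 \<le> card (Q - {x})" using x(2) Q by simp
      then obtain S1 where S1: "S1 \<subseteq> Q - {x}" "card S1 = l - 1" "finite S1"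
        by (rule obtain_subset_with_card_n)
      then have "card (insert x S1) = l" using l(1) by (subst card_insert_disjoint) auto
      then have "insert x S1 \<in> nsets Q l" using S1 x(2) by (auto simp: nsets_def)
      from RL[OF this] show False using x(1) by (auto simp: link_def nsets_def)
    qed
    show "R \<union> S \<in> edges H" if "S \<in> nsets Q l" for S
      using RL[OF that] by (simp add: link_def Un_commute)
  qed
qed

text \<open>A vertex common to two parts would occur twice in a list with distinct entries.\<close>

lemma complete_partite_parts_disjoint:
  assumes A: "\<And>i. i < k \<Longrightarrow> A i \<noteq> {}"
    and all: "\<And>xs. length xs = k \<Longrightarrow> \<forall>i<k. xs ! i \<in> A i \<Longrightarrow> distinct xs"
    and ij: "i < k" "j < k" "i \<noteq> j"
  shows "A i \<inter> A j = {}"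
proof (rule ccontr)
  assume "A i \<inter> A j \<noteq> {}"
  then obtain v where v: "v \<in> A i" "v \<in> A j" by blast
  define a where "a m = (if m = i \<or> m = j then v else (SOME w. w \<in> A m))" for m
  define xs where "xs = map a [0..<k]"
  have am: "a m \<in> A m" if m: "m < k" for m
  proof -
    have "\<exists>w. w \<in> A m" using A[OF m] by blast
    then have "(SOME w. w \<in> A m) \<in> A m" by (rule someI_ex)
    then show ?thesis using v by (auto simp: a_def)
  qed
  have "distinct xs" by (rule all) (simp_all add: xs_def am)
  moreover have "xs ! i = xs ! j" "length xs = k" using ij by (simp_all add: xs_def a_def)
  ultimately show False using ij by (simp add: nth_eq_iff_index_eq)
qed

text \<open>The dichotomy between the two graphs. The core is fixed before Ramsey's theorem is applied to the
  rest of each part. This way the sets to which blocks are to be linked are known in advance, and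
  their number does not depend on the host.\<close>

theorem linked_grid_or_clique_cone:
  assumes l: "0 < l" "l < k" and q: "l \<le> q"
  shows "\<exists>\<eta>>0. \<exists>n0. \<forall>H :: 'a hypergraph. kgraph k H \<longrightarrow> n0 \<le> card (verts H) \<longrightarrow>
    (\<forall>T\<in>nsets (verts H) l. (1 / 2 - \<eta>) * real ((card (verts H) - l) choose (k - l)) \<le> real (degree k H T)) \<longrightarrow>
    contains_copy H (linked_grid k l) \<or> contains_copy H (clique_cone (k - l) l q)"
proof -
  define r where "r = k - l"
  define \<eta> :: real where "\<eta> = 1 / (20 * (real (q choose l) + 1))"
  have e: "0 < \<eta>" "\<eta> \<le> 1 / 4" "20 * (real (q choose l) + 1) * \<eta> \<le> 1"
    by (auto simp: \<eta>_def field_simps)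
  define z where "z = card (grid k l) + (k - l) * card (link_pairs k l)"
  define c where "c = card (nsets (core k l) l)"
  have fincore: "finite (nsets (core k l) l)" by (simp add: core_def finite_imp_finite_nsets)
  obtain M where M: "\<And>(B :: 'a set) (rel :: 'a set \<Rightarrow> nat \<Rightarrow> bool). finite B \<Longrightarrow> M \<le> card B \<Longrightarrow>
    \<exists>Q\<subseteq>B. card Q = q \<and> ((\<exists>j<c. \<forall>S\<in>nsets Q l. \<not> rel S j) \<or> (\<forall>j<c. \<forall>S\<in>nsets Q l. rel S j))"
    using ramsey_several_relations[of q c l] by blast
  define t where "t = l + M"
  \<comment> \<open>A lower bound for the proportion of edges among all lists of \<open>k\<close> vertices.\<close>
  define d :: real where "d = 1 / (16 * fact l * fact (k - l))"
  have "0 < d" by (simp add: d_def)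
  from dense_contains_complete_partite[OF this, of k t] obtain n1 where n1:
    "\<And>(V :: 'a set) E. finite V \<Longrightarrow> n1 \<le> card V \<Longrightarrow>
      E \<subseteq> {xs. set xs \<subseteq> V \<and> length xs = k} \<Longrightarrow> d * real (card V) ^ k \<le> real (card E) \<Longrightarrow>
      \<exists>A. (\<forall>i<k. A i \<subseteq> V \<and> card (A i) = t) \<and> (\<forall>xs. length xs = k \<longrightarrow> (\<forall>i<k. xs ! i \<in> A i) \<longrightarrow> xs \<in> E)"
    by blast
  obtain n2 where n2: "\<And>n. n2 \<le> n \<Longrightarrow>
    real (n choose (k - l)) \<le> (1 + \<eta>) * real ((n - l) choose (k - l)) \<and>
    real z * real ((n - 1) choose (k - l - 1)) < \<eta> * real ((n - l) choose (k - l)) \<and>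
    d * real n ^ k \<le> real (n choose l) * ((1 / 2 - \<eta>) * real ((n - l) choose (k - l)))"
    using eventually_host_size_estimates[OF l(2) e(1,2), of z] unfolding eventually_at_top_linorder d_def by blast
  have main: "contains_copy H (linked_grid k l) \<or> contains_copy H (clique_cone (k - l) l q)"
    if H: "kgraph k H" and n: "max n1 n2 \<le> card (verts H)"
      and deg: "\<And>T. T \<in> nsets (verts H) l \<Longrightarrow>
        (1 / 2 - \<eta>) * real ((card (verts H) - l) choose (k - l)) \<le> real (degree k H T)"
    for H :: "'a hypergraph"
  proof -
    define V where "V = verts H"
    define n where "n = card V"
    define N where "N = real ((n - l) choose (k - l))"
    have finV: "finite V" using H by (simp add: kgraph_def V_def)
    have est: "real (n choose (k - l)) \<le> (1 + \<eta>) * N" "real z * real ((n - 1) choose (k - l - 1)) < \<eta> * N"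
      "d * real n ^ k \<le> real (n choose l) * ((1 / 2 - \<eta>) * N)"
      using n2[of n] n by (simp_all add: n_def V_def N_def)
    have degN: "(1 / 2 - \<eta>) * N \<le> real (degree k H T)" if "T \<in> nsets (verts H) l" for T
      using deg[OF that] by (simp add: N_def n_def V_def)
    have "0 \<le> real z * real ((n - 1) choose (k - l - 1))" by simp
    then have "0 < \<eta> * N" using est(2) by linarith
    then have N: "0 < N" using e(1) by (simp only: zero_less_mult_pos)
    define E where "E = {xs. set xs \<subseteq> V \<and> length xs = k \<and> distinct xs \<and> set xs \<in> edges H}"
    have "\<exists>A. (\<forall>i<k. A i \<subseteq> V \<and> card (A i) = t) \<and> (\<forall>xs. length xs = k \<longrightarrow> (\<forall>i<k. xs ! i \<in> A i) \<longrightarrow> xs \<in> E)"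
    proof (rule n1[OF finV])
      show "n1 \<le> card V" using n by (simp add: V_def)
      show "E \<subseteq> {xs. set xs \<subseteq> V \<and> length xs = k}" unfolding E_def by blast
      have "real (card (verts H) choose l) * ((1 / 2 - \<eta>) * N) \<le> real (card E)"
        unfolding E_def V_def by (rule card_edge_lists_ge[OF H less_imp_le[OF l(2)] degN])
      then show "d * real (card V) ^ k \<le> real (card E)" using est(3) by (simp add: n_def V_def)
    qed
    then obtain A where A: "\<forall>i<k. A i \<subseteq> V \<and> card (A i) = t"
      and AE: "\<forall>xs. length xs = k \<longrightarrow> (\<forall>i<k. xs ! i \<in> A i) \<longrightarrow> xs \<in> E"
      by (elim exE conjE)
    have t: "0 < t" "l \<le> t" using l by (simp_all add: t_def)
    have finA: "finite (A i)" if "i < k" for i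
      using A that finV by (meson finite_subset)
    have disj: "A i \<inter> A j = {}" if "i < k" "j < k" "i \<noteq> j" for i j
    proof (rule complete_partite_parts_disjoint[OF _ _ that])
      show "A i \<noteq> {}" if "i < k" for i using A that t(1) by force
      show "distinct xs" if "length xs = k" "\<forall>i<k. xs ! i \<in> A i" for xs
        using AE that unfolding E_def by blast
    qed
    have "\<forall>i\<in>{..<k}. \<exists>h. bij_betw h {..<t} (A i)"
    proof
      fix i assume "i \<in> {..<k}"
      then show "\<exists>h. bij_betw h {..<t} (A i)"
        using ex_bij_betw_nat_finite[OF finA, of i] A by (simp add: lessThan_atLeast0)
    qed
    from bchoice[OF this] obtain h where h: "\<And>i. i < k \<Longrightarrow> bij_betw (h i) {..<t} (A i)" by blast
    have hA: "h i x \<in> A i" if "i < k" "x < t" for i x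
      using h[OF that(1)] that(2) by (auto simp: bij_betw_def)
    define ec where "ec p = h (fst p) (snd p)" for p
    have inj_ec: "inj_on ec (core k l)"
    proof (rule inj_onI)
      fix p p' assume p: "p \<in> core k l" "p' \<in> core k l" and eq: "ec p = ec p'"
      have lt: "fst p < k" "snd p < t" "fst p' < k" "snd p' < t" using p t(2) by (auto simp: core_def)
      have "fst p = fst p'"
        using disj[OF lt(1,3)] hA[OF lt(1,2)] hA[OF lt(3,4)] eq unfolding ec_def by auto
      moreover have "snd p = snd p'"
        using h[OF lt(1)] lt(2,4) eq \<open>fst p = fst p'\<close> unfolding ec_def bij_betw_def inj_on_def by auto
      ultimately show "p = p'" by (rule prod_eqI)
    qed
    have ecV: "ec ` S \<in> nsets V l" if S: "S \<in> nsets (core k l) l" for S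
    proof -
      have S': "S \<subseteq> core k l" "finite S" "card S = l" using S by (auto simp: nsets_def)
      have "ec p \<in> V" if "p \<in> S" for p
      proof -
        have "p \<in> core k l" using that S'(1) by blast
        then have "fst p < k" "snd p < t" using t(2) by (auto simp: core_def)
        then show ?thesis using hA A unfolding ec_def by blast
      qed
      then show ?thesis using S' inj_on_subset[OF inj_ec S'(1)] by (auto simp: nsets_def card_image)
    qed
    obtain en where en: "bij_betw en {..<c} (nsets (core k l) l)"
      using ex_bij_betw_nat_finite[OF fincore] by (auto simp: c_def lessThan_atLeast0)
    \<comment> \<open>The index \<open>j\<close> enumerates the \<open>l\<close>-subsets of the core.\<close>
    define rel where "rel S j \<longleftrightarrow> \<eta> * N \<le> real (card (link k H S \<inter> link k H (ec ` en j)))" for S j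
    define B where "B i = h i ` {l..<t}" for i
    have B: "finite (B i)" "card (B i) = M" "B i \<subseteq> A i" if i: "i < k" for i
    proof -
      have "inj_on (h i) {l..<t}" using h[OF i] by (auto simp: bij_betw_def inj_on_def)
      then show "card (B i) = M" by (simp add: B_def card_image t_def)
      show "B i \<subseteq> A i" using hA[OF i] by (auto simp: B_def)
    qed (simp add: B_def)
    have BV: "B i \<subseteq> V" if "i < k" for i using B(3)[OF that] A that by blast
    have ram: "\<exists>Q\<subseteq>B i. card Q = q \<and> ((\<exists>j<c. \<forall>S\<in>nsets Q l. \<not> rel S j) \<or> (\<forall>j<c. \<forall>S\<in>nsets Q l. rel S j))"
      if i: "i < k" for i
      by (rule M) (use B[OF i] in simp_all)
    show ?thesis
    proof (cases "\<exists>i<k. \<exists>Q\<subseteq>B i. card Q = q \<and> (\<exists>j<c. \<forall>S\<in>nsets Q l. \<not> rel S j)")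
      case True
      then obtain i Q j where i: "i < k" and Q: "Q \<subseteq> B i" "card Q = q" and j: "j < c"
        and un: "\<forall>S\<in>nsets Q l. \<not> rel S j" by blast
      have "contains_copy H (clique_cone (k - l) l q)"
      proof (rule clique_cone_of_unlinked_clique[OF _ l _ degN N e(1,3)])
        show "finite (verts H)" using finV by (simp add: V_def)
        show "real (card (verts H) choose (k - l)) \<le> (1 + \<eta>) * N" using est(1) by (simp add: n_def V_def)
        have "en j \<in> nsets (core k l) l" using en j by (auto simp: bij_betw_def)
        then show "ec ` en j \<in> nsets (verts H) l" using ecV by (simp add: V_def)
        show "Q \<subseteq> verts H" using Q(1) BV[OF i] by (simp add: V_def)
        show "card Q = q" "l \<le> q" by (fact Q(2), fact q)
        show "real (card (link k H S \<inter> link k H (ec ` en j))) < \<eta> * N" if "S \<in> nsets Q l" for S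
          using un that unfolding rel_def by (simp add: not_le)
      qed
      then show ?thesis ..
    next
      case False
      have "\<forall>i\<in>{..<k}. \<exists>Q. Q \<subseteq> B i \<and> card Q = q \<and> (\<forall>j<c. \<forall>S\<in>nsets Q l. rel S j)"
      proof
        fix i assume "i \<in> {..<k}"
        then have i: "i < k" by simp
        show "\<exists>Q. Q \<subseteq> B i \<and> card Q = q \<and> (\<forall>j<c. \<forall>S\<in>nsets Q l. rel S j)"
          using ram[OF i] False i by blast
      qed
      from bchoice[OF this] obtain Q where
        Q: "\<forall>i\<in>{..<k}. Q i \<subseteq> B i \<and> card (Q i) = q \<and> (\<forall>j<c. \<forall>S\<in>nsets (Q i) l. rel S j)" ..
      have "\<forall>i\<in>{..<k}. \<exists>g. inj_on g {l..<2 * l} \<and> g ` {l..<2 * l} \<subseteq> Q i"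
      proof
        fix i assume i: "i \<in> {..<k}"
        have "finite (Q i)" using Q i B(1)[of i] by (meson finite_subset lessThan_iff)
        moreover have "card {l..<2 * l} \<le> card (Q i)" using Q i q by simp
        ultimately show "\<exists>g. inj_on g {l..<2 * l} \<and> g ` {l..<2 * l} \<subseteq> Q i"
          using card_le_inj[of "{l..<2 * l}" "Q i"] by auto
      qed
      from bchoice[OF this] obtain g where
        g: "\<forall>i\<in>{..<k}. inj_on (g i) {l..<2 * l} \<and> g i ` {l..<2 * l} \<subseteq> Q i" ..
      define \<phi> where "\<phi> p = (if snd p < l then h (fst p) (snd p) else g (fst p) (snd p))" for p
      have gB: "g i x \<in> B i" if "i < k" "l \<le> x" "x < 2 * l" for i x
      proof -
        have "g i x \<in> g i ` {l..<2 * l}" using that by simp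
        then show ?thesis using g Q that(1) by blast
      qed
      have \<phi>A: "\<phi> (i, x) \<in> A i" if "i < k" "x < 2 * l" for i x
        using that hA[of i x] gB[of i x] B(3)[of i] t(2) by (auto simp: \<phi>_def)
      have inj: "inj_on \<phi> (grid k l)"
      proof (rule inj_onI)
        fix p p' assume p: "p \<in> grid k l" "p' \<in> grid k l" and eq: "\<phi> p = \<phi> p'"
        obtain i x i' x' where px: "p = (i, x)" "p' = (i', x')" by (cases p, cases p')
        have lt: "i < k" "x < 2 * l" "i' < k" "x' < 2 * l" using p by (auto simp: grid_def px)
        have ii: "i = i'"
          using disj[OF lt(1,3)] \<phi>A[OF lt(1,2)] \<phi>A[OF lt(3,4)] eq unfolding px by auto
        have hinj: "h i y = h i y' \<Longrightarrow> y < t \<Longrightarrow> y' < t \<Longrightarrow> y = y'" for y y'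
          using h[OF lt(1)] unfolding bij_betw_def inj_on_def by simp
        have hg: "h i y \<noteq> g i y'" if "y < l" "l \<le> y'" "y' < 2 * l" for y y'
        proof
          assume eq': "h i y = g i y'"
          have "g i y' \<in> B i" by (rule gB[OF lt(1) that(2,3)])
          then obtain w where w: "l \<le> w" "w < t" "g i y' = h i w" by (auto simp: B_def)
          then have "y = w" using hinj[of y w] eq' that(1) t(2) by simp
          then show False using w(1) that(1) by simp
        qed
        have ginj: "y = y'" if "g i y = g i y'" "l \<le> y" "y < 2 * l" "l \<le> y'" "y' < 2 * l" for y y'
        proof -
          have "inj_on (g i) {l..<2 * l}" using g lt(1) by simp
          then show ?thesis using that unfolding inj_on_def by simp
        qed
        have "x = x'"
        proof (cases "x < l")
          case True
          show ?thesis
          proof (cases "x' < l")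
            case True
            then show ?thesis using \<open>x < l\<close> eq hinj[of x x'] t(2) by (simp add: px ii \<phi>_def)
          next
            case False
            then show ?thesis using \<open>x < l\<close> eq hg[of x x'] lt(4) by (simp add: px ii \<phi>_def)
          qed
        next
          case False
          show ?thesis
          proof (cases "x' < l")
            case True
            then have "h i x' = g i x" using False eq by (simp add: px ii \<phi>_def)
            then show ?thesis using hg[OF True, of x] False lt(2) by simp
          next
            case False
            then show ?thesis using \<open>\<not> x < l\<close> eq ginj[of x x'] lt(2,4) by (simp add: px ii \<phi>_def)
          qed
        qed
        then show "p = p'" using ii by (simp add: px)
      qed
      have "contains_copy (V, edges H) (linked_grid k l)"
      proof (rule linked_grid_embeds[OF finV inj])
        show "\<phi> ` grid k l \<subseteq> V"
        proof (rule image_subsetI)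
          fix p assume "p \<in> grid k l"
          then have "fst p < k" "snd p < 2 * l" by (auto simp: grid_def)
          then have "\<phi> (fst p, snd p) \<in> A (fst p)" "A (fst p) \<subseteq> V" using \<phi>A A by blast+
          then show "\<phi> p \<in> V" by auto
        qed
      next
        fix f :: "nat \<Rightarrow> nat" assume f: "\<forall>i<k. f i < 2 * l"
        define xs where "xs = map (\<lambda>i. \<phi> (i, f i)) [0..<k]"
        have "xs \<in> E" using AE \<phi>A f by (simp add: xs_def)
        moreover have "set xs = \<phi> ` transversal k f"
          by (simp add: xs_def transversal_def image_image lessThan_atLeast0)
        ultimately show "\<phi> ` transversal k f \<in> edges H" by (simp add: E_def)
      next
        fix S i and Z :: "'a set"
        assume S: "S \<in> nsets (core k l) l" and i: "i < k" and Z: "finite Z"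
          and cZ: "card Z \<le> card (grid k l) + (k - l) * card (link_pairs k l)"
        have "S \<in> en ` {..<c}" using en S by (simp add: bij_betw_def)
        then obtain j where j: "j < c" "en j = S" by auto
        have S': "S \<subseteq> core k l" using S by (auto simp: nsets_def)
        have \<phi>S: "\<phi> ` S = ec ` S"
        proof (rule image_cong[OF refl])
          fix p assume "p \<in> S"
          then have "snd p < l" using S' by (auto simp: core_def)
          then show "\<phi> p = ec p" by (simp add: \<phi>_def ec_def)
        qed
        have \<phi>b: "\<phi> ` block l i = g i ` {l..<2 * l}"
        proof -
          have "block l i = Pair i ` {l..<2 * l}" by (auto simp: block_def)
          then have "\<phi> ` block l i = (\<lambda>x. \<phi> (i, x)) ` {l..<2 * l}" by (simp only: image_image)
          also have "\<dots> = g i ` {l..<2 * l}" by (rule image_cong[OF refl]) (simp add: \<phi>_def)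
          finally show ?thesis .
        qed
        have gi: "inj_on (g i) {l..<2 * l}" "g i ` {l..<2 * l} \<subseteq> Q i" using g i by simp_all
        have gQ: "g i ` {l..<2 * l} \<in> nsets (Q i) l"
          using gi by (simp add: nsets_def card_image)
        have QV: "Q i \<subseteq> V" using Q i BV[OF i] by (meson lessThan_iff order_trans)
        define L where "L = link k H (\<phi> ` block l i) \<inter> link k H (\<phi> ` S)"
        have "rel (g i ` {l..<2 * l}) j" using Q i j(1) gQ by simp
        then have "\<eta> * N \<le> real (card L)" by (simp add: rel_def L_def j(2) \<phi>S \<phi>b)
        moreover have "real (card Z * ((card V - 1) choose (k - l - 1))) \<le> real z * real ((n - 1) choose (k - l - 1))"
          unfolding of_nat_mult n_def using cZ by (intro mult_right_mono of_nat_mono) (simp_all add: z_def)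
        ultimately have "real (card Z * ((card V - 1) choose (k - l - 1))) < real (card L)"
          using est(2) by linarith
        then have "card Z * ((card V - 1) choose (k - l - 1)) < card L" by (simp only: of_nat_less_iff)
        moreover have "L \<subseteq> nsets V (k - l)"
          using link_subset[OF ecV[OF S], of k H] by (auto simp: L_def \<phi>S V_def)
        ultimately obtain R where R: "R \<in> L" "R \<inter> Z = {}"
          using exists_member_avoiding[OF finV _ _ Z, of L "k - l"] l by auto
        have bV: "card (\<phi> ` block l i) = l" using gQ by (simp add: \<phi>b nsets_def)
        have "R \<in> nsets V (k - l)" using R(1) \<open>L \<subseteq> nsets V (k - l)\<close> by blast
        then have "R \<subseteq> V" "finite R" "card R = k - l" by (simp_all add: nsets_def)
        moreover have "\<phi> ` S \<union> R \<in> edges H" "\<phi> ` block l i \<union> R \<in> edges H"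
          using R(1) by (simp_all add: L_def link_def)
        ultimately show "\<exists>R. R \<subseteq> V \<and> finite R \<and> card R = k - l \<and> R \<inter> Z = {} \<and>
            \<phi> ` S \<union> R \<in> edges H \<and> \<phi> ` block l i \<union> R \<in> edges H"
          using R(2) by (intro exI[of _ R] conjI)
      qed
      then show ?thesis by (simp add: V_def)
    qed
  qed
  show ?thesis
  proof (intro exI[of _ \<eta>] conjI e(1))
    show "\<exists>n0. \<forall>H :: 'a hypergraph. kgraph k H \<longrightarrow> n0 \<le> card (verts H) \<longrightarrow>
    (\<forall>T\<in>nsets (verts H) l. (1 / 2 - \<eta>) * real ((card (verts H) - l) choose (k - l)) \<le> real (degree k H T)) \<longrightarrow>
    contains_copy H (linked_grid k l) \<or> contains_copy H (clique_cone (k - l) l q)"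
    proof (rule exI[of _ "max n1 n2"], intro allI impI)
      fix H :: "'a hypergraph"
      assume H: "kgraph k H" "max n1 n2 \<le> card (verts H)"
        "\<forall>T\<in>nsets (verts H) l. (1 / 2 - \<eta>) * real ((card (verts H) - l) choose (k - l)) \<le> real (degree k H T)"
      show "contains_copy H (linked_grid k l) \<or> contains_copy H (clique_cone (k - l) l q)"
        by (rule main[OF H(1,2)]) (rule bspec[OF H(3)])
    qed
  qed
qed

section \<open>Two-coloured hosts\<close>

text \<open>The limiting relative degree of an \<open>l\<close>-set with \<open>a\<close> red vertices, if a proportion \<open>p\<close> of the
  vertices is red and \<open>J\<close> is the set of admissible numbers of red vertices.\<close>

definition binomial_weight :: "nat \<Rightarrow> real \<Rightarrow> nat set \<Rightarrow> nat \<Rightarrow> real" where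
  "binomial_weight r p J a =
     (\<Sum>b\<le>r. if a + b \<in> J then real (r choose b) * p ^ b * (1 - p) ^ (r - b) else 0)"

lemma parity_class_weight:
  assumes "0 < r"
  shows "(\<Sum>b\<le>r. if odd (a + b) then real (r choose b) else 0) = 2 ^ r / 2"
proof (cases "even a")
  case True
  then show ?thesis using choose_odd_sum[OF assms, where ?'a = real] by simp
next
  case False
  then show ?thesis using choose_even_sum[OF assms, where ?'a = real] by simp
qed

lemma binomial_weight_half:
  "binomial_weight r (1 / 2) J a = (\<Sum>b\<le>r. if a + b \<in> J then real (r choose b) else 0) / 2 ^ r"
proof -
  have "(1 / 2 :: real) ^ b * (1 - 1 / 2) ^ (r - b) = 1 / 2 ^ r" if "b \<le> r" for b
    using that by (simp add: power_add[symmetric] power_one_over)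
  then have "binomial_weight r (1 / 2) J a = (\<Sum>b\<le>r. (if a + b \<in> J then real (r choose b) else 0) / 2 ^ r)"
    unfolding binomial_weight_def by (intro sum.cong refl) (simp add: mult.assoc)
  then show ?thesis by (simp add: sum_divide_distrib)
qed

text \<open>For even \<open>k\<close> the parity of the number of red vertices has all required properties with \<open>p = 1/2\<close>. For
  odd \<open>k\<close> the number \<open>k\<close> has to be removed from \<open>J\<close>, which lowers the degree of red \<open>l\<close>-sets. The
  numbers just below \<open>k\<close> make up for this. They differ from \<open>k\<close> by at most \<open>l - 2\<close>, so that \<open>b\<close> and
  \<open>b + 1\<close> are never both in \<open>J\<close> for \<open>b \<le> k - l\<close>.\<close>

lemma parity_pattern:
  assumes l: "1 < l" "l < k" and lk: "3 \<le> l \<or> even k" and a: "a \<le> l"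
  shows "1 / 2 \<le> binomial_weight (k - l) (1 / 2) {j. j < k \<and> (odd j \<or> k - j \<le> l - 2)} a"
proof -
  define r where "r = k - l"
  define J where "J = {j. j < k \<and> (odd j \<or> k - j \<le> l - 2)}"
  have r: "0 < r" using l by (simp add: r_def)
  have k: "k = l + r" using l by (simp add: r_def)
  have "(\<Sum>b\<le>r. if odd (a + b) then real (r choose b) else 0)
    \<le> (\<Sum>b\<le>r. if a + b \<in> J then real (r choose b) else 0)"
  proof (cases "a = l \<and> odd k")
    case False
    have "a + b \<in> J" if "b \<le> r" "odd (a + b)" for b
    proof -
      have "a + b \<noteq> k"
      proof
        assume ab: "a + b = k"
        then have "a = l" using that(1) a k by simp
        moreover have "odd k" using that(2) unfolding ab .
        ultimately show False using False by simp
      qed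
      then show ?thesis using that a k by (simp add: J_def)
    qed
    then show ?thesis by (intro sum_mono) simp
  next
    case True
    \<comment> \<open>Compared with parity, \<open>k\<close> is missing from \<open>J\<close> but \<open>k - 1\<close> has been added. The former costs
      \<open>r choose r\<close>, the latter gains \<open>r choose (r - 1)\<close>.\<close>
    then have l3: "3 \<le> l" using lk by auto
    obtain m where m: "r = Suc m" using r by (cases r) auto
    define o' where "o' b = (if odd (a + b) then real (r choose b) else 0)" for b
    define j' where "j' b = (if a + b \<in> J then real (r choose b) else 0)" for b
    have "o' b \<le> j' b" if "b < m" for b
    proof -
      have "a + b < k" using True that k m by simp
      then show ?thesis by (simp add: o'_def j'_def J_def)
    qed
    then have 1: "sum o' {..<m} \<le> sum j' {..<m}" by (intro sum_mono) simp
    have "even (a + m)" using True k m by auto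
    then have 2: "o' m = 0" by (simp add: o'_def)
    have "a + m \<in> J" using True k m l3 by (simp add: J_def)
    then have 3: "j' m = real (Suc m)" by (simp add: j'_def m)
    have 4: "o' (Suc m) \<le> 1" "0 \<le> j' (Suc m)" by (simp_all add: o'_def j'_def m)
    have split: "sum f {..r} = sum f {..<m} + f m + f (Suc m)" for f :: "nat \<Rightarrow> real"
      by (simp add: m lessThan_Suc_atMost[symmetric])
    have "sum o' {..r} \<le> sum j' {..r}" unfolding split using 1 2 3 4 by simp
    then show ?thesis unfolding o'_def[abs_def] j'_def[abs_def] .
  qed
  then have "2 ^ r / 2 \<le> (\<Sum>b\<le>r. if a + b \<in> J then real (r choose b) else 0)"
    by (simp only: parity_class_weight[OF r])
  then have "1 / 2 \<le> binomial_weight r (1 / 2) J a"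
    unfolding binomial_weight_half by (simp add: field_simps)
  then show ?thesis by (simp only: r_def J_def)
qed

lemma imaginary_unit_power_mod4: "\<i> ^ j = \<i> ^ (j mod 4)"
proof -
  have "\<i> ^ j = \<i> ^ (4 * (j div 4) + j mod 4)" by simp
  also have "\<dots> = (\<i> ^ 4) ^ (j div 4) * \<i> ^ (j mod 4)" by (simp only: power_add power_mult)
  also have "\<i> ^ 4 = 1" by (simp add: power4_eq_xxxx)
  finally show ?thesis by simp
qed

text \<open>The indicator function of two consecutive residues modulo \<open>4\<close> has a single frequency apart from the
  constant \<open>1/2\<close>, so its binomial weight involves only one power of a complex number.\<close>

lemma weight_of_quarter_period:
  assumes ind: "\<And>j. (if j \<in> J then 1 else 0) = 1 / 2 + Re (c * \<i> ^ j) / 2"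
  shows "binomial_weight r p J a
    = 1 / 2 + Re (c * \<i> ^ a * (complex_of_real (1 - p) + complex_of_real p * \<i>) ^ r) / 2"
proof -
  define w where "w b = real (r choose b) * p ^ b * (1 - p) ^ (r - b)" for b
  have "binomial_weight r p J a = (\<Sum>b\<le>r. w b * (1 / 2 + Re (c * \<i> ^ (a + b)) / 2))"
    unfolding binomial_weight_def
  proof (intro sum.cong refl)
    fix b
    have "(if a + b \<in> J then w b else 0) = w b * (if a + b \<in> J then 1 else 0)" by simp
    then show "(if a + b \<in> J then real (r choose b) * p ^ b * (1 - p) ^ (r - b) else 0)
      = w b * (1 / 2 + Re (c * \<i> ^ (a + b)) / 2)" by (simp only: ind w_def)
  qed
  also have "\<dots> = (\<Sum>b\<le>r. w b) / 2 + (\<Sum>b\<le>r. w b * Re (c * \<i> ^ (a + b))) / 2"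
    by (simp add: sum.distrib[symmetric] sum_divide_distrib distrib_left)
  also have "(\<Sum>b\<le>r. w b) = (p + (1 - p)) ^ r"
    unfolding binomial_ring w_def by simp
  also have "(\<Sum>b\<le>r. w b * Re (c * \<i> ^ (a + b))) = Re (\<Sum>b\<le>r. of_real (w b) * (c * \<i> ^ (a + b)))"
    by (simp add: Re_sum)
  also have "(\<Sum>b\<le>r. of_real (w b) * (c * \<i> ^ (a + b)))
    = c * \<i> ^ a * (\<Sum>b\<le>r. of_nat (r choose b) * (complex_of_real p * \<i>) ^ b * complex_of_real (1 - p) ^ (r - b))"
    unfolding sum_distrib_left
    by (intro sum.cong refl) (simp add: w_def power_add power_mult_distrib)
  also have "(\<Sum>b\<le>r. of_nat (r choose b) * (complex_of_real p * \<i>) ^ b * complex_of_real (1 - p) ^ (r - b))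
    = (complex_of_real p * \<i> + complex_of_real (1 - p)) ^ r"
    by (simp only: binomial_ring)
  finally show ?thesis by (simp add: add.commute)
qed

text \<open>The bias \<open>p\<close> turns the phase so that the weight is exactly \<open>1/2\<close> for \<open>a = 0\<close> and \<open>a = 2\<close>. For
  \<open>a = 1\<close> it is then at its maximum.\<close>

lemma quarter_period_pattern:
  assumes r: "0 < r" and \<omega>: "0 < \<omega>" "\<omega> < pi / 2" and c: "c = of_real (sqrt 2) * cis \<theta>"
    and total: "\<theta> + real r * \<omega> = 3 * pi / 2"
    and ind: "\<And>j. (if j \<in> J then 1 else 0) = 1 / 2 + Re (c * \<i> ^ j) / 2"
  shows "\<exists>p. 0 < p \<and> p < 1 \<and> (\<forall>a\<le>2. 1 / 2 \<le> binomial_weight r p J a)"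
proof -
  have pos: "0 < sin \<omega>" "0 < cos \<omega>" using \<omega> by (auto intro: sin_gt_zero cos_gt_zero)
  define s where "s = sin \<omega> + cos \<omega>"
  \<comment> \<open>Then \<open>(1 - p) + p * \<i>\<close> has argument \<open>\<omega>\<close>.\<close>
  define p where "p = sin \<omega> / s"
  have s: "0 < s" using pos by (simp add: s_def)
  have q: "1 - p = cos \<omega> / s" using s by (simp add: p_def s_def field_simps)
  have "complex_of_real (1 - p) + complex_of_real p * \<i> = of_real (1 / s) * cis \<omega>"
    unfolding q unfolding p_def by (simp add: complex_eq_iff)
  then have "(complex_of_real (1 - p) + complex_of_real p * \<i>) ^ r = of_real ((1 / s) ^ r) * cis (real r * \<omega>)"
    by (simp only: power_mult_distrib DeMoivre of_real_power)
  note power = this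
  have "cis \<theta> * cis (real r * \<omega>) = cis (3 * pi / 2)" unfolding cis_mult total ..
  also have "\<dots> = cis (pi + pi / 2)" by (rule arg_cong[of _ _ cis]) simp
  also have "\<dots> = - \<i>" by (simp only: cis_mult[symmetric] cis_pi cis_pi_half) simp
  finally have turn: "cis \<theta> * cis (real r * \<omega>) = - \<i>" .
  have eq: "c * \<i> ^ a * (complex_of_real (1 - p) + complex_of_real p * \<i>) ^ r
     = of_real (sqrt 2 * (1 / s) ^ r) * (\<i> ^ a * - \<i>)" for a
    unfolding c power turn[symmetric] by simp
  have "0 \<le> Re (\<i> ^ a * - \<i>)" if "a \<le> 2" for a :: nat
  proof -
    from that consider "a = 0" | "a = 1" | "a = 2" by linarith
    then show ?thesis by cases simp_all
  qed
  then have "0 \<le> Re (c * \<i> ^ a * (complex_of_real (1 - p) + complex_of_real p * \<i>) ^ r)" if "a \<le> 2" for a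
  proof -
    have "Re (of_real x * w) = x * Re w" for x w by simp
    moreover have "0 \<le> sqrt 2 * (1 / s) ^ r" using s by simp
    ultimately show ?thesis unfolding eq
      using \<open>\<And>a. a \<le> 2 \<Longrightarrow> 0 \<le> Re (\<i> ^ a * - \<i>)\<close>[OF that] by (simp only: mult_nonneg_nonneg)
  qed
  then have "1 / 2 \<le> binomial_weight r p J a" if "a \<le> 2" for a
    unfolding weight_of_quarter_period[OF ind] using that by simp
  moreover have "0 < p" "p < 1" using pos s by (simp_all add: p_def s_def)
  ultimately show ?thesis by blast
qed

text \<open>The parity pattern covers all cases but \<open>l = 2\<close> with odd \<open>k\<close>. There the shift \<open>s = 2\<close> is used with
  two consecutive residues modulo \<open>4\<close>, for which \<open>b\<close> and \<open>b + 2\<close> are never both admissible. The residues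
  are those that exclude \<open>0\<close> and \<open>k\<close>.\<close>

lemma bicolouring_pattern:
  assumes l: "1 < l" "l < k"
  shows "\<exists>J p s. 0 < p \<and> p < 1 \<and> 0 \<notin> J \<and> k \<notin> J \<and> s \<le> l \<and>
    (\<forall>b\<le>k - l. b \<notin> J \<or> s + b \<notin> J) \<and> (\<forall>a\<le>l. 1 / 2 \<le> binomial_weight (k - l) p J a)"
proof (cases "3 \<le> l \<or> even k")
  case True
  define J where "J = {j. j < k \<and> (odd j \<or> k - j \<le> l - 2)}"
  have "b \<notin> J \<or> 1 + b \<notin> J" if "b \<le> k - l" for b
    using that l by (auto simp: J_def)
  moreover have "0 \<notin> J" "k \<notin> J" using l by (auto simp: J_def)
  moreover have "1 / 2 \<le> binomial_weight (k - l) (1 / 2) J a" if "a \<le> l" for a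
    unfolding J_def by (rule parity_pattern[OF l True that])
  moreover have "(1 / 2 :: real) < 1" "(0 :: real) < 1 / 2" "1 \<le> l" using l by simp_all
  ultimately show ?thesis by blast
next
  case False
  then have l2: "l = 2" and k: "odd k" using l by auto
  define r where "r = k - l"
  have r: "odd r" "0 < r" "k = r + 2" using l k by (auto simp: r_def l2)
  have k4: "k mod 4 = 1 \<or> k mod 4 = 3" using k by presburger
  define J where "J = (if k mod 4 = 1 then {j :: nat. j mod 4 = 2 \<or> j mod 4 = 3} else {j. j mod 4 = 1 \<or> j mod 4 = 2})"
  have "\<exists>p. 0 < p \<and> p < 1 \<and> (\<forall>a\<le>2. 1 / 2 \<le> binomial_weight r p J a)"
  proof (cases "k mod 4 = 1")
    case True
    have r3: "3 \<le> r" using True r by presburger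
    show ?thesis
    proof (rule quarter_period_pattern[of r "3 * pi / 4 / real r" "- 1 + \<i>" "3 * pi / 4"])
      show "3 * pi / 4 / real r < pi / 2"
      proof -
        have "3 * pi / 4 / real r \<le> 3 * pi / 4 / 3" using r3 by (intro divide_left_mono) auto
        also have "\<dots> < pi / 2" by simp
        finally show ?thesis .
      qed
      have "cis (3 * pi / 4) = cis (pi / 2 + pi / 4)" by (rule arg_cong[of _ _ cis]) simp
      also have "\<dots> = \<i> * cis (pi / 4)" by (simp only: cis_mult[symmetric] cis_pi_half)
      finally have cis: "cis (3 * pi / 4) = \<i> * cis (pi / 4)" .
      have eqs: "cos (3 * pi / 4) = - (sqrt 2 / 2)" "sin (3 * pi / 4) = (sqrt 2 / 2)"
        using arg_cong[OF cis, of Re] arg_cong[OF cis, of Im] by (simp_all add: cos_45 sin_45)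
      have "sqrt 2 * cos (3 * pi / 4) = - 1" "sqrt 2 * sin (3 * pi / 4) = 1"
        unfolding eqs by simp_all
      then show "- 1 + \<i> = of_real (sqrt 2) * cis (3 * pi / 4)"
        by (simp add: complex_eq_iff)
      show "(if j \<in> J then 1 else 0) = 1 / 2 + Re ((- 1 + \<i>) * \<i> ^ j) / 2" for j
      proof -
        have "j mod 4 < 4" by simp
        then consider "j mod 4 = 0" | "j mod 4 = 1" | "j mod 4 = 2" | "j mod 4 = 3" by linarith
        then show ?thesis
          using True unfolding imaginary_unit_power_mod4[of j] J_def
          by cases (simp_all add: power2_eq_square power3_eq_cube)
      qed
    qed (use r in simp_all)
  next
    case no1: False
    show ?thesis
    proof (rule quarter_period_pattern[of r "pi / 4 / real r" "- 1 - \<i>" "5 * pi / 4"])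
      show "pi / 4 / real r < pi / 2"
      proof -
        have "pi / 4 / real r \<le> pi / 4 / 1" using r(2) by (intro divide_left_mono) auto
        also have "\<dots> < pi / 2" by simp
        finally show ?thesis .
      qed
      have "cis (5 * pi / 4) = cis (pi + pi / 4)" by (rule arg_cong[of _ _ cis]) simp
      also have "\<dots> = - cis (pi / 4)" by (simp only: cis_mult[symmetric] cis_pi) simp
      finally have cis: "cis (5 * pi / 4) = - cis (pi / 4)" .
      have eqs: "cos (5 * pi / 4) = - (sqrt 2 / 2)" "sin (5 * pi / 4) = - (sqrt 2 / 2)"
        using arg_cong[OF cis, of Re] arg_cong[OF cis, of Im] by (simp_all add: cos_45 sin_45)
      have "sqrt 2 * cos (5 * pi / 4) = - 1" "sqrt 2 * sin (5 * pi / 4) = - 1"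
        unfolding eqs by simp_all
      then show "- 1 - \<i> = of_real (sqrt 2) * cis (5 * pi / 4)"
        by (simp add: complex_eq_iff)
      show "(if j \<in> J then 1 else 0) = 1 / 2 + Re ((- 1 - \<i>) * \<i> ^ j) / 2" for j
      proof -
        have "j mod 4 < 4" by simp
        then consider "j mod 4 = 0" | "j mod 4 = 1" | "j mod 4 = 2" | "j mod 4 = 3" by linarith
        then show ?thesis
          using no1 unfolding imaginary_unit_power_mod4[of j] J_def
          by cases (simp_all add: power2_eq_square power3_eq_cube)
      qed
    qed (use r in simp_all)
  qed
  then obtain p where p: "0 < p" "p < 1" "\<forall>a\<le>2. 1 / 2 \<le> binomial_weight r p J a" by blast
  have "0 \<notin> J" "k \<notin> J" using k4 by (auto simp: J_def)
  moreover have "b \<notin> J \<or> 2 + b \<notin> J" for b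
    unfolding J_def by (cases "k mod 4 = 1"; simp; presburger)
  ultimately show ?thesis using p unfolding l2[symmetric] r_def[symmetric] by blast
qed

lemma linked_grid_free_of_bicoloured:
  assumes l: "0 < l" "l < k"
    and J: "0 \<notin> J" "k \<notin> J" "s \<le> l" "\<And>b. b \<le> k - l \<Longrightarrow> b \<notin> J \<or> s + b \<notin> J"
    and col: "\<And>e. e \<in> edges H \<Longrightarrow> card (e \<inter> X) \<in> J"
  shows "\<not> contains_copy H (linked_grid k l)"
proof
  assume "contains_copy H (linked_grid k l)"
  then obtain f where f: "inj_on f (verts (linked_grid k l))"
    "\<forall>e\<in>edges (linked_grid k l). f ` e \<in> edges H"
    unfolding contains_copy_def by blast
  show False
  proof (rule linked_grid_not_bicoloured[OF l J, where red = "\<lambda>v. f v \<in> X"])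
    fix e assume e: "e \<in> edges (linked_grid k l)"
    then have "e \<subseteq> verts (linked_grid k l)"
      using kgraph_linked_grid[OF l(2)] unfolding kgraph_def nsets_def by blast
    then have "inj_on f {v \<in> e. f v \<in> X}" using f(1) by (auto intro: inj_on_subset)
    moreover have "f ` e \<inter> X = f ` {v \<in> e. f v \<in> X}" by blast
    ultimately have "card (f ` e \<inter> X) = card {v \<in> e. f v \<in> X}" by (simp add: card_image)
    moreover have "card (f ` e \<inter> X) \<in> J" using col f(2) e by blast
    ultimately show "card {v \<in> e. f v \<in> X} \<in> J" by (simp only:)
  qed
qed

lemma card_nsets_meeting_in:
  assumes "finite A" "finite B" "A \<inter> B = {}" "b \<le> r"
  shows "card {R \<in> nsets (A \<union> B) r. card (R \<inter> A) = b} = (card A choose b) * (card B choose (r - b))"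
proof -
  have "bij_betw (\<lambda>(R1, R2). R1 \<union> R2) (nsets A b \<times> nsets B (r - b)) {R \<in> nsets (A \<union> B) r. card (R \<inter> A) = b}"
  proof (rule bij_betw_byWitness[where f' = "\<lambda>R. (R \<inter> A, R \<inter> B)"])
    show "\<forall>p\<in>nsets A b \<times> nsets B (r - b). (\<lambda>R. (R \<inter> A, R \<inter> B)) ((\<lambda>(R1, R2). R1 \<union> R2) p) = p"
      using assms(3) by (auto simp: nsets_def)
    show "\<forall>R\<in>{R \<in> nsets (A \<union> B) r. card (R \<inter> A) = b}. (\<lambda>(R1, R2). R1 \<union> R2) (R \<inter> A, R \<inter> B) = R"
      by (auto simp: nsets_def)
    show "(\<lambda>(R1, R2). R1 \<union> R2) ` (nsets A b \<times> nsets B (r - b)) \<subseteq> {R \<in> nsets (A \<union> B) r. card (R \<inter> A) = b}"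
    proof (clarsimp)
      fix R1 R2 assume "R1 \<in> nsets A b" "R2 \<in> nsets B (r - b)"
      then have R: "R1 \<subseteq> A" "finite R1" "card R1 = b" "R2 \<subseteq> B" "finite R2" "card R2 = r - b"
        by (auto simp: nsets_def)
      have "card (R1 \<union> R2) = card R1 + card R2" using R assms(3) by (intro card_Un_disjoint) auto
      moreover have "(R1 \<union> R2) \<inter> A = R1" using R assms(3) by auto
      ultimately show "R1 \<union> R2 \<in> nsets (A \<union> B) r \<and> card ((R1 \<union> R2) \<inter> A) = b"
        using R assms(4) by (auto simp: nsets_def)
    qed
    show "(\<lambda>R. (R \<inter> A, R \<inter> B)) ` {R \<in> nsets (A \<union> B) r. card (R \<inter> A) = b} \<subseteq> nsets A b \<times> nsets B (r - b)"
    proof (clarsimp)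
      fix R assume R: "R \<in> nsets (A \<union> B) r" "b = card (R \<inter> A)"
      then have R': "R \<subseteq> A \<union> B" "finite R" "card R = r" by (auto simp: nsets_def)
      have "card R = card (R \<inter> A) + card (R \<inter> B)"
        using R' assms(3) by (subst card_Un_disjoint[symmetric]) (auto intro!: arg_cong[of _ _ card])
      then show "R \<inter> A \<in> nsets A (card (R \<inter> A)) \<and> R \<inter> B \<in> nsets B (r - card (R \<inter> A))"
        using R' by (auto simp: nsets_def)
    qed
  qed
  from bij_betw_same_card[OF this] show ?thesis by (simp add: card_cartesian_product)
qed

definition bicoloured_host :: "nat \<Rightarrow> nat set \<Rightarrow> 'a set \<Rightarrow> 'a set \<Rightarrow> 'a hypergraph" where
  "bicoloured_host k J V X = (V, {e \<in> nsets V k. card (e \<inter> X) \<in> J})"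

lemma degree_bicoloured_host:
  assumes V: "finite V" "X \<subseteq> V" and T: "T \<in> nsets V l" and l: "l \<le> k"
  defines "a \<equiv> card (T \<inter> X)"
  shows "degree k (bicoloured_host k J V X) T =
    (\<Sum>b\<le>k - l. if a + b \<in> J then ((card X - a) choose b) * ((card V - card X - (l - a)) choose (k - l - b)) else 0)"
proof -
  define r where "r = k - l"
  define A where "A = X - T"
  define B where "B = V - X - T"
  have T': "T \<subseteq> V" "finite T" "card T = l" using T by (auto simp: nsets_def)
  have AB: "finite A" "finite B" "A \<inter> B = {}" "V - T = A \<union> B"
    using V by (auto simp: A_def B_def finite_subset)
  have "card A = card X - a"
    unfolding A_def a_def using V T' by (simp add: card_Diff_subset_Int Int_commute finite_subset)
  moreover have "card B = card V - card X - (l - a)"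
  proof -
    have "card T = card (T \<inter> X) + card (T - X)" using T'(2) by (rule card_Int_Diff)
    then have "card (T - X) = l - a" using T' by (simp add: a_def)
    moreover have "(V - X) \<inter> T = T - X" using T' by blast
    ultimately have "card B = card (V - X) - (l - a)"
      unfolding B_def using V by (subst card_Diff_subset_Int) (auto simp: T'(2))
    then show ?thesis using V by (simp add: card_Diff_subset finite_subset)
  qed
  ultimately have cAB: "card A = card X - a" "card B = card V - card X - (l - a)" .
  have "{R \<in> nsets (verts (bicoloured_host k J V X) - T) (k - card T). T \<union> R \<in> edges (bicoloured_host k J V X)}
    = {R \<in> nsets (A \<union> B) r. a + card (R \<inter> A) \<in> J}"
  proof (rule Collect_cong)
    fix R
    show "(R \<in> nsets (verts (bicoloured_host k J V X) - T) (k - card T) \<and> T \<union> R \<in> edges (bicoloured_host k J V X))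
      \<longleftrightarrow> (R \<in> nsets (A \<union> B) r \<and> a + card (R \<inter> A) \<in> J)"
    proof (cases "R \<in> nsets (A \<union> B) r")
      case True
      then have R: "R \<subseteq> V - T" "finite R" "card R = r" by (auto simp: nsets_def AB(4))
      have "card (T \<union> R) = card T + card R" using R T' by (intro card_Un_disjoint) auto
      then have "T \<union> R \<in> nsets V k" using R T' l by (auto simp: nsets_def r_def)
      moreover have "card ((T \<union> R) \<inter> X) = a + card (R \<inter> A)"
      proof -
        have "(T \<union> R) \<inter> X = (T \<inter> X) \<union> (R \<inter> A)" using R(1) by (auto simp: A_def)
        then have "card ((T \<union> R) \<inter> X) = card ((T \<inter> X) \<union> (R \<inter> A))" by (simp only:)
        also have "\<dots> = card (T \<inter> X) + card (R \<inter> A)"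
          using R T' by (intro card_Un_disjoint) (auto simp: A_def)
        finally show ?thesis by (simp only: a_def)
      qed
      ultimately show ?thesis using True by (simp add: bicoloured_host_def AB(4) T'(3) r_def)
    next
      case False
      then show ?thesis by (simp add: bicoloured_host_def AB(4) T'(3) r_def)
    qed
  qed
  then have "degree k (bicoloured_host k J V X) T = card {R \<in> nsets (A \<union> B) r. a + card (R \<inter> A) \<in> J}"
    by (simp only: degree_def)
  also have "{R \<in> nsets (A \<union> B) r. a + card (R \<inter> A) \<in> J}
    = (\<Union>b\<in>{..r}. {R \<in> nsets (A \<union> B) r. card (R \<inter> A) = b \<and> a + b \<in> J})" (is "?l = ?r")
  proof
    show "?l \<subseteq> ?r"
    proof
      fix R assume R: "R \<in> ?l"
      then have "finite R" "card R = r" by (auto simp: nsets_def)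
      then have "card (R \<inter> A) \<le> r" using card_mono[of R "R \<inter> A"] by simp
      then show "R \<in> ?r" using R by simp
    qed
  qed auto
  also have "card ?r = (\<Sum>b\<le>r. card {R \<in> nsets (A \<union> B) r. card (R \<inter> A) = b \<and> a + b \<in> J})"
    using AB by (intro card_UN_disjoint) (auto simp: finite_imp_finite_nsets)
  also have "\<dots> = (\<Sum>b\<le>r. if a + b \<in> J then (card A choose b) * (card B choose (r - b)) else 0)"
  proof (rule sum.cong[OF refl])
    fix b assume "b \<in> {..r}"
    then have "b \<le> r" by simp
    then show "card {R \<in> nsets (A \<union> B) r. card (R \<inter> A) = b \<and> a + b \<in> J}
      = (if a + b \<in> J then (card A choose b) * (card B choose (r - b)) else 0)"
      using card_nsets_meeting_in[OF AB(1-3)] by auto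
  qed
  finally show ?thesis unfolding cAB r_def .
qed

definition red_count :: "real \<Rightarrow> nat \<Rightarrow> nat" where
  "red_count p n = nat \<lfloor>p * real n\<rfloor>"

lemma red_count_le: "0 < p \<Longrightarrow> p < 1 \<Longrightarrow> red_count p n \<le> n"
proof -
  assume p: "0 < p" "p < 1"
  have "p * real n \<le> real n" using p by (simp add: mult_left_le_one_le)
  then have "\<lfloor>p * real n\<rfloor> \<le> int n" by linarith
  then show ?thesis by (simp add: red_count_def)
qed

lemma red_count_ratio:
  assumes "0 < p"
  shows "(\<lambda>n. real (red_count p n) / real n) \<longlonglongrightarrow> p"
proof (rule tendsto_sandwich[of "\<lambda>n. p - 1 / real n" _ _ "\<lambda>_. p"])
  have b: "p * real n - 1 \<le> real (red_count p n)" "real (red_count p n) \<le> p * real n" for n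
  proof -
    have "0 \<le> p * real n" using assms by simp
    then have "real (red_count p n) = of_int \<lfloor>p * real n\<rfloor>" by (simp add: red_count_def)
    then show "p * real n - 1 \<le> real (red_count p n)" "real (red_count p n) \<le> p * real n"
      by linarith+
  qed
  show "\<forall>\<^sub>F n in sequentially. p - 1 / real n \<le> real (red_count p n) / real n"
    using eventually_gt_at_top[of 0]
  proof eventually_elim
    case (elim n)
    have "(p * real n - 1) / real n \<le> real (red_count p n) / real n"
      using b(1) by (rule divide_right_mono) simp
    then show ?case using elim by (simp add: diff_divide_distrib)
  qed
  show "\<forall>\<^sub>F n in sequentially. real (red_count p n) / real n \<le> p"
    using eventually_gt_at_top[of 0] by eventually_elim (use b(2) in \<open>simp add: field_simps\<close>)
  have "(\<lambda>n. p - 1 / real n) \<longlonglongrightarrow> p - 0" by (intro tendsto_intros lim_1_over_n)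
  then show "(\<lambda>n. p - 1 / real n) \<longlonglongrightarrow> p" by simp
qed simp

lemma binomial_of_proportional_size:
  fixes x :: "nat \<Rightarrow> nat"
  assumes c: "0 < c" and x: "(\<lambda>n. real (x n) / real n) \<longlonglongrightarrow> c"
  shows "(\<lambda>n. real ((x n - a) choose b) * fact b / real n ^ b) \<longlonglongrightarrow> c ^ b"
proof -
  have xr: "filterlim (\<lambda>n. real (x n)) at_top sequentially"
  proof (rule filterlim_cong[THEN iffD1, OF refl refl])
    show "filterlim (\<lambda>n. real (x n) / real n * real n) at_top sequentially"
      by (rule filterlim_tendsto_pos_mult_at_top[OF x c filterlim_real_sequentially])
    show "\<forall>\<^sub>F n in sequentially. real (x n) / real n * real n = real (x n)"
      using eventually_gt_at_top[of 0] by eventually_elim simp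
  qed
  then have xn: "filterlim x sequentially sequentially"
    by (simp add: filterlim_sequentially_iff_filterlim_real)
  have "(\<lambda>n. real ((x n - a) choose b) * fact b / real (x n) ^ b) \<longlonglongrightarrow> 1"
    by (rule filterlim_compose[OF falling_binomial_ratio xn])
  from tendsto_mult[OF this tendsto_power[OF x, of b]]
  have "(\<lambda>n. real ((x n - a) choose b) * fact b / real (x n) ^ b * (real (x n) / real n) ^ b) \<longlonglongrightarrow> c ^ b"
    by simp
  then show ?thesis
  proof (rule Lim_transform_eventually)
    have "\<forall>\<^sub>F n in sequentially. 1 \<le> x n" using xn by (simp add: filterlim_at_top)
    then show "\<forall>\<^sub>F n in sequentially. real ((x n - a) choose b) * fact b / real (x n) ^ b * (real (x n) / real n) ^ b
      = real ((x n - a) choose b) * fact b / real n ^ b"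
      by eventually_elim (simp add: power_divide)
  qed
qed

text \<open>The hypergeometric distribution converges to the binomial distribution.\<close>

lemma bicoloured_degree_ratio:
  assumes p: "0 < p" "p < 1"
  shows "(\<lambda>n. (\<Sum>b\<le>r. if a + b \<in> J then real ((red_count p n - a) choose b)
        * real ((n - red_count p n - a') choose (r - b)) else 0) / real ((n - l) choose r))
     \<longlonglongrightarrow> binomial_weight r p J a"
proof -
  have y: "(\<lambda>n. real (n - red_count p n) / real n) \<longlonglongrightarrow> 1 - p"
  proof (rule Lim_transform_eventually)
    show "(\<lambda>n. 1 - real (red_count p n) / real n) \<longlonglongrightarrow> 1 - p"
      by (intro tendsto_intros red_count_ratio p)
    show "\<forall>\<^sub>F n in sequentially. 1 - real (red_count p n) / real n = real (n - red_count p n) / real n"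
      using eventually_gt_at_top[of 0]
    proof eventually_elim
      case (elim n)
      then show ?case using red_count_le[OF p, of n] by (simp add: of_nat_diff diff_divide_distrib)
    qed
  qed
  have cancel: "c * (A * f / X * (B * g / Y) / (D * (c * (f * g)) / (X * Y))) = A * B / D"
    if "c \<noteq> 0" "f \<noteq> 0" "g \<noteq> 0" "X \<noteq> 0" "Y \<noteq> 0" for c f g X Y A B D :: real
    using that by (cases "D = 0") (simp_all add: divide_simps)
  have summand: "(\<lambda>n. real ((red_count p n - a) choose b) * real ((n - red_count p n - a') choose (r - b))
      / real ((n - l) choose r)) \<longlonglongrightarrow> real (r choose b) * p ^ b * (1 - p) ^ (r - b)" if b: "b \<le> r" for b
  proof -
    let ?U = "\<lambda>n. real ((red_count p n - a) choose b) * fact b / real n ^ b"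
    let ?W = "\<lambda>n. real ((n - red_count p n - a') choose (r - b)) * fact (r - b) / real n ^ (r - b)"
    let ?Z = "\<lambda>n. real ((n - l) choose r) * fact r / real n ^ r"
    have "(\<lambda>n. ?U n * ?W n / ?Z n) \<longlonglongrightarrow> p ^ b * (1 - p) ^ (r - b) / 1"
      using p by (intro tendsto_divide tendsto_mult binomial_of_proportional_size red_count_ratio y falling_binomial_ratio) auto
    from tendsto_mult_left[OF this, of "real (r choose b)"]
    have "(\<lambda>n. real (r choose b) * (?U n * ?W n / ?Z n)) \<longlonglongrightarrow> real (r choose b) * p ^ b * (1 - p) ^ (r - b)"
      by (simp add: mult.assoc)
    then show ?thesis
    proof (rule Lim_transform_eventually)
      show "\<forall>\<^sub>F n in sequentially. real (r choose b) * (?U n * ?W n / ?Z n)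
        = real ((red_count p n - a) choose b) * real ((n - red_count p n - a') choose (r - b)) / real ((n - l) choose r)"
        using eventually_gt_at_top[of 0]
      proof eventually_elim
        case (elim n)
        have n: "real n ^ r = real n ^ b * real n ^ (r - b)" using b by (simp add: power_add[symmetric])
        have "real (r choose b) = fact r / (fact b * fact (r - b))" by (rule binomial_fact[OF b])
        then have F: "(fact r :: real) = real (r choose b) * (fact b * fact (r - b))" by simp
        have "real n ^ b \<noteq> 0" "real n ^ (r - b) \<noteq> 0" "real (r choose b) \<noteq> 0" using elim b by simp_all
        then show ?case unfolding n F by (intro cancel) simp_all
      qed
    qed
  qed
  have "(\<lambda>n. \<Sum>b\<le>r. if a + b \<in> J then real ((red_count p n - a) choose b)
        * real ((n - red_count p n - a') choose (r - b)) / real ((n - l) choose r) else 0)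
     \<longlonglongrightarrow> binomial_weight r p J a"
    unfolding binomial_weight_def
  proof (rule tendsto_sum)
    fix b assume "b \<in> {..r}"
    then show "(\<lambda>n. if a + b \<in> J then real ((red_count p n - a) choose b)
        * real ((n - red_count p n - a') choose (r - b)) / real ((n - l) choose r) else 0)
      \<longlonglongrightarrow> (if a + b \<in> J then real (r choose b) * p ^ b * (1 - p) ^ (r - b) else 0)"
      using summand[of b] by simp
  qed
  moreover have "(\<Sum>b\<le>r. if a + b \<in> J then real ((red_count p n - a) choose b)
        * real ((n - red_count p n - a') choose (r - b)) else 0) / real ((n - l) choose r)
    = (\<Sum>b\<le>r. if a + b \<in> J then real ((red_count p n - a) choose b)
        * real ((n - red_count p n - a') choose (r - b)) / real ((n - l) choose r) else 0)" for n
    unfolding sum_divide_distrib by (intro sum.cong refl) (rule if_distrib[THEN trans], simp)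
  ultimately show ?thesis by (simp only:)
qed

lemma eventually_bicoloured_degree:
  assumes l: "l \<le> k" and p: "0 < p" "p < 1" and w: "\<forall>a\<le>l. 1 / 2 \<le> binomial_weight (k - l) p J a"
    and e: "0 < \<epsilon>"
  shows "\<forall>\<^sub>F n in sequentially. \<forall>(V :: 'a set) X T. finite V \<longrightarrow> card V = n \<longrightarrow> X \<subseteq> V \<longrightarrow>
    card X = red_count p n \<longrightarrow> T \<in> nsets V l \<longrightarrow>
    (1 / 2 - \<epsilon>) * real ((n - l) choose (k - l)) \<le> real (degree k (bicoloured_host k J V X) T)"
proof -
  define f where "f a n = (\<Sum>b\<le>k - l. if a + b \<in> J then real ((red_count p n - a) choose b)
        * real ((n - red_count p n - (l - a)) choose (k - l - b)) else 0)" for a n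
  have "\<forall>\<^sub>F n in sequentially. \<forall>a\<in>{..l}. 1 / 2 - \<epsilon> < f a n / real ((n - l) choose (k - l))"
  proof (rule eventually_ball_finite)
    show "\<forall>a\<in>{..l}. \<forall>\<^sub>F n in sequentially. 1 / 2 - \<epsilon> < f a n / real ((n - l) choose (k - l))"
    proof
      fix a assume "a \<in> {..l}"
      then have "1 / 2 - \<epsilon> < binomial_weight (k - l) p J a" using w e by fastforce
      then show "\<forall>\<^sub>F n in sequentially. 1 / 2 - \<epsilon> < f a n / real ((n - l) choose (k - l))"
        unfolding f_def by (rule order_tendstoD(1)[OF bicoloured_degree_ratio[OF p]])
    qed
  qed simp
  then show ?thesis
    using eventually_ge_at_top[of k]
  proof eventually_elim
    case (elim n)
    show ?case
    proof (intro allI impI)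
      fix V X T :: "'a set"
      assume V: "finite V" "card V = n" and X: "X \<subseteq> V" "card X = red_count p n" and T: "T \<in> nsets V l"
      define a where "a = card (T \<inter> X)"
      have "finite T" "card T = l" using T by (auto simp: nsets_def)
      then have "a \<le> l" unfolding a_def using card_mono[of T "T \<inter> X"] by simp
      moreover have "real (degree k (bicoloured_host k J V X) T) = f a n"
        unfolding degree_bicoloured_host[OF V(1) X(1) T l] f_def a_def[symmetric] V(2) X(2)
        by (simp only: of_nat_sum if_distrib[of real] of_nat_mult of_nat_0)
      moreover have "real ((n - l) choose (k - l)) > 0" using elim(2) by simp
      ultimately show "(1 / 2 - \<epsilon>) * real ((n - l) choose (k - l)) \<le> real (degree k (bicoloured_host k J V X) T)"
        using elim(1) by (simp add: pos_less_divide_eq less_imp_le)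
    qed
  qed
qed

section \<open>Hashed hosts\<close>

text \<open>The hash function of \<open>v\<close>: multiplication by \<open>v\<close> modulo the prime \<open>p\<close>, followed by cutting the residues
  into \<open>m\<close> intervals.\<close>

definition bucket :: "nat \<Rightarrow> nat \<Rightarrow> nat \<Rightarrow> nat \<Rightarrow> nat" where
  "bucket m p v u = m * (u * v mod p) div p"

lemma bucket_less:
  assumes "0 < m" "0 < p" shows "bucket m p v u < m"
proof -
  have "m * (u * v mod p) < m * p" using assms by simp
  then show ?thesis unfolding bucket_def using assms by (simp add: less_mult_imp_div_less)
qed

text \<open>The residues modulo \<open>p\<close> whose distance to \<open>0\<close> is below \<open>p / m\<close>.\<close>

definition near_zero :: "nat \<Rightarrow> nat \<Rightarrow> int set" where
  "near_zero m p = {d. 0 \<le> d \<and> d < int p \<and> (d * int m < int p \<or> (int p - d) * int m < int p)}"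

lemma card_near_zero_le:
  assumes "0 < m"
  shows "finite (near_zero m p)" "card (near_zero m p) \<le> 2 * (p div m + 1)"
proof -
  define D where "D = {0..int (p div m)}"
  have small: "e \<in> D" if e: "0 \<le> e" "e * int m < int p" for e
  proof -
    obtain e' where e': "e = int e'" using e(1) by (rule nonneg_int_cases)
    have "int (e' * m) < int p" using e(2) by (simp add: e')
    then have "e' * m \<le> p" by (simp only: of_nat_less_iff less_imp_le)
    then have "e' \<le> p div m" using assms by (simp add: less_eq_div_iff_mult_less_eq)
    then show ?thesis by (simp add: D_def e')
  qed
  have sub: "near_zero m p \<subseteq> D \<union> (\<lambda>e. int p - e) ` D"
  proof
    fix d assume d: "d \<in> near_zero m p"
    then consider "0 \<le> d" "d * int m < int p" | "0 \<le> int p - d" "(int p - d) * int m < int p"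
      by (auto simp: near_zero_def)
    then show "d \<in> D \<union> (\<lambda>e. int p - e) ` D"
    proof cases
      case 1
      then show ?thesis using small by blast
    next
      case 2
      then have "int p - d \<in> D" by (rule small)
      then have "int p - (int p - d) \<in> (\<lambda>e. int p - e) ` D" by (rule imageI)
      then show ?thesis by simp
    qed
  qed
  have finD: "finite D" "card D = p div m + 1" by (simp_all add: D_def)
  then show "finite (near_zero m p)" using sub by (meson finite_UnI finite_imageI finite_subset)
  have "card (near_zero m p) \<le> card (D \<union> (\<lambda>e. int p - e) ` D)"
    using finD sub by (intro card_mono) auto
  also have "\<dots> \<le> card D + card ((\<lambda>e. int p - e) ` D)" by (rule card_Un_le)
  also have "\<dots> \<le> card D + card D" using card_image_le[OF finD(1)] by simp
  finally show "card (near_zero m p) \<le> 2 * (p div m + 1)" using finD by simp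
qed

lemma near_zero_of_equal_buckets:
  assumes ab: "a < p" "b < p" and eq: "m * a div p = m * b div p"
  shows "(int a - int b) mod int p \<in> near_zero m p"
proof -
  have close: "(c - d) * m < p" if "m * c div p = m * d div p" "d \<le> c" "c < p" for c d :: nat
  proof -
    have "m * c = p * (m * c div p) + m * c mod p" by (rule mult_div_mod_eq[symmetric])
    moreover have "m * d = p * (m * c div p) + m * d mod p"
      unfolding that(1) by (rule mult_div_mod_eq[symmetric])
    moreover have "m * c mod p < p" using that by simp
    ultimately have "m * c < m * d + p" by linarith
    then have "c * m < d * m + p" by (simp only: mult.commute)
    then show ?thesis unfolding diff_mult_distrib using mult_le_mono1[OF that(2), of m] by linarith
  qed
  show ?thesis
  proof (cases "b \<le> a")
    case True
    have "int ((a - b) * m) < int p" using close[OF eq True ab(1)] by (simp only: of_nat_less_iff)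
    then have "(int a - int b) * int m < int p" using True by (simp add: of_nat_diff)
    moreover have "(int a - int b) mod int p = int a - int b" using True ab by simp
    ultimately show ?thesis using True ab by (simp add: near_zero_def)
  next
    case False
    then have ba: "a \<le> b" by simp
    have "int ((b - a) * m) < int p" using close[OF eq[symmetric] ba ab(2)] by (simp only: of_nat_less_iff)
    then have "(int b - int a) * int m < int p" using ba by (simp add: of_nat_diff)
    moreover have "int p - (int a - int b + int p) = int b - int a" by simp
    ultimately have "(int p - (int a - int b + int p)) * int m < int p" by (simp only:)
    then have "int a - int b + int p \<in> near_zero m p" using False ab unfolding near_zero_def by simp
    moreover have "(int a - int b) mod int p = int a - int b + int p"
    proof -
      have "(int a - int b) mod int p = (int a - int b + int p) mod int p" by simp
      also have "\<dots> = int a - int b + int p" using False ab by (intro mod_pos_pos_trivial) auto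
      finally show ?thesis .
    qed
    ultimately show ?thesis by (simp only:)
  qed
qed

text \<open>Multiplication by a unit modulo \<open>p\<close> is injective.\<close>

lemma card_multiples_near_zero_le:
  assumes p: "prime p" and m: "0 < m" and X: "X \<subseteq> {1..<p}" and c: "\<not> int p dvd c"
    and near: "\<And>x. x \<in> X \<Longrightarrow> ((int x - s) * c) mod int p \<in> near_zero m p"
  shows "card X \<le> 2 * (p div m + 1)"
proof -
  have "inj_on (\<lambda>x. ((int x - s) * c) mod int p) X"
  proof (rule inj_onI)
    fix x x' assume x: "x \<in> X" "x' \<in> X"
      and eq: "((int x - s) * c) mod int p = ((int x' - s) * c) mod int p"
    have "int p dvd (int x - s) * c - (int x' - s) * c" using eq by (simp add: mod_eq_dvd_iff)
    then have "int p dvd (int x - int x') * c" by (simp add: algebra_simps)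
    then have "int p dvd int x - int x'" using p c by (simp add: prime_dvd_mult_iff)
    moreover have "\<bar>int x - int x'\<bar> < int p" using x X by (auto simp: abs_less_iff)
    ultimately have "int x - int x' = 0" using zdvd_not_zless[of "\<bar>int x - int x'\<bar>" "int p"] by auto
    then show "x = x'" by simp
  qed
  then have "card X \<le> card (near_zero m p)"
    using near card_near_zero_le(1)[OF m] by (intro card_inj_on_le) auto
  then show ?thesis using card_near_zero_le(2)[OF m, of p] by linarith
qed

lemma equal_buckets_product:
  assumes p: "0 < p" and eq: "bucket m p v u = bucket m p v' u'"
  shows "(int u * int v - int u' * int v') mod int p \<in> near_zero m p"
proof -
  have "(int (u * v mod p) - int (u' * v' mod p)) mod int p \<in> near_zero m p"
    using p eq by (intro near_zero_of_equal_buckets) (simp_all add: bucket_def)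
  moreover have "(int (u * v mod p) - int (u' * v' mod p)) mod int p = (int u * int v - int u' * int v') mod int p"
    by (simp add: zmod_int mod_diff_eq)
  ultimately show ?thesis by simp
qed

text \<open>The vertices \<open>x\<close> that produce a collision with \<open>y\<close> and \<open>z\<close>, either because \<open>x\<close> does not separate \<open>y\<close>
  from \<open>z\<close>, or because \<open>y\<close> does not separate \<open>x\<close> from \<open>z\<close>.\<close>

definition clash :: "nat \<Rightarrow> nat \<Rightarrow> nat \<Rightarrow> nat \<Rightarrow> nat set" where
  "clash m p y z = {x \<in> {1..<p}. bucket m p x y = bucket m p x z} \<union>
     {x \<in> {1..<p}. x \<noteq> z \<and> bucket m p y x = bucket m p y z}"

text \<open>The bucket condition compares \<open>x * y\<close> with \<open>x * z\<close>, or \<open>x * y\<close> with \<open>z * y\<close>. In either case the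
  product of \<open>x\<close>, possibly shifted, with a fixed unit modulo \<open>p\<close> has to be near \<open>0\<close>.\<close>

lemma card_clash_le:
  assumes p: "prime p" and m: "0 < m" and y: "y \<in> {1..<p}" and z: "z \<in> {1..<p}" and "y \<noteq> z"
  shows "card (clash m p y z) \<le> 4 * (p div m + 1)"
proof -
  have p0: "0 < p" using p by (simp add: prime_gt_0_nat)
  have "card {x \<in> {1..<p}. bucket m p x y = bucket m p x z} \<le> 2 * (p div m + 1)"
  proof (rule card_multiples_near_zero_le[OF p m, where c = "int y - int z" and s = 0])
    have "\<bar>int y - int z\<bar> < int p" "int y - int z \<noteq> 0" using y z assms(5) by auto
    then show "\<not> int p dvd int y - int z" using zdvd_not_zless[of "\<bar>int y - int z\<bar>" "int p"] by auto
    show "((int x - 0) * (int y - int z)) mod int p \<in> near_zero m p"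
      if "x \<in> {x \<in> {1..<p}. bucket m p x y = bucket m p x z}" for x
    proof -
      have "(int y * int x - int z * int x) mod int p \<in> near_zero m p"
        using that by (intro equal_buckets_product[OF p0]) simp
      then show ?thesis by (simp add: algebra_simps)
    qed
  qed auto
  moreover have "card {x \<in> {1..<p}. x \<noteq> z \<and> bucket m p y x = bucket m p y z} \<le> 2 * (p div m + 1)"
  proof (rule card_multiples_near_zero_le[OF p m, where c = "int y" and s = "int z"])
    show "\<not> int p dvd int y" using y by (auto dest: zdvd_imp_le)
    show "((int x - int z) * int y) mod int p \<in> near_zero m p"
      if "x \<in> {x \<in> {1..<p}. x \<noteq> z \<and> bucket m p y x = bucket m p y z}" for x
    proof -
      have "(int x * int y - int z * int y) mod int p \<in> near_zero m p"
        using that by (intro equal_buckets_product[OF p0]) simp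
      then show ?thesis by (simp add: algebra_simps)
    qed
  qed auto
  moreover have "card (clash m p y z) \<le> card {x \<in> {1..<p}. bucket m p x y = bucket m p x z}
    + card {x \<in> {1..<p}. x \<noteq> z \<and> bucket m p y x = bucket m p y z}"
    unfolding clash_def by (rule card_Un_le)
  ultimately show ?thesis by simp
qed

text \<open>The condition involves \<open>l + 1\<close> vertices, hence always one outside of a given \<open>l\<close>-set. A condition on
  \<open>l\<close> vertices could destroy the whole link of an \<open>l\<close>-set.\<close>

definition hash_bad :: "nat \<Rightarrow> nat \<Rightarrow> nat \<Rightarrow> nat set \<Rightarrow> bool" where
  "hash_bad l m p e \<longleftrightarrow>
     (\<exists>v\<in>e. \<exists>S\<in>nsets (e - {v}) l. \<forall>u\<in>S. \<forall>u'\<in>S. bucket m p v u = bucket m p v u')"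

text \<open>A vertex \<open>v\<close> in the apex set of the cone has \<open>l\<close> vertices of the clique in one of its \<open>m\<close> buckets.\<close>

lemma clique_cone_free_of_hash:
  assumes r: "0 < r" and l: "0 < l" and m: "0 < m" "0 < p"
    and good: "\<And>e. e \<in> edges H \<Longrightarrow> \<not> hash_bad l m p e"
  shows "\<not> contains_copy H (clique_cone r l (m * (l - 1) + 1))"
proof
  define q where "q = m * (l - 1) + 1"
  assume "contains_copy H (clique_cone r l (m * (l - 1) + 1))"
  then obtain f where f: "inj_on f {..<r + q}"
    and E: "\<And>S. S \<in> nsets {r..<r + q} l \<Longrightarrow> f ` ({..<r} \<union> S) \<in> edges H"
    unfolding contains_copy_def clique_cone_def q_def by auto
  define v where "v = f 0"
  define C where "C c = {u \<in> {r..<r + q}. bucket m p v (f u) = c}" for c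
  have "\<exists>c<m. l \<le> card (C c)"
  proof (rule ccontr)
    assume "\<not> ?thesis"
    then have le: "card (C c) \<le> l - 1" if "c < m" for c using that by fastforce
    have "{r..<r + q} = (\<Union>c\<in>{..<m}. C c)" using bucket_less[OF m] by (auto simp: C_def)
    then have "q = card (\<Union>c\<in>{..<m}. C c)" by (metis card_atLeastLessThan add_diff_cancel_left')
    also have "\<dots> \<le> (\<Sum>c<m. card (C c))" by (rule card_UN_le) simp
    also have "\<dots> \<le> (\<Sum>c<m. l - 1)" using le by (intro sum_mono) simp
    finally show False by (simp add: q_def)
  qed
  then obtain c where c: "l \<le> card (C c)" by blast
  then obtain S where S: "S \<subseteq> C c" "card S = l" "finite S" by (rule obtain_subset_with_card_n)
  have SQ: "S \<subseteq> {r..<r + q}" using S(1) by (auto simp: C_def)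
  then have "S \<in> nsets {r..<r + q} l" using S by (simp add: nsets_def)
  then have "f ` ({..<r} \<union> S) \<in> edges H" by (rule E)
  moreover have "hash_bad l m p (f ` ({..<r} \<union> S))"
    unfolding hash_bad_def
  proof (intro bexI ballI)
    show "v \<in> f ` ({..<r} \<union> S)" using r by (auto simp: v_def)
    have "inj_on f S" using SQ by (intro inj_on_subset[OF f]) auto
    moreover have "v \<notin> f ` S"
    proof
      assume "v \<in> f ` S"
      then obtain u where u: "u \<in> S" "f 0 = f u" by (auto simp: v_def)
      then have "u \<in> {r..<r + q}" using SQ by blast
      then have "0 = u" using r by (intro inj_onD[OF f u(2)]) auto
      then show False using \<open>u \<in> {r..<r + q}\<close> r by simp
    qed
    ultimately show "f ` S \<in> nsets (f ` ({..<r} \<union> S) - {v}) l"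
      using S by (auto simp: nsets_def card_image)
    fix x x' assume "x \<in> f ` S" "x' \<in> f ` S"
    then show "bucket m p v x = bucket m p v x'" using S(1) by (auto simp: C_def)
  qed
  ultimately show False using good by blast
qed

text \<open>A bad set contains a vertex of \<open>R\<close> that clashes with two other vertices of \<open>T \<union> R\<close>. So \<open>R\<close> arises from an
  \<open>(r - 1)\<close>-set by adding a vertex from one of at most \<open>(k - 1)\<^sup>2\<close> small sets.\<close>

lemma card_hash_bad_le:
  assumes p: "prime p" and m: "0 < m" and l: "1 < l" "l < k" and T: "T \<in> nsets {1..<p} l"
  shows "card {R \<in> nsets ({1..<p} - T) (k - l). hash_bad l m p (T \<union> R)}
    \<le> ((p - 1 - l) choose (k - l - 1)) * ((k - 1)\<^sup>2 * (4 * (p div m + 1)))"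
proof -
  define V where "V = {1..<p}"
  define r where "r = k - l"
  have T': "T \<subseteq> V" "finite T" "card T = l" using T by (auto simp: nsets_def V_def)
  define D where "D R' = {yz \<in> (T \<union> R') \<times> (T \<union> R'). fst yz \<noteq> snd yz}" for R'
  define G where "G R' = (\<Union>yz\<in>D R'. (\<lambda>x. insert x R') ` clash m p (fst yz) (snd yz))" for R'
  define B where "B = {R \<in> nsets (V - T) r. hash_bad l m p (T \<union> R)}"
  have finclash: "finite (clash m p y z)" for y z by (simp add: clash_def)
  have finW: "finite (nsets (V - T) (r - 1))" by (simp add: V_def finite_imp_finite_nsets)
  have clashI: "R \<in> (\<Union>R'\<in>nsets (V - T) (r - 1). G R')"
    if R: "R \<in> nsets (V - T) r" and x: "x \<in> R" "x \<in> clash m p y z"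
      and yz: "y \<in> T \<union> (R - {x})" "z \<in> T \<union> (R - {x})" "y \<noteq> z" for R x y z
  proof -
    have R': "R \<subseteq> V - T" "finite R" "card R = r" using R by (auto simp: nsets_def)
    then have "R - {x} \<in> nsets (V - T) (r - 1)" using x(1) by (auto simp: nsets_def)
    moreover have "R \<in> G (R - {x})"
    proof -
      have "(y, z) \<in> D (R - {x})" using yz by (simp add: D_def)
      moreover have "R = insert x (R - {x})" using x(1) by blast
      then have "R \<in> (\<lambda>x'. insert x' (R - {x})) ` clash m p (fst (y, z)) (snd (y, z))"
        using x(2) by (intro image_eqI[of _ _ x]) simp_all
      ultimately show ?thesis unfolding G_def by blast
    qed
    ultimately show ?thesis by blast
  qed
  have "B \<subseteq> (\<Union>R'\<in>nsets (V - T) (r - 1). G R')"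
  proof
    fix R assume "R \<in> B"
    then have R: "R \<in> nsets (V - T) r" and "hash_bad l m p (T \<union> R)" by (simp_all add: B_def)
    then obtain v S where v: "v \<in> T \<union> R" and S: "S \<in> nsets (T \<union> R - {v}) l"
      and eq: "\<And>u u'. u \<in> S \<Longrightarrow> u' \<in> S \<Longrightarrow> bucket m p v u = bucket m p v u'"
      unfolding hash_bad_def by blast
    have S': "S \<subseteq> T \<union> R - {v}" "finite S" "card S = l" using S by (auto simp: nsets_def)
    have RV: "R \<subseteq> V" "R \<inter> T = {}" using R by (auto simp: nsets_def)
    have other: "\<exists>u'\<in>S. u' \<noteq> u" for u
    proof (rule ccontr)
      assume "\<not> ?thesis"
      then have "S \<subseteq> {u}" by blast
      then have "card S \<le> card {u}" by (intro card_mono) simp_all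
      then show False using S'(3) l by simp
    qed
    \<comment> \<open>In both cases the vertex of \<open>R\<close> that is counted last is determined up to a clash: it is \<open>v\<close>
      itself, or an element of \<open>S\<close>, which has \<open>l\<close> elements and therefore does not fit into
      \<open>T - {v}\<close>.\<close>
    show "R \<in> (\<Union>R'\<in>nsets (V - T) (r - 1). G R')"
    proof (cases "v \<in> R")
      case True
      obtain u where u: "u \<in> S" using other by blast
      obtain u' where u': "u' \<in> S" "u' \<noteq> u" using other by blast
      have "v \<in> clash m p u u'" using True RV(1) eq[OF u u'(1)] by (auto simp: clash_def V_def)
      moreover have "u \<in> T \<union> (R - {v})" "u' \<in> T \<union> (R - {v})" using u u'(1) S'(1) by blast+
      ultimately show ?thesis using clashI[OF R True] u'(2) by blast
    next
      case False
      then have vT: "v \<in> T" using v by blast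
      have "\<not> S \<subseteq> T"
      proof
        assume "S \<subseteq> T"
        then have "S \<subseteq> T - {v}" using S'(1) by blast
        then have "card S \<le> card (T - {v})" using T'(2) by (intro card_mono) simp_all
        then show False using vT T' S'(3) l by simp
      qed
      then obtain u where u: "u \<in> S" "u \<in> R" using S'(1) by blast
      obtain u' where u': "u' \<in> S" "u' \<noteq> u" using other by blast
      have "u \<in> clash m p v u'" using u RV(1) eq[OF u(1) u'(1)] u'(2) by (auto simp: clash_def V_def)
      moreover have "v \<in> T \<union> (R - {u})" "u' \<in> T \<union> (R - {u})" "v \<noteq> u'"
        using vT u' S'(1) by blast+
      ultimately show ?thesis using clashI[OF R u(2)] by blast
    qed
  qed
  moreover have fG: "finite (G R')" if "R' \<in> nsets (V - T) (r - 1)" for R'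
  proof -
    have "finite R'" using that by (simp add: nsets_def)
    then have "finite (D R')" using T'(2) by (simp add: D_def)
    then show ?thesis unfolding G_def using finclash by simp
  qed
  ultimately have "card B \<le> card (\<Union>R'\<in>nsets (V - T) (r - 1). G R')"
    using finW by (intro card_mono) simp_all
  also have "\<dots> \<le> (\<Sum>R'\<in>nsets (V - T) (r - 1). card (G R'))" by (rule card_UN_le[OF finW])
  also have "\<dots> \<le> (\<Sum>R'\<in>nsets (V - T) (r - 1). (k - 1)\<^sup>2 * (4 * (p div m + 1)))"
  proof (rule sum_mono)
    fix R' assume "R' \<in> nsets (V - T) (r - 1)"
    then have R': "R' \<subseteq> V - T" "finite R'" "card R' = r - 1" by (auto simp: nsets_def)
    have "card (T \<union> R') = card T + card R'" using R' T' by (intro card_Un_disjoint) auto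
    then have W: "finite (T \<union> R')" "card (T \<union> R') = k - 1" using R' T' l by (simp_all add: r_def)
    have D: "finite (D R')" "card (D R') \<le> (k - 1)\<^sup>2"
    proof -
      have sub: "D R' \<subseteq> (T \<union> R') \<times> (T \<union> R')" unfolding D_def by blast
      have fin: "finite ((T \<union> R') \<times> (T \<union> R'))" using W(1) by (intro finite_cartesian_product)
      show "finite (D R')" using sub fin by (rule finite_subset)
      have "card (D R') \<le> card ((T \<union> R') \<times> (T \<union> R'))" using fin sub by (rule card_mono)
      also have "\<dots> = (k - 1)\<^sup>2" by (simp only: card_cartesian_product W(2) power2_eq_square)
      finally show "card (D R') \<le> (k - 1)\<^sup>2" .
    qed
    have "card (G R') \<le> (\<Sum>yz\<in>D R'. card ((\<lambda>x. insert x R') ` clash m p (fst yz) (snd yz)))"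
      unfolding G_def by (rule card_UN_le[OF D(1)])
    also have "\<dots> \<le> (\<Sum>yz\<in>D R'. 4 * (p div m + 1))"
    proof (rule sum_mono)
      fix yz assume "yz \<in> D R'"
      then have "fst yz \<in> V" "snd yz \<in> V" "fst yz \<noteq> snd yz" using R'(1) T'(1) by (auto simp: D_def)
      then have "card (clash m p (fst yz) (snd yz)) \<le> 4 * (p div m + 1)"
        unfolding V_def by (rule card_clash_le[OF p m])
      then show "card ((\<lambda>x. insert x R') ` clash m p (fst yz) (snd yz)) \<le> 4 * (p div m + 1)"
        using card_image_le[OF finclash] by (rule order_trans[rotated])
    qed
    also have "\<dots> = card (D R') * (4 * (p div m + 1))" by simp
    also have "\<dots> \<le> (k - 1)\<^sup>2 * (4 * (p div m + 1))" using D(2) by (rule mult_le_mono1)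
    finally show "card (G R') \<le> (k - 1)\<^sup>2 * (4 * (p div m + 1))" .
  qed
  also have "\<dots> = (card (V - T) choose (r - 1)) * ((k - 1)\<^sup>2 * (4 * (p div m + 1)))" by simp
  also have "card (V - T) = p - 1 - l" using T' by (simp add: card_Diff_subset V_def)
  finally show ?thesis by (simp only: B_def V_def r_def)
qed

definition hash_filter :: "nat \<Rightarrow> nat \<Rightarrow> nat \<Rightarrow> nat hypergraph \<Rightarrow> nat hypergraph" where
  "hash_filter l m p H = (verts H, {e \<in> edges H. \<not> hash_bad l m p e})"

text \<open>The number \<open>m\<close> of buckets is chosen such that bad sets make up at most a quarter of all candidates
  for members of a link.\<close>

lemma degree_hash_filter_ge:
  assumes p: "prime p" and l: "1 < l" "l < k" and m: "m = 32 * ((k - l) * k\<^sup>2)"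
    and large: "34 * ((k - l) * k\<^sup>2) \<le> p"
    and V: "verts H = {1..<p}" and T: "T \<in> nsets {1..<p} l"
  shows "real (degree k H T) - real ((p - 1 - l) choose (k - l)) / 4 \<le> real (degree k (hash_filter l m p H) T)"
proof -
  define r where "r = k - l"
  define K where "K = r * k\<^sup>2"
  define A where "A = {R \<in> nsets ({1..<p} - T) r. T \<union> R \<in> edges H}"
  define B where "B = {R \<in> nsets ({1..<p} - T) r. hash_bad l m p (T \<union> R)}"
  have r: "0 < r" using l by (simp add: r_def)
  have k: "k = l + r" using l by (simp add: r_def)
  have K: "k \<le> K" "0 < K"
  proof -
    have "k * 1 \<le> k * k" using l by (intro mult_le_mono) auto
    also have "\<dots> \<le> r * (k * k)" using r by simp
    finally show "k \<le> K" by (simp add: K_def power2_eq_square)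
    then show "0 < K" using l by simp
  qed
  have m0: "0 < m" using K(2) by (simp add: m K_def r_def)
  have p34: "34 * K \<le> p" using large by (simp add: K_def r_def)
  have cT: "card T = l" using T by (simp add: nsets_def)
  have fin: "finite (nsets ({1..<p} - T) r)" by (simp add: finite_imp_finite_nsets)
  have dA: "degree k H T = card A" by (simp add: degree_def A_def V cT r_def)
  have dF: "degree k (hash_filter l m p H) T = card (A - B)"
  proof -
    have "{R \<in> nsets (verts (hash_filter l m p H) - T) (k - card T). T \<union> R \<in> edges (hash_filter l m p H)} = A - B"
      by (auto simp: hash_filter_def A_def B_def V cT r_def)
    then show ?thesis by (simp only: degree_def)
  qed
  have finB: "finite B" using fin by (simp add: B_def)
  have "card A - card B \<le> card (A - B)" by (rule diff_card_le_card_Diff[OF finB])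
  then have AB: "real (card A) - real (card B) \<le> real (card (A - B))" by linarith
  define W where "W = (k - 1)\<^sup>2 * (4 * (p div m + 1))"
  define c where "c = (p - 1 - l) choose (r - 1)"
  have cB: "card B \<le> c * W"
    unfolding B_def c_def W_def r_def by (rule card_hash_bad_le[OF p m0 l T])
  have kp: "k \<le> p" using K p34 by simp
  have absorb: "r * ((p - 1 - l) choose r) = (p - k) * c"
  proof -
    have "r * ((p - 1 - l) choose r) = (p - 1 - l) * ((p - 1 - l - 1) choose (r - 1))"
      by (rule times_binomial_minus1_eq[OF r])
    also have "\<dots> = (p - 1 - l - (r - 1)) * ((p - 1 - l) choose (r - 1))"
      by (rule binomial_absorb_comp[symmetric])
    also have "p - 1 - l - (r - 1) = p - k" using k r by simp
    finally show ?thesis by (simp only: c_def)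
  qed
  have "4 * (r * W) \<le> p - k"
  proof -
    have "r * (k - 1)\<^sup>2 \<le> K" unfolding K_def by (intro mult_le_mono power_mono) simp_all
    then have "(r * (k - 1)\<^sup>2) * (16 * (p div m + 1)) \<le> K * (16 * (p div m + 1))" by (rule mult_le_mono1)
    then have 1: "4 * (r * W) \<le> 16 * (K * (p div m)) + 16 * K" by (simp add: W_def algebra_simps)
    have "p div m * m \<le> p" by (rule div_times_less_eq_dividend)
    then have 2: "32 * (K * (p div m)) \<le> p" by (simp add: m K_def r_def algebra_simps)
    show ?thesis using 1 2 p34 K(1) by linarith
  qed
  then have "4 * (r * W) * c \<le> (p - k) * c" by (rule mult_le_mono1)
  then have "r * (4 * (c * W)) \<le> r * ((p - 1 - l) choose r)" unfolding absorb by (simp add: algebra_simps)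
  then have "4 * (c * W) \<le> (p - 1 - l) choose r" using r by simp
  then have "4 * card B \<le> (p - 1 - l) choose r" using cB by linarith
  then have "real (card B) \<le> real ((p - 1 - l) choose r) / 4" by linarith
  then show ?thesis using AB unfolding dA dF r_def[symmetric] by linarith
qed

section \<open>The three densities\<close>

lemma exists_prime_host_size:
  "\<exists>p. prime p \<and> N \<le> p - (1 :: nat)"
proof -
  obtain p :: nat where "prime p" "N + 1 < p" using bigger_prime by blast
  then show ?thesis by (intro exI[of _ p]) simp
qed

text \<open>The hash condition alone, imposed on the complete \<open>k\<close>-graph.\<close>

lemma clique_cone_density_ge:
  assumes lk: "1 < l" "l < k" and m: "m = 32 * ((k - l) * k\<^sup>2)"
  shows "3 / 4 \<le> turan_density k l {clique_cone (k - l) l (m * (l - 1) + 1)}"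
proof -
  define q where "q = m * (l - 1) + 1"
  have k0: "0 < (k - l) * k\<^sup>2" using lk by simp
  then have m1: "0 < m" by (simp add: m)
  then have q: "l \<le> q" by (cases l) (simp_all add: q_def)
  interpret turan_problem k l "{clique_cone (k - l) l q}"
    by unfold_locales (use lk kgraph_clique_cone(2)[OF q] in auto)
  have "3 / 4 \<le> turan_density k l {clique_cone (k - l) l q}"
  proof (rule turan_density_ge)
    fix n0
    obtain p where p: "prime p" "n0 + k + 34 * ((k - l) * k\<^sup>2) \<le> p - 1" using exists_prime_host_size by blast
    define H where "H = hash_filter l m p ({1..<p}, nsets {1..<p} k)"
    have V: "verts H = {1..<p}" "card (verts H) = p - 1" by (simp_all add: H_def hash_filter_def)
    have "3 / 4 \<le> ratio (card (verts H))"
    proof (rule ratio_ge)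
      show "k \<le> card (verts H)" using p(2) V by simp
      show "kgraph k H" by (auto simp: kgraph_def H_def hash_filter_def)
      have "\<not> contains_copy H (clique_cone (k - l) l q)"
        unfolding q_def using lk m1 p(1)
        by (intro clique_cone_free_of_hash[where p = p]) (auto simp: H_def hash_filter_def prime_gt_0_nat)
      then show "family_free {clique_cone (k - l) l q} H" by (simp add: family_free_def)
      fix T assume "T \<in> nsets (verts H) l"
      then have T: "T \<in> nsets {1..<p} l" by (simp add: V)
      have "degree k ({1..<p}, nsets {1..<p} k) T = (p - 1 - l) choose (k - l)"
      proof -
        have T': "T \<subseteq> {1..<p}" "finite T" "card T = l" using T by (auto simp: nsets_def)
        have "{R \<in> nsets ({1..<p} - T) (k - l). T \<union> R \<in> nsets {1..<p} k} = nsets ({1..<p} - T) (k - l)"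
        proof (rule Collect_cong[THEN trans, of _ "\<lambda>R. R \<in> nsets ({1..<p} - T) (k - l)"])
          fix R
          have "T \<union> R \<in> nsets {1..<p} k" if R: "R \<in> nsets ({1..<p} - T) (k - l)"
          proof -
            have R': "R \<subseteq> {1..<p} - T" "finite R" "card R = k - l" using R by (auto simp: nsets_def)
            have "card (T \<union> R) = card T + card R" using R' T' by (intro card_Un_disjoint) auto
            then show ?thesis using R' T' lk by (auto simp: nsets_def)
          qed
          then show "(R \<in> nsets ({1..<p} - T) (k - l) \<and> T \<union> R \<in> nsets {1..<p} k)
            = (R \<in> nsets ({1..<p} - T) (k - l))" by blast
        qed simp
        then have "degree k ({1..<p}, nsets {1..<p} k) T = card (nsets ({1..<p} - T) (k - l))"
          by (simp only: degree_def fst_conv snd_conv T'(3))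
        then show ?thesis using T' by (simp add: card_Diff_subset)
      qed
      moreover have "real (degree k ({1..<p}, nsets {1..<p} k) T) - real ((p - 1 - l) choose (k - l)) / 4
        \<le> real (degree k H T)"
        unfolding H_def by (rule degree_hash_filter_ge[OF p(1) lk m _ _ T]) (use p(2) in simp_all)
      ultimately show "3 / 4 * real ((card (verts H) - l) choose (k - l)) \<le> real (degree k H T)"
        by (simp add: V(2))
    qed
    then show "\<exists>n\<ge>n0. 3 / 4 \<le> ratio n" using p(2) V(2) by (intro exI[of _ "card (verts H)"]) simp
  qed
  then show ?thesis by (simp add: q_def)
qed

lemma linked_grid_density_ge:
  assumes lk: "1 < l" "l < k" and F: "\<And>H :: nat hypergraph. contains_copy H F \<longleftrightarrow> contains_copy H (linked_grid k l)"
    and ne: "edges F \<noteq> {}"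
  shows "1 / 2 \<le> turan_density k l {F}"
proof -
  interpret turan_problem k l "{F}" by unfold_locales (use lk ne in auto)
  obtain J p s where p: "0 < p" "p < 1" and J: "0 \<notin> J" "k \<notin> J" "s \<le> l" "\<forall>b\<le>k - l. b \<notin> J \<or> s + b \<notin> J"
    and w: "\<forall>a\<le>l. 1 / 2 \<le> binomial_weight (k - l) p J a"
    using bicolouring_pattern[OF lk] by (elim exE conjE)
  show ?thesis
  proof (rule field_le_epsilon)
    fix \<epsilon> :: real assume e: "0 < \<epsilon>"
    from eventually_bicoloured_degree[OF less_imp_le[OF lk(2)] p w e, where 'a = nat]
    obtain n1 where n1: "\<forall>n\<ge>n1. \<forall>(V :: nat set) X T. finite V \<longrightarrow> card V = n \<longrightarrow> X \<subseteq> V \<longrightarrow>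
      card X = red_count p n \<longrightarrow> T \<in> nsets V l \<longrightarrow>
      (1 / 2 - \<epsilon>) * real ((n - l) choose (k - l)) \<le> real (degree k (bicoloured_host k J V X) T)"
      unfolding eventually_at_top_linorder by (elim exE)
    have "1 / 2 - \<epsilon> \<le> turan_density k l {F}"
    proof (rule turan_density_ge)
      fix n0
      define n where "n = n0 + n1 + k"
      define H where "H = bicoloured_host k J {..<n} {..<red_count p n}"
      have V: "verts H = {..<n}" by (simp add: H_def bicoloured_host_def)
      have "1 / 2 - \<epsilon> \<le> ratio (card (verts H))"
      proof (rule ratio_ge)
        show "k \<le> card (verts H)" by (simp add: V n_def)
        show "kgraph k H" by (auto simp: kgraph_def H_def bicoloured_host_def)
        have "\<not> contains_copy H (linked_grid k l)"
          using lk J by (intro linked_grid_free_of_bicoloured[of l k J s _ "{..<red_count p n}"])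
            (auto simp: H_def bicoloured_host_def)
        then show "family_free {F} H" by (simp add: family_free_def F)
        fix T assume "T \<in> nsets (verts H) l"
        then have T: "T \<in> nsets {..<n} l" by (simp only: V)
        have "(1 / 2 - \<epsilon>) * real ((n - l) choose (k - l)) \<le> real (degree k H T)"
          unfolding H_def using red_count_le[OF p, of n]
          by (intro n1[rule_format] T) (simp_all add: n_def)
        then show "(1 / 2 - \<epsilon>) * real ((card (verts H) - l) choose (k - l)) \<le> real (degree k H T)"
          by (simp only: V card_lessThan)
      qed
      then show "\<exists>n\<ge>n0. 1 / 2 - \<epsilon> \<le> ratio n" by (intro exI[of _ n]) (simp add: V n_def)
    qed
    then show "1 / 2 \<le> turan_density k l {F} + \<epsilon>" by simp
  qed
qed

text \<open>Both conditions together: the colouring leaves degrees of at least \<open>1/2 - 1/8\<close> of the maximum, and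
  the hash condition costs at most another quarter of the maximum.\<close>

lemma joint_density_ge:
  assumes lk: "1 < l" "l < k" and F: "\<And>H :: nat hypergraph. contains_copy H F \<longleftrightarrow> contains_copy H (linked_grid k l)"
    and ne: "edges F \<noteq> {}" and m: "m = 32 * ((k - l) * k\<^sup>2)"
  shows "1 / 8 \<le> turan_density k l {F, clique_cone (k - l) l (m * (l - 1) + 1)}"
proof -
  define q where "q = m * (l - 1) + 1"
  have k0: "0 < (k - l) * k\<^sup>2" using lk by simp
  then have m1: "0 < m" by (simp add: m)
  then have q: "l \<le> q" by (cases l) (simp_all add: q_def)
  interpret turan_problem k l "{F, clique_cone (k - l) l q}"
    by unfold_locales (use lk ne kgraph_clique_cone(2)[OF q] in auto)
  obtain J c s where c: "0 < c" "c < 1" and J: "0 \<notin> J" "k \<notin> J" "s \<le> l" "\<forall>b\<le>k - l. b \<notin> J \<or> s + b \<notin> J"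
    and w: "\<forall>a\<le>l. 1 / 2 \<le> binomial_weight (k - l) c J a"
    using bicolouring_pattern[OF lk] by (elim exE conjE)
  have e: "0 < (1 / 8 :: real)" by simp
  from eventually_bicoloured_degree[OF less_imp_le[OF lk(2)] c w e, where 'a = nat]
    obtain n1 where n1: "\<forall>n\<ge>n1. \<forall>(V :: nat set) X T. finite V \<longrightarrow> card V = n \<longrightarrow> X \<subseteq> V \<longrightarrow>
      card X = red_count c n \<longrightarrow> T \<in> nsets V l \<longrightarrow>
      (1 / 2 - 1 / 8) * real ((n - l) choose (k - l)) \<le> real (degree k (bicoloured_host k J V X) T)"
      unfolding eventually_at_top_linorder by (elim exE)
  have "1 / 8 \<le> turan_density k l {F, clique_cone (k - l) l q}"
  proof (rule turan_density_ge)
    fix n0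
    obtain p where p: "prime p" "n0 + n1 + k + 34 * ((k - l) * k\<^sup>2) \<le> p - 1" using exists_prime_host_size by blast
    have "red_count c (p - 1) \<le> card {1..<p}" using red_count_le[OF c] by simp
    then obtain X where X: "X \<subseteq> {1..<p}" "card X = red_count c (p - 1)" "finite X"
      by (rule obtain_subset_with_card_n)
    define G where "G = bicoloured_host k J {1..<p} X"
    define H where "H = hash_filter l m p G"
    have VG: "verts G = {1..<p}" by (simp add: G_def bicoloured_host_def)
    have V: "verts H = {1..<p}" "card (verts H) = p - 1" by (simp_all add: H_def hash_filter_def VG)
    have "1 / 8 \<le> ratio (card (verts H))"
    proof (rule ratio_ge)
      show "k \<le> card (verts H)" using p(2) V by simp
      show "kgraph k H" by (auto simp: kgraph_def H_def G_def bicoloured_host_def hash_filter_def)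
      have "\<not> contains_copy H (clique_cone (k - l) l q)"
        unfolding q_def using lk m1 p(1)
        by (intro clique_cone_free_of_hash[where p = p]) (auto simp: H_def hash_filter_def prime_gt_0_nat)
      moreover have "\<not> contains_copy H (linked_grid k l)"
        using lk J by (intro linked_grid_free_of_bicoloured[of l k J s _ X])
          (auto simp: H_def G_def hash_filter_def bicoloured_host_def)
      ultimately show "family_free {F, clique_cone (k - l) l q} H" by (simp add: family_free_def F)
      fix T assume "T \<in> nsets (verts H) l"
      then have T: "T \<in> nsets {1..<p} l" by (simp add: V)
      have "(1 / 2 - 1 / 8) * real ((p - 1 - l) choose (k - l)) \<le> real (degree k G T)"
        unfolding G_def using p(2) by (intro n1[rule_format] X(1,2) T) simp_all
      moreover have "real (degree k G T) - real ((p - 1 - l) choose (k - l)) / 4 \<le> real (degree k H T)"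
        unfolding H_def by (rule degree_hash_filter_ge[OF p(1) lk m _ VG T]) (use p(2) in simp)
      ultimately show "1 / 8 * real ((card (verts H) - l) choose (k - l)) \<le> real (degree k H T)"
        by (simp add: V(2))
    qed
    then show "\<exists>n\<ge>n0. 1 / 8 \<le> ratio n" using p(2) V(2) by (intro exI[of _ "card (verts H)"]) simp
  qed
  then show ?thesis by (simp add: q_def)
qed

lemma joint_density_less_half:
  assumes lk: "1 < l" "l < k" and F: "\<And>H :: nat hypergraph. contains_copy H F \<longleftrightarrow> contains_copy H (linked_grid k l)"
    and ne: "edges F \<noteq> {}" and q: "l \<le> q"
  shows "turan_density k l {F, clique_cone (k - l) l q} < 1 / 2"
proof -
  interpret turan_problem k l "{F, clique_cone (k - l) l q}"
    by unfold_locales (use lk ne kgraph_clique_cone(2)[OF q] in auto)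
  have l0: "0 < l" using lk by simp
  obtain \<eta> n0 where e: "0 < \<eta>" and n0: "\<forall>H :: nat hypergraph. kgraph k H \<longrightarrow> n0 \<le> card (verts H) \<longrightarrow>
    (\<forall>T\<in>nsets (verts H) l. (1 / 2 - \<eta>) * real ((card (verts H) - l) choose (k - l)) \<le> real (degree k H T)) \<longrightarrow>
    contains_copy H (linked_grid k l) \<or> contains_copy H (clique_cone (k - l) l q)"
    using linked_grid_or_clique_cone[OF l0 lk(2) q, where 'a = nat] by (elim exE conjE)
  have "turan_density k l {F, clique_cone (k - l) l q} \<le> 1 / 2 - \<eta>"
  proof (rule turan_density_le)
    fix n assume n: "max n0 k \<le> n"
    then have kn: "k \<le> n" by simp
    obtain H :: "nat hypergraph" where H: "kgraph k H" "card (verts H) = n"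
      "family_free {F, clique_cone (k - l) l q} H"
      "\<And>T. T \<in> nsets (verts H) l \<Longrightarrow> ratio n * real ((n - l) choose (k - l)) \<le> real (degree k H T)"
      using ratio_attained[OF kn] by blast
    show "ratio n \<le> 1 / 2 - \<eta>"
    proof (rule ccontr)
      assume "\<not> ?thesis"
      then have gt: "1 / 2 - \<eta> \<le> ratio n" by simp
      have "(1 / 2 - \<eta>) * real ((card (verts H) - l) choose (k - l)) \<le> real (degree k H T)"
        if T: "T \<in> nsets (verts H) l" for T
      proof -
        have "(1 / 2 - \<eta>) * real ((n - l) choose (k - l)) \<le> ratio n * real ((n - l) choose (k - l))"
          using gt by (rule mult_right_mono) simp
        then show ?thesis using H(4)[OF T] by (simp add: H(2))
      qed
      moreover have "n0 \<le> card (verts H)" using n H(2) by simp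
      ultimately have "contains_copy H (linked_grid k l) \<or> contains_copy H (clique_cone (k - l) l q)"
        using n0 H(1) by blast
      then show False using H(3) by (simp add: family_free_def F)
    qed
  qed
  then show ?thesis using e by simp
qed

theorem theorem1p3:
  fixes k l :: nat
  assumes "1 < l" and "l < k"
  shows "\<exists>F1 F2 :: nat hypergraph.
           kgraph k F1 \<and> edges F1 \<noteq> {} \<and> kgraph k F2 \<and> edges F2 \<noteq> {} \<and>
           0 < turan_density k l {F1, F2} \<and>
           turan_density k l {F1, F2} < min (turan_density k l {F1}) (turan_density k l {F2})"
proof -
  have kg: "kgraph k (linked_grid k l)" by (rule kgraph_linked_grid[OF assms(2)])
  then have "finite (verts (linked_grid k l))" by (simp add: kgraph_def)
  \<comment> \<open>The vertices of the linked grid have to be turned into natural numbers.\<close>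
  from finite_imp_inj_to_nat_seg[OF this]
  obtain h :: "grid_vertex \<Rightarrow> nat" where h: "inj_on h (verts (linked_grid k l))"
    by (elim exE conjE)
  define F1 where "F1 = relabel h (linked_grid k l)"
  have copy: "contains_copy H F1 \<longleftrightarrow> contains_copy H (linked_grid k l)" for H :: "nat hypergraph"
    unfolding F1_def
  proof (rule contains_copy_relabel[OF h])
    show "e \<subseteq> verts (linked_grid k l)" if "e \<in> edges (linked_grid k l)" for e
      using kg that unfolding kgraph_def nsets_def by blast
  qed
  have F1: "kgraph k F1" unfolding F1_def by (rule kgraph_relabel[OF kg h])
  have "Inl ` transversal k (\<lambda>_. 0) \<in> edges (linked_grid k l)"
    by (rule transversal_edge) (use assms in simp)
  then have "h ` Inl ` transversal k (\<lambda>_. 0) \<in> edges F1"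
    unfolding F1_def relabel_def snd_conv by (rule image_eqI[OF refl])
  then have F1e: "edges F1 \<noteq> {}" by (metis empty_iff)
  define m where "m = 32 * ((k - l) * k\<^sup>2)"
  define q where "q = m * (l - 1) + 1"
  define F2 where "F2 = clique_cone (k - l) l q"
  have "0 < (k - l) * k\<^sup>2" using assms by simp
  then have "0 < m" by (simp add: m_def)
  then have q: "l \<le> q" by (cases l) (simp_all add: q_def)
  have F2: "kgraph k F2" "edges F2 \<noteq> {}"
    using kgraph_clique_cone[OF q, of "k - l"] assms by (simp_all add: F2_def)
  have "0 < turan_density k l {F1, F2}"
    using joint_density_ge[OF assms copy F1e m_def] by (simp add: F2_def q_def)
  moreover have "turan_density k l {F1, F2} < 1 / 2"
    unfolding F2_def by (rule joint_density_less_half[OF assms copy F1e q])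
  moreover have "1 / 2 \<le> turan_density k l {F1}" by (rule linked_grid_density_ge[OF assms copy F1e])
  moreover have "1 / 2 \<le> turan_density k l {F2}"
    using clique_cone_density_ge[OF assms m_def] by (simp add: F2_def q_def)
  ultimately have "kgraph k F1 \<and> edges F1 \<noteq> {} \<and> kgraph k F2 \<and> edges F2 \<noteq> {} \<and>
      0 < turan_density k l {F1, F2} \<and>
      turan_density k l {F1, F2} < min (turan_density k l {F1}) (turan_density k l {F2})"
    using F1 F1e F2 by simp
  then show ?thesis by blast
qed

end
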